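(* Let $p\ge q\ge 1$, $n=p+q$, and consider the action of $SU(p,q)$ on the manifold $Z$ of complete flags in $\mathbb{C}^n$. A Schubert variety $S_w$ (with respect to $B_I$) that intersects at least one open $SU(p,q)$-orbit is parametrized by an element $w\in\Sigma_n^I$ of length $pq$ if and only if $w$ satisfies the strictly pairing condition. Under this condition $S_w$ intersects exactly $2^q$ open orbits, and it intersects the base cycle in each one of them in precisely one point. Moreover, the map $f:\mathcal{I}_{p,q}\to\mathcal{P}(\mathrm{Fix}(T))$, $S_w\mapsto T_w$, is injective, and $f(S_w)$ consists of the points of intersection of $S_w$ with the base cycles inside the $2^q$ open orbits.
   Context: $G=SL(n,\mathbb{C})$; $G_0=SU(p,q)$ is the isometry group (of determinant 1) of $h(v,w)=-\sum_{i=1}^qv_i\bar w_i+\sum_{i=1}^pv_{q+i}\bar w_{q+i}$; $K_0=S(U(q)\times U(p))$ is block diagonal. The base cycle of an open $G_0$-orbit $D\subset Z$ is the unique $K_0$-orbit in $D$ that is a complex submanifold. $T\subset G$ is the torus of diagonal matrices, $\mathrm{Fix}(T)$ the set of its fixed points in $Z$ (the coordinate flags of the standard basis), and $\mathcal{P}(\cdot)$ denotes the power set. Let $(u_1,\dots,u_n)=(e_1+e_{2q},\dots,e_q+e_{q+1},e_{2q+1},\dots,e_n,e_q-e_{q+1},\dots,e_1-e_{2q})$, so $u_i=e_i+e_{2q-i+1}$ and $u_{n-i+1}=e_i-e_{2q-i+1}$ for $i\le q$. $B_I$ is the (Iwasawa–)Borel subgroup stabilizing the complete flag of this ordered basis.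 $\Sigma_n^I$ is the permutation group, $w\in\Sigma_n^I$ (one-line notation) corresponding to the flag with $k$-th subspace $\langle u_{w(1)},\dots,u_{w(k)}\rangle$; $S_w$ is the closure of the $B_I$-orbit of this flag. The length $|w|$ is the number of inversions. $\Sigma_n^T$ is the permutation group, $v\in\Sigma_n^T$ corresponding to the coordinate flag with $k$-th subspace $\langle e_{v(1)},\dots,e_{v(k)}\rangle$. The canonical isomorphism $\gamma_I:\Sigma_n^I\to\Sigma_n^T$ replaces each entry $i$ of the one-line notation by $\gamma(i)$, where $\gamma(i)=i$ if $i\le q$, $\gamma(i)=i+q$ if $q<i\le p$, $\gamma(i)=i-p+q$ if $i>p$. Strictly pairing condition: $w$ is constructed by placing, for $i=1,2,\dots,q$ in this order, the pair $(n-i+1,i)$ (with $n-i+1$ to the left of $i$) into two empty boxes of a row of $n$ boxes which are adjacent after ignoring the already filled boxes; afterwards the numbers $q+1,\dots,p$ (if $p>q$) are placed in the remaining boxes in increasing order. $\mathcal{I}_{p,q}$ is the set of Schubert varieties $S_w$ that intersect at least one open orbit and have $|w|=pq$. For $w$ satisfying the strictly pairing condition, $Perm_w$ is the set of all $\gamma_I(w')$ where $w'$ is obtained from $w$ by making none, some or all of the transpositions interchanging $n-i+1$ and $i$ ($1\le i\le q$), and $T_w\subset\mathrm{Fix}(T)$ is the set of complete coordinate flags associated with the elements of $Perm_w$. *)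

theory Defs
  imports "HOL-Analysis.Analysis" "HOL-Combinatorics.Permutations"
begin

section \<open>Complete flags\<close>

text \<open>
  Vectors live in \<open>complex^'n\<close>, where the finite linear order \<open>'n\<close> has \<open>n\<close> elements;
  \<open>idx i\<close> is its \<open>i\<close>-th element, counted from 1, and \<open>e i\<close> the \<open>i\<close>-th standard basis vector.
\<close>

definition idx :: "nat \<Rightarrow> 'n::{finite,linorder}" where
  "idx i = (THE j. card {..j} = i)"

definition e :: "nat \<Rightarrow> complex^'n::{finite,linorder}" where
  "e i = axis (idx i) 1"

text \<open>
  A flag is the function sending \<open>k\<close> to its \<open>k\<close>-dimensional subspace. For \<open>k \<ge> n\<close> the value
  is forced to be the whole space, so flags are equal iff their subspaces agree.
\<close>

type_synonym 'n flag = "nat \<Rightarrow> (complex^'n) set"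

definition flags :: "'n::finite flag set" where
  "flags = {F. mono F \<and> (\<forall>k. vec.subspace (F k) \<and> vec.dim (F k) = min k CARD('n))}"

definition flag_of :: "(nat \<Rightarrow> complex^'n::finite) \<Rightarrow> 'n flag" where
  "flag_of b = (\<lambda>k. vec.span (b ` {1..k}))"

definition act :: "complex^'n^'n \<Rightarrow> 'n::finite flag \<Rightarrow> 'n flag" where
  "act g F = (\<lambda>k. (*v) g ` F k)"

definition orbit :: "(complex^'n^'n) set \<Rightarrow> 'n::finite flag \<Rightarrow> 'n flag set" where
  "orbit H F = (\<lambda>g. act g F) ` H"

definition SL :: "(complex^'n::finite^'n) set" where
  "SL = {g. det g = 1}"

definition std_flag :: "'n::{finite,linorder} flag" where
  "std_flag = flag_of e"

text \<open>The quotient topology along \<open>SL \<rightarrow> flags\<close>, \<open>g \<mapsto> act g std_flag\<close>.\<close>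

definition flag_topology :: "'n::{finite,linorder} flag topology" where
  "flag_topology = topology (\<lambda>U. U \<subseteq> flags \<and>
     openin (top_of_set SL) {g \<in> SL. act g std_flag \<in> U})"

lemma openin_flag_topology:
  "openin flag_topology U \<longleftrightarrow>
     U \<subseteq> flags \<and> openin (top_of_set SL) {g \<in> SL. act g std_flag \<in> U}"
proof -
  have "istopology (\<lambda>U::'a flag set. U \<subseteq> flags \<and>
          openin (top_of_set SL) {g \<in> SL. act g std_flag \<in> U})"
    unfolding istopology_def
  proof (intro conjI allI impI)
    fix S T :: "'a flag set"
    assume S: "S \<subseteq> flags \<and> openin (top_of_set SL) {g \<in> SL. act g std_flag \<in> S}"
      and T: "T \<subseteq> flags \<and> openin (top_of_set SL) {g \<in> SL. act g std_flag \<in> T}"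
    show "S \<inter> T \<subseteq> flags" using S by blast
    have "{g \<in> SL. act g std_flag \<in> S \<inter> T} =
        {g \<in> SL. act g std_flag \<in> S} \<inter> {g \<in> SL. act g std_flag \<in> T}" by blast
    then show "openin (top_of_set SL) {g \<in> SL. act g std_flag \<in> S \<inter> T}"
      using S T by (simp add: openin_Int)
  next
    fix K :: "'a flag set set"
    assume K: "\<forall>S\<in>K. S \<subseteq> flags \<and> openin (top_of_set SL) {g \<in> SL. act g std_flag \<in> S}"
    show "\<Union>K \<subseteq> flags" using K by blast
    have "{g \<in> SL. act g std_flag \<in> \<Union>K} = (\<Union>S\<in>K. {g \<in> SL. act g std_flag \<in> S})" by blast
    then show "openin (top_of_set SL) {g \<in> SL. act g std_flag \<in> \<Union>K}"
      using K by (auto intro: openin_Union)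
  qed
  then show ?thesis
    by (simp add: flag_topology_def topology_inverse')
qed

section \<open>Complex submanifolds\<close>

text \<open>
  Submanifolds are embedded. The dimension of \<open>L\<close> may depend on the point; it is constant for
  orbits, the only sets to which the notion is applied.
\<close>

definition holomorphic_map_on :: "(complex^'m \<Rightarrow> complex^'k) \<Rightarrow> (complex^'m::finite) set \<Rightarrow> bool" where
  "holomorphic_map_on f U \<longleftrightarrow>
     (\<forall>x\<in>U. \<exists>f'. (f has_derivative f') (at x) \<and> Vector_Spaces.linear (*s) (*s) f')"

definition complex_submanifold :: "(complex^'m::finite) set \<Rightarrow> bool" where
  "complex_submanifold S \<longleftrightarrow>
     (\<forall>x\<in>S. \<exists>U V (\<phi> :: complex^'m \<Rightarrow> complex^'m) \<psi> L. open U \<and> x \<in> U \<and> open V \<and> homeomorphism U V \<phi> \<psi> \<and>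
        holomorphic_map_on \<phi> U \<and> holomorphic_map_on \<psi> V \<and>
        vec.subspace L \<and> \<phi> ` (S \<inter> U) = L \<inter> V)"

text \<open>
  The complex structure on \<open>flags\<close> is given by the charts \<open>X \<mapsto> g (1 + X) \<cdot> std_flag\<close>, for
  \<open>g \<in> SL\<close>, which parametrize the translated big cells by the strictly lower triangular matrices
  \<open>X\<close>. The entries of \<open>X\<close> are indexed by pairs, so that \<open>X\<close> ranges over a complex linear
  subspace of \<open>complex^('n \<times> 'n)\<close>; a subset of such a subspace is a submanifold of the subspace
  iff it is one of the ambient space.
\<close>

definition strictly_lower :: "(complex^('n::{finite,linorder} \<times> 'n)) set" where
  "strictly_lower = {X. \<forall>i j. i \<le> j \<longrightarrow> X $ (i, j) = 0}"

definition flag_chart ::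
    "complex^'n::{finite,linorder}^'n::{finite,linorder} \<Rightarrow> complex^('n \<times> 'n) \<Rightarrow> 'n flag" where
  "flag_chart g X = act (g ** (mat 1 + (\<chi> i j. X $ (i, j)))) std_flag"

definition flag_submanifold :: "'n::{finite,linorder} flag set \<Rightarrow> bool" where
  "flag_submanifold C \<longleftrightarrow> C \<subseteq> flags \<and>
     (\<forall>g\<in>SL. complex_submanifold {X \<in> strictly_lower. flag_chart g X \<in> C})"

section \<open>Open orbits and base cycles\<close>

definition herm :: "nat \<Rightarrow> nat \<Rightarrow> complex^'n::{finite,linorder} \<Rightarrow> complex^'n::{finite,linorder} \<Rightarrow> complex" where
  "herm p q v w = - (\<Sum>i=1..q. v $ idx i * cnj (w $ idx i))
                  + (\<Sum>i=1..p. v $ idx (q + i) * cnj (w $ idx (q + i)))"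

definition SU :: "nat \<Rightarrow> nat \<Rightarrow> (complex^'n::{finite,linorder}^'n::{finite,linorder}) set" where
  "SU p q = {g \<in> SL. \<forall>v w. herm p q (g *v v) (g *v w) = herm p q v w}"

definition unitary :: "complex^'n::finite^'n \<Rightarrow> bool" where
  "unitary g \<longleftrightarrow> (\<chi> i j. cnj (g $ j $ i)) ** g = mat 1"

text \<open>\<open>S(U(q) \<times> U(p))\<close>: a block diagonal matrix is unitary iff both of its blocks are.\<close>

definition K0 :: "nat \<Rightarrow> nat \<Rightarrow> (complex^'n::{finite,linorder}^'n::{finite,linorder}) set" where
  "K0 p q = {g \<in> SL. unitary g \<and>
     (\<forall>i\<in>{1..q}. \<forall>j\<in>{q+1..p+q}. g $ idx i $ idx j = 0 \<and> g $ idx j $ idx i = 0)}"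

definition open_orbits :: "nat \<Rightarrow> nat \<Rightarrow> 'n::{finite,linorder} flag set set" where
  "open_orbits p q = {D. (\<exists>F\<in>flags. D = orbit (SU p q) F) \<and> openin flag_topology D}"

definition base_cycle ::
    "nat \<Rightarrow> nat \<Rightarrow> 'n::{finite,linorder} flag set \<Rightarrow> 'n flag set" where
  "base_cycle p q D =
     (THE C. (\<exists>F\<in>D. C = orbit (K0 p q) F) \<and> C \<subseteq> D \<and> flag_submanifold C)"

section \<open>Schubert varieties\<close>

definition u :: "nat \<Rightarrow> nat \<Rightarrow> nat \<Rightarrow> complex^'n::{finite,linorder}" where
  "u p q i =
     (if i \<le> q then e i + e (2 * q - i + 1)
      else if i \<le> p then e (q + i)
      else let j = p + q - i + 1 in e j - e (2 * q - j + 1))"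

definition B_I :: "nat \<Rightarrow> nat \<Rightarrow> (complex^'n::{finite,linorder}^'n::{finite,linorder}) set" where
  "B_I p q = {g \<in> SL. act g (flag_of (u p q)) = flag_of (u p q)}"

text \<open>
  A permutation \<open>w\<close> of \<open>{1..n}\<close> with one-line notation \<open>w(1), \<dots>, w(n)\<close> is a function
  with \<open>w permutes {1..n}\<close>.
\<close>

definition schubert ::
    "nat \<Rightarrow> nat \<Rightarrow> (nat \<Rightarrow> nat) \<Rightarrow> 'n::{finite,linorder} flag set" where
  "schubert p q w = flag_topology closure_of orbit (B_I p q) (flag_of (u p q \<circ> w))"

definition perm_length :: "nat \<Rightarrow> (nat \<Rightarrow> nat) \<Rightarrow> nat" where
  "perm_length n w = card {(i, j). 1 \<le> i \<and> i < j \<and> j \<le> n \<and> w j < w i}"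

definition met_orbits ::
    "nat \<Rightarrow> nat \<Rightarrow> 'n::{finite,linorder} flag set \<Rightarrow> 'n flag set set" where
  "met_orbits p q S = {D \<in> open_orbits p q. S \<inter> D \<noteq> {}}"

definition Ipq :: "nat \<Rightarrow> nat \<Rightarrow> 'n::{finite,linorder} flag set set" where
  "Ipq p q = {schubert p q w | w.
     w permutes {1..p+q} \<and> perm_length (p + q) w = p * q \<and>
     met_orbits p q (schubert p q w :: 'n flag set) \<noteq> {}}"

section \<open>The strictly pairing condition\<close>

text \<open>
  \<open>pairs_placed n i r\<close>: the partial filling \<open>r\<close> of the boxes \<open>1, \<dots>, n\<close> can arise by placing
  the first \<open>i\<close> pairs \<open>(n, 1), (n - 1, 2), \<dots>, (n - i + 1, i)\<close>.
\<close>

inductive pairs_placed :: "nat \<Rightarrow> nat \<Rightarrow> (nat \<rightharpoonup> nat) \<Rightarrow> bool" for n where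
  none: "pairs_placed n 0 Map.empty"
| place: "pairs_placed n (i - 1) r \<Longrightarrow> 1 \<le> i \<Longrightarrow>
     a \<in> {1..n} - dom r \<Longrightarrow> b \<in> {1..n} - dom r \<Longrightarrow> a < b \<Longrightarrow> {a<..<b} \<subseteq> dom r \<Longrightarrow>
     pairs_placed n i (r(a \<mapsto> n - i + 1, b \<mapsto> i))"

definition strictly_pairing :: "nat \<Rightarrow> nat \<Rightarrow> (nat \<Rightarrow> nat) \<Rightarrow> bool" where
  "strictly_pairing p q w \<longleftrightarrow> w permutes {1..p+q} \<and>
     (\<exists>r. pairs_placed (p + q) q r \<and> (\<forall>k\<in>dom r. r k = Some (w k)) \<and>
          w ` ({1..p+q} - dom r) = {q+1..p} \<and> strict_mono_on ({1..p+q} - dom r) w)"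

section \<open>The coordinate flags associated with a Schubert variety\<close>

definition \<gamma> :: "nat \<Rightarrow> nat \<Rightarrow> nat \<Rightarrow> nat" where
  "\<gamma> p q i =
     (if i \<le> q then i
      else if i \<le> p then i + q
      else if i \<le> p + q then i - p + q
      else i)"

definition \<gamma>_I :: "nat \<Rightarrow> nat \<Rightarrow> (nat \<Rightarrow> nat) \<Rightarrow> nat \<Rightarrow> nat" where
  "\<gamma>_I p q w = \<gamma> p q \<circ> w"

text \<open>The list \<open>is\<close> enumerates the (disjoint, hence commuting) transpositions that are made.\<close>

definition Perm :: "nat \<Rightarrow> nat \<Rightarrow> (nat \<Rightarrow> nat) \<Rightarrow> (nat \<Rightarrow> nat) set" where
  "Perm p q w = {\<gamma>_I p q (foldr (\<lambda>i. (\<circ>) (Transposition.transpose (p + q - i + 1) i)) is w) | is.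
     distinct is \<and> set is \<subseteq> {1..q}}"

definition coord_flags :: "nat \<Rightarrow> nat \<Rightarrow> (nat \<Rightarrow> nat) \<Rightarrow> 'n::{finite,linorder} flag set" where
  "coord_flags p q w = {flag_of (e \<circ> v) | v. v \<in> Perm p q w}"

definition Fix_T :: "'n::{finite,linorder} flag set" where
  "Fix_T = {F \<in> flags. \<forall>t\<in>SL. (\<forall>i j. i \<noteq> j \<longrightarrow> t $ i $ j = 0) \<longrightarrow> act t F = F}"

end

theory Submission
  imports Defs "HOL-Complex_Analysis.Conformal_Mappings"
begin

text \<open>
  A nondegenerate flag has a pseudo-orthonormal basis adapted to it, unique up to phases, and
  the open orbits are the sets of flags whose adapted bases have a given sign sequence. A complex
  submanifold that is a \<open>K0\<close>-orbit is locally invariant under the complexified center of \<open>K0\<close>, by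
  the identity theorem; hence it consists of flags spanned by positive and negative vectors for
  the splitting. For a nondegenerate flag in the cell of \<open>w\<close>, comparing its intersections with the
  isotropic subspaces \<open>V i\<close> and with their orthogonal complements shows that in every prefix of
  \<open>w\<close> the \<open>i\<close> largest letters are at least as frequent as the \<open>i\<close> smallest ones. Such a ballot word
  has at least \<open>p q\<close> inversions, with equality iff it is strictly pairing, and a strictly pairing
  word is minimal among ballot words in the Bruhat order; so inside the open orbits \<open>S_w\<close> agrees
  with its cell. There the vectors of the adapted basis at the two positions of each pair span a
  hyperbolic plane, which leaves one free sign per pair.
\<close>

text \<open>The number \<open>p q\<close> arises by peeling off outer pairs: in a ballot word the
  pair of \<open>n - i + 1\<close> and \<open>i\<close> accounts for \<open>n + 1 - 2 i\<close>
  inversions, plus one for each inner letter standing between its two entries, and the sum of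
  \<open>n + 1 - 2 i\<close> over \<open>i = 1, ..., q\<close> is \<open>p q\<close>. A letter
  trapped in a pair can be exchanged with one of its entries; this lowers the number of inversions
  and keeps the word ballot, so equality forces the pairs to be adjacent. \<open>base_cycle\<close>
  is a definite description, so all \<open>K0\<close>-orbits in an open orbit but one have to be
  excluded. What excludes them is that a real element of the complexified center stretches the two
  parts of the splitting by different factors, whereas \<open>K0\<close> preserves lengths. A
  nondegenerate flag in \<open>S_w\<close> lies in no cell but that of \<open>w\<close>. Hence the
  variety determines its word, which makes \<open>f\<close> independent of the word chosen for
  \<open>S_w\<close>, and the coordinate flags determine the word as well, which makes
  \<open>f\<close> injective.\<close>

type_synonym 'n cvec = "(complex, 'n) vec"
type_synonym 'n cmat = "((complex, 'n) vec, 'n) vec"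

section \<open>Frames and flags\<close>

text \<open>The inverse of \<open>idx\<close>, which is given by a definite description. It numbers
  the index type, so that sums, products and flags can be handled by the positions 1 to n.\<close>

definition rk :: "'n::{finite,linorder} \<Rightarrow> nat" where
  "rk j = card {..j}"

lemma rk_less_iff [simp]: "rk i < rk j \<longleftrightarrow> i < j"
proof -
  have *: "rk i < rk j" if "i < j" for i j :: "'a"
    unfolding rk_def by (rule psubset_card_mono) (use that in auto)
  show ?thesis
    using * by (metis less_asym linorder_neqE order_less_irrefl)
qed

lemma rk_le_iff [simp]: "rk i \<le> rk j \<longleftrightarrow> i \<le> j"
  by (meson linorder_not_less rk_less_iff)

lemma rk_eq_iff [simp]: "rk i = rk j \<longleftrightarrow> i = j"
  by (metis order_antisym order_refl rk_le_iff)

lemma rk_range: "rk (j::'n::{finite,linorder}) \<in> {1..CARD('n)}"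
  unfolding rk_def by (auto intro!: card_mono simp: Suc_le_eq card_gt_0_iff)

lemma bij_rk: "bij_betw rk (UNIV::'n::{finite,linorder} set) {1..CARD('n)}"
  unfolding bij_betw_def
proof
  show "inj (rk :: 'n \<Rightarrow> nat)" by (simp add: inj_def)
  then show "range (rk :: 'n \<Rightarrow> nat) = {1..CARD('n)}"
    using rk_range[where 'n='n] by (intro card_subset_eq) (auto simp: card_image)
qed

lemma idx_rk [simp]: "idx (rk j) = j"
  unfolding idx_def by (rule the_equality) (use rk_eq_iff rk_def in metis)+

lemma rk_idx: "i \<in> {1..CARD('n)} \<Longrightarrow> rk (idx i :: 'n::{finite,linorder}) = i"
  using bij_rk[where 'n='n] idx_rk unfolding bij_betw_def by (metis imageE)

lemma idx_eq_iff:
  "i \<in> {1..CARD('n)} \<Longrightarrow> j \<in> {1..CARD('n)} \<Longrightarrow> (idx i :: 'n::{finite,linorder}) = idx j \<longleftrightarrow> i = j"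
  by (metis rk_idx)

lemma bij_idx: "bij_betw idx {1..CARD('n)} (UNIV::'n::{finite,linorder} set)"
  by (rule bij_betw_byWitness[where f'=rk]) (use rk_range[where 'n='n] in \<open>auto simp: rk_idx\<close>)

lemma sum_idx: "(\<Sum>j\<in>UNIV. f j) = (\<Sum>i=1..CARD('n). f (idx i :: 'n::{finite,linorder}))"
  by (rule sum.reindex_bij_betw[OF bij_idx, symmetric])

lemma prod_idx: "(\<Prod>j\<in>UNIV. f j) = (\<Prod>i=1..CARD('n). f (idx i :: 'n::{finite,linorder}))"
  by (rule prod.reindex_bij_betw[OF bij_idx, symmetric])

lemma e_nth: "(e i :: 'n::{finite,linorder} cvec) $ j = (if j = idx i then 1 else 0)"
  by (simp add: e_def axis_def)

text \<open>Frames stand in for group elements: \<open>mat_of b\<close> carries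
  \<open>std_flag\<close> to \<open>flag_of b\<close> (\<open>act_mat_of\<close>), so it is enough
  to produce a basis and to correct its determinant afterwards.\<close>

definition mat_of :: "(nat \<Rightarrow> 'n::{finite,linorder} cvec) \<Rightarrow> 'n::{finite,linorder} cmat" where
  "mat_of b = (\<chi> i j. b (rk j) $ i)"

definition dg :: "(nat \<Rightarrow> complex) \<Rightarrow> 'n::{finite,linorder} cmat" where
  "dg f = (\<chi> i j. if i = j then f (rk i) else 0)"

lemma column_mat_of: "column j (mat_of b) = b (rk j)"
  by (simp add: column_def mat_of_def vec_eq_iff)

lemma columns_mat_of: "columns (mat_of b :: 'n::{finite,linorder} cmat) = b ` {1..CARD('n)}"
proof -
  have "columns (mat_of b :: 'n cmat) = b ` rk ` (UNIV::'n set)"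
    by (auto simp: columns_def column_mat_of)
  then show ?thesis using bij_rk[where 'n='n] by (simp add: bij_betw_def)
qed

lemma mult_axis: "(A :: 'n::finite cmat) *v axis k 1 = column k A"
  by (simp add: matrix_vector_mult_def column_def axis_def vec_eq_iff if_distrib cong: if_cong)

lemma mat_of_mult_e: 
  "k \<in> {1..CARD('n)} \<Longrightarrow> (mat_of b :: 'n::{finite,linorder} cmat) *v e k = b k"
  using rk_idx[of k, where 'n='n] by (simp add: e_def mult_axis column_mat_of)

lemma mat_mult_mat_of: "g ** mat_of b = mat_of (\<lambda>k. g *v b k)"
  by (simp add: mat_of_def matrix_matrix_mult_def matrix_vector_mult_def vec_eq_iff)

lemma mat_of_mult: "mat_of (b :: nat \<Rightarrow> 'n::{finite,linorder} cvec) *v x = (\<Sum>k=1..CARD('n). x $ idx k *s b k)"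
  by (simp add: vec_eq_iff mat_of_def matrix_vector_mult_def sum_idx rk_idx mult.commute)

lemma mat_of_dg: "mat_of b ** dg f = mat_of (\<lambda>k. f k *s b k)"
  by (simp add: mat_of_def dg_def matrix_matrix_mult_def vec_eq_iff if_distrib if_distribR mult.commute cong: if_cong)

lemma dg_mult_vec: "dg f *v x = (\<chi> i. f (rk i) * x $ i)"
  by (simp add: dg_def matrix_vector_mult_def vec_eq_iff if_distrib if_distribR cong: if_cong)

lemma dg_nth: "(dg f *v x) $ i = f (rk i) * x $ i"
  by (simp add: dg_mult_vec)

lemma det_dg: "det (dg f :: 'n::{finite,linorder} cmat) = (\<Prod>k=1..CARD('n). f k)"
proof -
  have "det (dg f :: 'n cmat) = (\<Prod>i\<in>UNIV. f (rk (i::'n)))"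
    by (subst det_diagonal) (auto simp: dg_def)
  also have "\<dots> = (\<Prod>k=1..CARD('n). f k)"
    by (simp add: prod_idx rk_idx)
  finally show ?thesis .
qed

lemma det_mat_of_scale:
  "det (mat_of (\<lambda>k. f k *s b k) :: 'n::{finite,linorder} cmat) = det (mat_of b :: 'n cmat) * (\<Prod>k=1..CARD('n). f k)"
  by (simp add: mat_of_dg[symmetric] det_mul det_dg)

text \<open>Independence of the image set does not notice repeated vectors; the injectivity clause
  excludes them.\<close>

definition frame :: "(nat \<Rightarrow> 'n::{finite,linorder} cvec) \<Rightarrow> bool" where
  "frame b \<longleftrightarrow> vec.independent (b ` {1..CARD('n)}) \<and> inj_on b {1..CARD('n)}"

lemma frame_span: "frame (b :: nat \<Rightarrow> 'n::{finite,linorder} cvec) \<Longrightarrow> vec.span (b ` {1..CARD('n)}) = UNIV"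
  using vec.card_ge_dim_independent[of "b ` {1..CARD('n)}" UNIV]
  by (auto simp: frame_def card_image card_cart_basis)

lemma frame_if_span:
  assumes "vec.span (b ` {1..CARD('n)}) = (UNIV :: ('n::{finite,linorder} cvec) set)"
  shows "frame b"
proof -
  have "CARD('n) \<le> card (b ` {1..CARD('n)})"
    using vec.dim_le_card[of UNIV "b ` {1..CARD('n)}"] assms by (simp add: card_cart_basis)
  then have "card (b ` {1..CARD('n)}) = CARD('n)"
    using card_image_le[of "{1..CARD('n)}" b] by simp
  then show ?thesis
    unfolding frame_def using assms vec.card_le_dim_spanning[of "b ` {1..CARD('n)}" UNIV]
    by (auto simp: card_cart_basis intro: eq_card_imp_inj_on)
qed

lemma frame_iff_det: "frame b \<longleftrightarrow> det (mat_of b :: 'n::{finite,linorder} cmat) \<noteq> 0"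
proof -
  have "det (mat_of b :: 'n cmat) \<noteq> 0 \<longleftrightarrow> vec.span (b ` {1..CARD('n)}) = UNIV"
    using invertible_det_nz[of "mat_of b"] invertible_right_inverse[of "mat_of b"]
      matrix_right_invertible_span_columns[of "mat_of b"]
    by (simp add: columns_mat_of)
  then show ?thesis using frame_span frame_if_span by blast
qed

lemma frame_dim:
  assumes "frame (b :: nat \<Rightarrow> 'n::{finite,linorder} cvec)" "A \<subseteq> {1..CARD('n)}"
  shows "vec.independent (b ` A)" "vec.dim (vec.span (b ` A)) = card A"
proof -
  show i: "vec.independent (b ` A)"
    using assms unfolding frame_def by (meson image_mono vec.independent_mono)
  show "vec.dim (vec.span (b ` A)) = card A"
    using vec.dim_span_eq_card_independent[OF i] assms card_image[of b A]
    by (metis frame_def inj_on_subset)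
qed

lemma frame_mult:
  assumes "frame b" "det g \<noteq> 0" shows "frame (\<lambda>k. g *v b k)"
  using assms by (simp add: frame_iff_det mat_mult_mat_of[symmetric] det_mul)

lemma frame_scale:
  assumes "frame (b :: nat \<Rightarrow> 'n::{finite,linorder} cvec)" "\<And>k. k \<in> {1..CARD('n)} \<Longrightarrow> f k \<noteq> 0" 
  shows "frame (\<lambda>k. f k *s b k)"
  using assms by (auto simp: frame_iff_det det_mat_of_scale)

lemma frame_e: "frame (e :: nat \<Rightarrow> 'n::{finite,linorder} cvec)"
proof -
  have "mat_of e = (mat 1 :: 'n cmat)"
    by (auto simp: mat_of_def mat_def vec_eq_iff e_nth)
  then show ?thesis by (simp add: frame_iff_det)
qed

lemma frame_cong: 
  assumes "\<And>k. k \<in> {1..CARD('n)} \<Longrightarrow> b k = c k"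
  shows "frame (b :: nat \<Rightarrow> 'n::{finite,linorder} cvec) \<longleftrightarrow> frame c"
proof -
  have "b ` {1..CARD('n)} = c ` {1..CARD('n)}" by (rule image_cong) (use assms in auto)
  moreover have "inj_on b {1..CARD('n)} = inj_on c {1..CARD('n)}" 
    by (rule inj_on_cong) (use assms in auto)
  ultimately show ?thesis unfolding frame_def by metis
qed

lemma frame_nonzero: "frame (b :: nat \<Rightarrow> 'n::{finite,linorder} cvec) \<Longrightarrow> k \<in> {1..CARD('n)} \<Longrightarrow> b k \<noteq> 0"
  unfolding frame_def using vec.dependent_zero by (metis imageI)

lemma flag_of_mono: "i \<le> j \<Longrightarrow> flag_of b i \<subseteq> flag_of b j"
  unfolding flag_of_def by (intro vec.span_mono image_mono) auto

lemma subspace_flag_of: "vec.subspace (flag_of b k)"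
  by (simp add: flag_of_def)

lemma flag_of_base: "1 \<le> i \<Longrightarrow> i \<le> k \<Longrightarrow> b i \<in> flag_of b k"
  unfolding flag_of_def by (rule vec.span_base) auto

lemma flag_of_0 [simp]: "flag_of b 0 = {0}"
  by (simp add: flag_of_def)

lemma flag_of_full: 
  "frame (b :: nat \<Rightarrow> 'n::{finite,linorder} cvec) \<Longrightarrow> CARD('n) \<le> k \<Longrightarrow> flag_of b k = UNIV"
  using flag_of_mono[of "CARD('n)" k b] frame_span[of b] by (auto simp: flag_of_def)

lemma dim_flag_of: 
  "frame (b :: nat \<Rightarrow> 'n::{finite,linorder} cvec) \<Longrightarrow> vec.dim (flag_of b k) = min k CARD('n)"
proof (cases "k \<le> CARD('n)")
  case True
  assume "frame b"
  then show ?thesis using frame_dim(2)[of b "{1..k}"] True by (simp add: flag_of_def)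
next
  case False
  assume "frame b"
  then show ?thesis using flag_of_full[of b k] False by (simp add: card_cart_basis)
qed

lemma flag_of_flags: "frame b \<Longrightarrow> flag_of b \<in> flags"
  by (auto simp: flags_def mono_def dim_flag_of subspace_flag_of dest: set_mp[OF flag_of_mono])

lemma flag_of_Suc: "flag_of b (Suc k) = vec.span (insert (b (Suc k)) (flag_of b k))"
proof -
  have "{1..Suc k} = insert (Suc k) {1..k}" by auto
  then show ?thesis
    unfolding flag_of_def by (simp add: vec.span_insert[where S="vec.span _"] vec.span_insert vec.span_span)
qed

lemma flag_of_step: 
  assumes "1 \<le> k" shows "x \<in> flag_of b k \<longleftrightarrow> (\<exists>c. x - c *s b k \<in> flag_of b (k - 1))"
proof -
  obtain m where m: "k = Suc m" using assms by (metis Suc_diff_le diff_Suc_1 plus_1_eq_Suc le_add_diff_inverse)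
  show ?thesis unfolding m flag_of_Suc by (simp add: vec.span_insert flag_of_def vec.span_span)
qed

lemma frame_notin:
  assumes "frame (b :: nat \<Rightarrow> 'n::{finite,linorder} cvec)" "k \<in> {1..CARD('n)}" 
  shows "b k \<notin> flag_of b (k - 1)"
proof
  assume *: "b k \<in> flag_of b (k - 1)"
  have "b ` {1..k-1} \<subseteq> b ` {1..CARD('n)} - {b k}"
  proof
    fix x assume "x \<in> b ` {1..k-1}"
    then obtain i where i: "i \<in> {1..k-1}" "x = b i" by blast
    then have "i \<in> {1..CARD('n)}" "i \<noteq> k" "x = b i" using assms(2) by auto
    then show "x \<in> b ` {1..CARD('n)} - {b k}"
      using assms inj_on_eq_iff[of b "{1..CARD('n)}" i k] unfolding frame_def by auto
  qed
  then have "b k \<in> vec.span (b ` {1..CARD('n)} - {b k})"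
    using * vec.span_mono unfolding flag_of_def by blast
  then show False using assms unfolding frame_def vec.dependent_def by blast
qed

text \<open>Two frames give subspaces of equal dimension at each level, so one inclusion forces
  equality.\<close>

lemma flag_of_eqI:
  assumes "frame (b :: nat \<Rightarrow> 'n::{finite,linorder} cvec)" "frame c"
    and "\<And>k. k \<in> {1..CARD('n)} \<Longrightarrow> b k \<in> flag_of c k"
  shows "flag_of b = flag_of c"
proof
  fix k
  show "flag_of b k = flag_of c k"
  proof (cases "k \<le> CARD('n)")
    case True
    have "b ` {1..k} \<subseteq> flag_of c k"
    proof
      fix x assume "x \<in> b ` {1..k}"
      then obtain i where "i \<in> {1..k}" "x = b i" by auto
      then show "x \<in> flag_of c k" using assms(3)[of i] True flag_of_mono[of i k c] by auto
    qed
    then have "flag_of b k \<subseteq> flag_of c k"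
      unfolding flag_of_def[of b] using subspace_flag_of vec.span_minimal by blast
    then show ?thesis using assms dim_flag_of subspace_flag_of vec.subspace_dim_equal by (metis order_refl)
  next
    case False then show ?thesis using assms flag_of_full by (metis nat_le_linear)
  qed
qed

lemma flag_of_cong:
  assumes "frame (b :: nat \<Rightarrow> 'n::{finite,linorder} cvec)" "\<And>k. k \<in> {1..CARD('n)} \<Longrightarrow> b k = c k"
  shows "flag_of b = flag_of c"
  by (rule flag_of_eqI) (use assms frame_cong[of b c] in \<open>auto intro: flag_of_base\<close>)

lemma flag_of_scale:
  assumes "frame (b :: nat \<Rightarrow> 'n::{finite,linorder} cvec)" "\<And>k. k \<in> {1..CARD('n)} \<Longrightarrow> f k \<noteq> 0" 
  shows "flag_of (\<lambda>k. f k *s b k) = flag_of b"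
  by (rule flag_of_eqI) 
    (use assms in \<open>auto intro!: frame_scale vec.subspace_scale subspace_flag_of flag_of_base\<close>)

text \<open>A triangular change of basis with nonzero diagonal. That \<open>b\<close> is a frame
  comes out of the induction: level by level it spans the same subspaces as \<open>c\<close>, and
  finally the whole space.\<close>

lemma triangular_frame:
  assumes "frame (c :: nat \<Rightarrow> 'n::{finite,linorder} cvec)"
    and "\<And>k. k \<in> {1..CARD('n)} \<Longrightarrow> b k \<in> flag_of c k - flag_of c (k - 1)"
  shows "frame b" "flag_of b = flag_of c"
proof -
  have "k \<le> CARD('n) \<Longrightarrow> flag_of b k = flag_of c k" for k
  proof (induction k)
    case (Suc k)
    then have IH: "flag_of b k = flag_of c k" by simp
    have b: "b (Suc k) \<in> flag_of c (Suc k)" "b (Suc k) \<notin> flag_of c k" using assms(2)[of "Suc k"] Suc by auto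
    then obtain a where a: "b (Suc k) - a *s c (Suc k) \<in> flag_of c k" using flag_of_step[of "Suc k"] by force
    have "a \<noteq> 0" using a b by auto
    have sub: "vec.subspace (flag_of c k)" by (rule subspace_flag_of)
    have 1: "x - d *s b (Suc k) \<in> flag_of c k \<Longrightarrow> x - (d * a) *s c (Suc k) \<in> flag_of c k" for x d
      using vec.subspace_add[OF sub _ vec.subspace_scale[OF sub a, of d]]
      by (fastforce simp: vec.scale_right_diff_distrib)
    have 2: "x - d *s c (Suc k) \<in> flag_of c k \<Longrightarrow> x - (d / a) *s b (Suc k) \<in> flag_of c k" for x d
      using vec.subspace_diff[OF sub _ vec.subspace_scale[OF sub a, of "d/a"], of "x - d *s c (Suc k)"] \<open>a \<noteq> 0\<close>
      by (simp add: vec.scale_right_diff_distrib)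
    show ?case
    proof (rule set_eqI)
      fix x
      have "x \<in> flag_of b (Suc k) \<longleftrightarrow> (\<exists>d. x - d *s b (Suc k) \<in> flag_of c k)"
        using flag_of_step[of "Suc k" x b] IH by simp
      also have "\<dots> \<longleftrightarrow> (\<exists>d. x - d *s c (Suc k) \<in> flag_of c k)"
        using 1 2 by blast
      also have "\<dots> \<longleftrightarrow> x \<in> flag_of c (Suc k)"
        using flag_of_step[of "Suc k" x c] by simp
      finally show "x \<in> flag_of b (Suc k) \<longleftrightarrow> x \<in> flag_of c (Suc k)" .
    qed
  qed simp
  then have "flag_of b CARD('n) = UNIV" using flag_of_full[OF assms(1)] by simp
  then show f: "frame b" by (intro frame_if_span) (simp add: flag_of_def)
  show "flag_of b = flag_of c" by (rule flag_of_eqI) (use f assms in auto)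
qed

lemma act_flag_of: "act g (flag_of b) = flag_of (\<lambda>k. g *v b k)"
  unfolding act_def flag_of_def
  by (simp add: vec.linear_span_image[OF matrix_vector_mul_linear_gen, symmetric] image_image)

lemma act_act: "act g (act k F) = act (g ** k) F"
  by (simp add: act_def fun_eq_iff image_image matrix_vector_mul_assoc)

lemma act_1 [simp]: "act (mat 1) F = F"
  by (simp add: act_def)

lemma act_std_flag: "act g std_flag = flag_of (\<lambda>k. g *v e k)"
  by (simp add: std_flag_def act_flag_of)

lemma act_mat_of: "frame b \<Longrightarrow> act (mat_of b) std_flag = flag_of b"
  unfolding act_std_flag
  by (rule flag_of_cong) (auto simp: mat_of_mult_e frame_iff_det mat_mult_mat_of[symmetric] det_mul
    frame_e[unfolded frame_iff_det])

lemma mat_of_columns: "mat_of (\<lambda>k. g *v e k) = g"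
  by (auto simp: mat_of_def vec_eq_iff e_def mult_axis column_def)

lemma frame_columns: "frame (\<lambda>k. g *v e k) \<longleftrightarrow> det g \<noteq> 0"
  by (simp add: frame_iff_det mat_of_columns)

text \<open>The dimension grows by one at each level, so some vector of \<open>F k\<close> lies
  outside \<open>F (k - 1)\<close>; any such choice of vectors spans the flag.\<close>

lemma flags_frame:
  assumes "F \<in> flags" obtains b :: "nat \<Rightarrow> 'n::{finite,linorder} cvec" where "frame b" "F = flag_of b"
proof -
  have F: "vec.subspace (F k)" "vec.dim (F k) = min k CARD('n)" "i \<le> j \<Longrightarrow> F i \<subseteq> F j" for i j k
    using assms by (auto simp: flags_def mono_def)
  have "\<exists>x. x \<in> F k - F (k - 1)" if "k \<in> {1..CARD('n)}" for k
  proof (rule ccontr)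
    assume "\<nexists>x. x \<in> F k - F (k - 1)"
    then have "F k = F (k - 1)" using F(3)[of "k - 1" k] by auto
    then have "min k CARD('n) = min (k - 1) CARD('n)" using F(2) by metis
    then show False using that by (auto simp: min_def split: if_splits)
  qed
  then obtain b where b: "\<And>k. k \<in> {1..CARD('n)} \<Longrightarrow> b k \<in> F k - F (k - 1)" by metis
  have *: "k \<le> CARD('n) \<Longrightarrow> flag_of b k = F k" for k
  proof (induction k)
    case 0
    then show ?case using F(1)[of 0] F(2)[of 0] vec.dim_eq_0[of "F 0"] vec.subspace_0[OF F(1)[of 0]] by auto
  next
    case (Suc k)
    then have IH: "flag_of b k = F k" by simp
    have bk: "b (Suc k) \<in> F (Suc k)" "b (Suc k) \<notin> F k" using b[of "Suc k"] Suc by auto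
    have sub: "flag_of b (Suc k) \<subseteq> F (Suc k)"
      unfolding flag_of_Suc IH by (rule vec.span_minimal) (use bk F in auto)
    have "vec.dim (flag_of b (Suc k)) = Suc k"
      unfolding flag_of_Suc IH using bk F(1)[of k] F(2)[of k] Suc
      by (simp add: vec.dim_insert vec.span_eq_iff[THEN iffD2] vec.dim_span)
    then show ?case using vec.subspace_dim_equal[OF subspace_flag_of F(1) sub] F(2)[of "Suc k"] by simp
  qed
  have "F CARD('n) = UNIV" using F(2)[of "CARD('n)"]
    by (intro vec.subspace_dim_equal F vec.subspace_UNIV) (simp_all add: card_cart_basis)
  then have f: "frame b" by (intro frame_if_span) (use *[of "CARD('n)"] in \<open>simp add: flag_of_def\<close>)
  moreover have "F = flag_of b"
  proof
    fix k show "F k = flag_of b k"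
    proof (cases "k \<le> CARD('n)")
      case False
      then show ?thesis using F(3)[of "CARD('n)" k] \<open>F CARD('n) = UNIV\<close> flag_of_full[OF f, of k] by auto
    qed (use * in auto)
  qed
  ultimately show ?thesis using that by blast
qed

lemma flags_iff: "F \<in> flags \<longleftrightarrow> (\<exists>b. frame b \<and> F = flag_of b)"
  using flags_frame flag_of_flags by metis

lemma act_flags: "det g \<noteq> 0 \<Longrightarrow> (F :: 'n::{finite,linorder} flag) \<in> flags \<Longrightarrow> act g F \<in> flags"
  using frame_mult unfolding flags_iff by (metis act_flag_of)

lemma std_flag_flags: "std_flag \<in> flags"
  by (simp add: std_flag_def flag_of_flags frame_e)

lemma one_le_card: "1 \<le> CARD('n::finite)"
  by (simp add: Suc_leI)

text \<open>Rescaling the first basis vector changes the determinant but not the flag.\<close>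

definition rescale :: "complex \<Rightarrow> nat \<Rightarrow> complex" where
  "rescale c = (\<lambda>k. if k = 1 then c else 1)"

lemma prod_rescale: "(\<Prod>k=1..CARD('n::finite). rescale c k) = c"
  using one_le_card[where 'n='n] by (simp add: rescale_def prod.delta)

lemma act_dg_rescale: "c \<noteq> 0 \<Longrightarrow> det g \<noteq> 0 \<Longrightarrow> act (g ** dg (rescale c)) std_flag = act g std_flag"
proof -
  assume *: "c \<noteq> 0" "det g \<noteq> 0"
  let ?b = "\<lambda>k. g *v e k"
  have b: "frame ?b" using * by (simp add: frame_columns)
  have r: "rescale c k \<noteq> 0" for k using * by (simp add: rescale_def)
  have "g ** dg (rescale c) = mat_of (\<lambda>k. rescale c k *s ?b k)"
    using mat_of_dg[of ?b "rescale c"] by (simp add: mat_of_columns)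
  then show ?thesis
    using act_mat_of[OF frame_scale[OF b r]] flag_of_scale[OF b r] by (simp add: act_std_flag)
qed

lemma det_dg_rescale: "det (g ** dg (rescale c) :: 'n::{finite,linorder} cmat) = det g * c"
  by (simp only: det_mul det_dg prod_rescale)

lemma flags_SL:
  assumes "F \<in> flags" obtains g where "g \<in> SL" "F = act g std_flag"
proof -
  obtain b where b: "frame b" "F = flag_of b" using assms flags_frame by blast
  let ?d = "det (mat_of b)"
  have d: "?d \<noteq> 0" using b frame_iff_det by blast
  show ?thesis
    by (rule that[of "mat_of b ** dg (rescale (1 / ?d))"])
      (use b d in \<open>simp_all add: SL_def det_dg_rescale act_dg_rescale act_mat_of\<close>)
qed

subsection \<open>The topology of the flag manifold\<close>

lemma continuous_on_det [continuous_intros]: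
  fixes f :: "'b::topological_space \<Rightarrow> 'n::finite cmat"
  assumes "\<And>i j. continuous_on S (\<lambda>x. f x $ i $ j)"
  shows "continuous_on S (\<lambda>x. det (f x))"
  unfolding det_def by (intro continuous_intros assms)

lemma open_det_nz: "open {g :: 'n::finite cmat. det g \<noteq> 0}"
proof -
  have "continuous_on UNIV (det :: 'n cmat \<Rightarrow> complex)"
    by (intro continuous_intros)
  then show ?thesis
    by (intro open_Collect_neq continuous_on_const)
qed

text \<open>\<open>SL\<close> is not open among the matrices, which is awkward for perturbation
  arguments. Dividing the first column by the determinant retracts the invertible matrices
  continuously onto \<open>SL\<close> without changing the flag, so openness can be tested on all
  invertible matrices.\<close>

lemma openin_flag_topology_GL:
  fixes A :: "'n::{finite,linorder} flag set"
  shows "openin flag_topology A \<longleftrightarrow> A \<subseteq> flags \<and> open {g. det g \<noteq> 0 \<and> act g std_flag \<in> A}"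
proof (intro iffI conjI; (elim conjE)?)
  assume A: "openin flag_topology A"
  then show "A \<subseteq> flags" by (simp add: openin_flag_topology)
  obtain T :: "('n cmat) set" where T: "open T" "{g \<in> SL. act g std_flag \<in> A} = SL \<inter> T"
    using A by (auto simp: openin_flag_topology openin_open)
  let ?f = "\<lambda>g :: 'n cmat. g ** dg (rescale (1 / det g))"
  have f: "?f g = (\<chi> i j. g $ i $ j * rescale (1 / det g) (rk j))" for g
    by (simp add: dg_def matrix_matrix_mult_def vec_eq_iff if_distrib if_distribR cong: if_cong)
  have "continuous_on {g. det g \<noteq> 0} ?f"
    unfolding f
  proof (intro continuous_on_vec_lambda)
    fix i j :: 'n
    show "continuous_on {g :: 'n cmat. det g \<noteq> 0} (\<lambda>g. g $ i $ j * rescale (1 / det g) (rk j))"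
      unfolding rescale_def by (cases "rk j = 1") (auto intro!: continuous_intros)
  qed
  then have "open ({g. det g \<noteq> 0} \<inter> ?f -` T)"
    using T open_det_nz continuous_open_preimage by blast
  moreover have "{g. det g \<noteq> 0 \<and> act g std_flag \<in> A} = {g. det g \<noteq> 0} \<inter> ?f -` T"
  proof -
    have "act g std_flag \<in> A \<longleftrightarrow> ?f g \<in> T" if "det g \<noteq> 0" for g
    proof -
      have "?f g \<in> SL" using that by (simp add: SL_def det_dg_rescale)
      then have "?f g \<in> T \<longleftrightarrow> act (?f g) std_flag \<in> A" using T(2) by blast
      then show ?thesis using that by (simp add: act_dg_rescale)
    qed
    then show ?thesis by auto
  qed
  ultimately show "open {g. det g \<noteq> 0 \<and> act g std_flag \<in> A}" by simp
next
  assume "A \<subseteq> flags" "open {g. det g \<noteq> 0 \<and> act g std_flag \<in> A}"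
  moreover have "{g \<in> SL. act g std_flag \<in> A} = SL \<inter> {g. det g \<noteq> 0 \<and> act g std_flag \<in> A}"
    by (auto simp: SL_def)
  ultimately show "openin flag_topology A" 
    by (auto simp: openin_flag_topology openin_open)
qed

lemma topspace_flag_topology: "topspace flag_topology = (flags :: 'n::{finite,linorder} flag set)"
proof
  show "topspace flag_topology \<subseteq> (flags :: 'n flag set)"
    using openin_topspace[of "flag_topology :: 'n flag topology"] openin_flag_topology by blast
  have "{g. det g \<noteq> 0 \<and> act g std_flag \<in> (flags :: 'n flag set)} = {g. det g \<noteq> 0}"
    using act_flags std_flag_flags by blast
  then have "openin flag_topology (flags :: 'n flag set)"
    by (simp add: openin_flag_topology_GL open_det_nz)
  then show "(flags :: 'n flag set) \<subseteq> topspace flag_topology" by (rule openin_subset)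
qed

section \<open>The Hermitian form\<close>

locale pq_form =
  fixes p q :: nat and ty :: "'n::{finite,linorder} itself"
  assumes q_pos: "1 \<le> q" and q_le_p: "q \<le> p" and card_n: "CARD('n) = p + q"
begin

abbreviation h :: "'n cvec \<Rightarrow> 'n cvec \<Rightarrow> complex" where
  "h \<equiv> herm p q"

definition eta :: "nat \<Rightarrow> complex" where
  "eta k = (if k \<le> q then -1 else 1)"

text \<open>The Gram matrix of \<open>h\<close>. It exchanges \<open>h\<close> with the positive
  definite \<open>sp\<close>, and \<open>K0 p q\<close> is its commutant in \<open>SU p q\<close>
  (\<open>K0_iff\<close>).\<close>

definition J :: "'n cmat" where
  "J = dg eta"

definition sp :: "'n cvec \<Rightarrow> 'n cvec \<Rightarrow> complex" where
  "sp v w = (\<Sum>j\<in>UNIV. v $ j * cnj (w $ j))"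

lemma herm_eta: "h v w = (\<Sum>j\<in>UNIV. eta (rk j) * (v $ j * cnj (w $ j)))"
proof -
  have "(\<Sum>j\<in>UNIV. eta (rk j) * (v $ j * cnj (w $ j))) = (\<Sum>k=1..q+p. eta k * (v $ idx k * cnj (w $ idx k)))"
    unfolding sum_idx card_n
    by (rule sum.cong) (auto simp: rk_idx card_n add.commute)
  also have "\<dots> = (\<Sum>k=1..q. eta k * (v $ idx k * cnj (w $ idx k))) + (\<Sum>k=q+1..q+p. eta k * (v $ idx k * cnj (w $ idx k)))"
    by (rule sum.ub_add_nat) simp
  also have "(\<Sum>k=q+1..q+p. eta k * (v $ idx k * cnj (w $ idx k))) = (\<Sum>k=1..p. eta (q+k) * (v $ idx (q+k) * cnj (w $ idx (q+k))))"
    using sum.shift_bounds_cl_nat_ivl[of "\<lambda>k. eta k * (v $ idx k * cnj (w $ idx k))" 1 q p] by (simp add: add.commute)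
  finally show ?thesis
    unfolding herm_def by (simp add: eta_def sum_negf)
qed

lemma J_nth: "(J *v x) $ j = eta (rk j) * x $ j"
  by (simp add: J_def dg_nth)

lemma eta_sq [simp]: "eta k * eta k = 1" "eta k * (eta k * z) = z"
  by (simp_all add: eta_def)

lemma cnj_eta [simp]: "cnj (eta k) = eta k"
  by (simp add: eta_def)

lemma J_J [simp]: "J *v (J *v x) = x"
  by (simp add: vec_eq_iff J_nth)

lemma JJ [simp]: "J ** J = mat 1"
  by (simp add: matrix_eq flip: matrix_vector_mul_assoc)

lemma h_sp: "h v w = sp (J *v v) w"
  by (simp add: herm_eta sp_def J_nth mult.assoc)

lemma sp_h: "sp v w = h (J *v v) w"
  by (simp add: h_sp)

lemma h_J: "h (J *v v) w = h v (J *v w)"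
  by (simp add: herm_eta J_nth mult_ac)

lemma h_add_left: "h (v + v') w = h v w + h v' w"
  by (simp add: herm_eta algebra_simps sum.distrib)

lemma h_add_right: "h v (w + w') = h v w + h v w'"
  by (simp add: herm_eta algebra_simps sum.distrib)

lemma h_scale_left: "h (a *s v) w = a * h v w"
  by (simp add: herm_eta sum_distrib_left mult_ac)

lemma h_scale_right: "h v (a *s w) = cnj a * h v w"
  by (simp add: herm_eta sum_distrib_left mult_ac)

lemma h_sym: "h w v = cnj (h v w)"
  by (simp add: herm_eta mult_ac)

lemma h_zero_left [simp]: "h 0 w = 0"
  by (simp add: herm_eta)

lemma h_zero_right [simp]: "h v 0 = 0"
  by (simp add: herm_eta)

lemma h_diff_left: "h (v - v') w = h v w - h v' w"
  by (simp add: herm_eta algebra_simps sum_subtractf)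

lemma h_diff_right: "h v (w - w') = h v w - h v w'"
  by (simp add: herm_eta algebra_simps sum_subtractf)

lemma h_sum_left: "h (sum f A) w = (\<Sum>x\<in>A. h (f x) w)"
  by (induction A rule: infinite_finite_induct) (simp_all add: h_add_left)

lemma h_sum_right: "h v (sum f A) = (\<Sum>x\<in>A. h v (f x))"
  by (induction A rule: infinite_finite_induct) (simp_all add: h_add_right)

lemmas h_linear = h_add_left h_add_right h_scale_left h_scale_right h_diff_left h_diff_right h_sum_left h_sum_right

lemma h_eq_0_sym: "h v w = 0 \<longleftrightarrow> h w v = 0"
  by (metis complex_cnj_zero h_sym)

lemma h_self_real: "h v v \<in> \<real>"
  using h_sym[of v v] by (simp add: Reals_cnj_iff)

lemma h_nondegenerate: 
  assumes "\<And>w. h v w = 0" shows "v = 0"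
proof -
  have "h v (axis j 1) = eta (rk j) * v $ j" for j
  proof -
    have "h v (axis j 1) = (\<Sum>i\<in>UNIV. if i = j then eta (rk i) * v $ i else 0)"
      unfolding herm_eta by (rule sum.cong) (auto simp: axis_def)
    then show ?thesis by simp
  qed
  then have "eta (rk j) * v $ j = 0" for j using assms by metis
  moreover have "eta k \<noteq> 0" for k by (simp add: eta_def)
  ultimately show ?thesis by (simp add: vec_eq_iff)
qed

lemma h_span_0:
  assumes "v \<in> vec.span A" "\<And>x. x \<in> A \<Longrightarrow> h x w = 0" shows "h v w = 0"
proof -
  have "vec.subspace {x. h x w = 0}" by (auto simp: vec.subspace_def h_linear)
  then show ?thesis using assms vec.span_minimal[of A "{x. h x w = 0}"] by blast
qed

lemma h_span_0':
  assumes "v \<in> vec.span A" "\<And>x. x \<in> A \<Longrightarrow> h w x = 0" shows "h w v = 0"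
  using h_span_0[OF assms(1), of w] assms(2) h_eq_0_sym by blast

lemma sp_self_0: "sp v v = 0 \<Longrightarrow> v = 0"
proof -
  assume "sp v v = 0"
  moreover have "sp v v = of_real (\<Sum>j\<in>UNIV. (cmod (v $ j))\<^sup>2)"
    by (simp only: sp_def complex_norm_square of_real_sum)
  ultimately have "(\<Sum>j\<in>UNIV. (cmod (v $ j))\<^sup>2) = 0" by (metis of_real_eq_0_iff)
  then have "\<forall>j\<in>UNIV. (cmod (v $ j))\<^sup>2 = 0" by (subst (asm) sum_nonneg_eq_0_iff) auto
  then show "v = 0" by (simp add: vec_eq_iff)
qed

lemma h_eigen:
  assumes "J *v v = s *s v" shows "sp v v = s * h v v"
  using assms by (simp add: sp_h h_scale_left)

section \<open>Orthonormal frames and the orbits of the unitary groups\<close>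

definition oframe :: "(nat \<Rightarrow> 'n cvec) \<Rightarrow> (nat \<Rightarrow> complex) \<Rightarrow> bool" where
  "oframe c s \<longleftrightarrow> (\<forall>k\<in>{1..p+q}. s k = 1 \<or> s k = -1) \<and>
     (\<forall>k\<in>{1..p+q}. \<forall>l\<in>{1..p+q}. h (c k) (c l) = (if k = l then s k else 0))"

definition sflags :: "(nat \<Rightarrow> complex) \<Rightarrow> 'n flag set" where
  "sflags s = {flag_of c | c. oframe c s}"

text \<open>The eigenspaces of \<open>J\<close> are the negative and the positive coordinate
  subspace, so such a frame is orthonormal for \<open>h\<close> and for \<open>sp\<close> at once.
  The nonempty sets \<open>aflags s\<close> are going to be the base cycles.\<close>

definition aframe :: "(nat \<Rightarrow> 'n cvec) \<Rightarrow> (nat \<Rightarrow> complex) \<Rightarrow> bool" where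
  "aframe c s \<longleftrightarrow> oframe c s \<and> (\<forall>k\<in>{1..p+q}. J *v c k = s k *s c k)"

definition aflags :: "(nat \<Rightarrow> complex) \<Rightarrow> 'n flag set" where
  "aflags s = {flag_of c | c. aframe c s}"

lemma oframe_h: "oframe c s \<Longrightarrow> k \<in> {1..p+q} \<Longrightarrow> l \<in> {1..p+q} \<Longrightarrow> h (c k) (c l) = (if k = l then s k else 0)"
  by (simp add: oframe_def)

lemma oframe_sign: "oframe c s \<Longrightarrow> k \<in> {1..p+q} \<Longrightarrow> s k = 1 \<or> s k = -1"
  by (simp add: oframe_def)

lemma oframe_nz: "oframe c s \<Longrightarrow> k \<in> {1..p+q} \<Longrightarrow> s k \<noteq> 0"
  using oframe_sign by fastforce

lemma oframe_sq: "oframe c s \<Longrightarrow> k \<in> {1..p+q} \<Longrightarrow> s k * (s k * z) = z"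
  using oframe_sign by fastforce

lemma oframe_h_sum:
  assumes "oframe c s" "l \<in> {1..p+q}" "A \<subseteq> {1..p+q}" 
  shows "h (\<Sum>k\<in>A. x k *s c k) (c l) = (if l \<in> A then x l * s l else 0)"
proof -
  have fin: "finite A" using assms(3) finite_subset by blast
  have "h (\<Sum>k\<in>A. x k *s c k) (c l) = (\<Sum>k\<in>A. if k = l then x l * s l else 0)"
    unfolding h_linear
    by (rule sum.cong) (use assms oframe_h[OF assms(1)] in auto)
  then show ?thesis using fin by simp
qed

lemma oframe_frame: "oframe c s \<Longrightarrow> frame c"
proof -
  assume c: "oframe c s"
  have "x = 0" if x: "mat_of c *v x = 0" for x
  proof -
    have "x $ idx l = 0" if l: "l \<in> {1..p+q}" for l
      using oframe_h_sum[OF c l order_refl, of "\<lambda>k. x $ idx k"] x l oframe_nz[OF c l]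
      by (simp add: mat_of_mult card_n)
    then have "x $ j = 0" for j using rk_range[of j] idx_rk[of j] card_n by metis
    then show ?thesis by (simp add: vec_eq_iff)
  qed
  then have "invertible (mat_of c)"
    using matrix_left_invertible_ker[of "mat_of c"] invertible_left_inverse[of "mat_of c"] by blast
  then show ?thesis by (simp add: frame_iff_det invertible_det_nz)
qed

text \<open>Signs are their own inverses, so the factor \<open>s k\<close> stands for the division
  by \<open>h (c k) (c k)\<close>. The difference of both sides is orthogonal to a basis and
  vanishes by nondegeneracy.\<close>

lemma oframe_expand:
  assumes c: "oframe c s" shows "v = (\<Sum>k=1..p+q. (s k * h v (c k)) *s c k)"
proof -
  let ?d = "v - (\<Sum>k=1..p+q. (s k * h v (c k)) *s c k)"
  have d: "h ?d (c l) = 0" if l: "l \<in> {1..p+q}" for l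
    unfolding h_diff_left oframe_h_sum[OF c l order_refl] using l oframe_sq[OF c l, of 1]
    by (auto simp: mult_ac oframe_sq[OF c l])
  have "w \<in> vec.span (c ` {1..p+q})" for w using frame_span[OF oframe_frame[OF c]] card_n by auto
  then have "h ?d w = 0" for w
    by (rule h_span_0') (use d in auto)
  then have "?d = 0" by (rule h_nondegenerate)
  then show ?thesis by simp
qed

lemma oframe_flag:
  assumes c: "oframe c s" and m: "m \<le> p + q"
  shows "v \<in> flag_of c m \<longleftrightarrow> (\<forall>k\<in>{m+1..p+q}. h v (c k) = 0)"
proof
  assume v: "v \<in> flag_of c m"
  show "\<forall>k\<in>{m+1..p+q}. h v (c k) = 0"
    using v m unfolding flag_of_def
    by (intro ballI h_span_0[of v "c ` {1..m}"]) (auto simp: oframe_h[OF c])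
next
  assume v: "\<forall>k\<in>{m+1..p+q}. h v (c k) = 0"
  have "v = (\<Sum>k=1..p+q. (s k * h v (c k)) *s c k)" by (rule oframe_expand[OF c])
  also have "\<dots> = (\<Sum>k=1..m. (s k * h v (c k)) *s c k)"
    by (rule sum.mono_neutral_right) (use m v in auto)
  also have "\<dots> \<in> flag_of c m"
    by (intro vec.subspace_sum subspace_flag_of vec.subspace_scale flag_of_base) auto
  finally show "v \<in> flag_of c m" .
qed

lemma h_mat_of:
  assumes c: "oframe c s"
  shows "h (mat_of c *v x) (mat_of c *v y) = (\<Sum>k=1..p+q. s k * x $ idx k * cnj (y $ idx k))"
proof -
  have "h (mat_of c *v x) (mat_of c *v y) = (\<Sum>l=1..p+q. cnj (y $ idx l) * h (mat_of c *v x) (c l))"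
    by (simp add: mat_of_mult[of c y] h_sum_right h_scale_right card_n)
  also have "\<dots> = (\<Sum>l=1..p+q. s l * x $ idx l * cnj (y $ idx l))"
    by (rule sum.cong) (auto simp: mat_of_mult card_n oframe_h_sum[OF c])
  finally show ?thesis .
qed

section \<open>Transitivity of \<open>SU p q\<close> and \<open>K0 p q\<close> on frames with given
  signs\<close>

definition adj :: "'n cmat \<Rightarrow> 'n cmat" where
  "adj A = (\<chi> i j. cnj (A $ j $ i))"

lemma det_adj: "det (adj A) = cnj (det A)"
proof -
  have "det (adj A) = det (\<chi> i j. cnj (A $ i $ j))"
    using det_transpose[of "\<chi> i j. cnj (A $ i $ j)"] by (simp add: adj_def transpose_def)
  also have "\<dots> = cnj (det A)" by (simp add: det_def)
  finally show ?thesis .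
qed

text \<open>Determinants in the Gram identity for \<open>c\<close>. As a consequence, the map
  between two frames with the same signs has a phase as its determinant.\<close>

lemma oframe_det:
  assumes c: "oframe c s"
  shows "(cmod (det (mat_of c :: 'n cmat)))\<^sup>2 = cmod (\<Prod>k=1..p+q. s k)"
proof -
  have "adj (mat_of c) ** J ** mat_of c = dg s"
  proof -
    have "(adj (mat_of c) ** J ** mat_of c) $ i $ j = h (c (rk j)) (c (rk i))" for i j
      by (simp add: herm_eta matrix_matrix_mult_def adj_def J_def dg_def mat_of_def if_distrib if_distribR mult_ac cong: if_cong)
    moreover have "h (c (rk j)) (c (rk i)) = (if i = j then s (rk i) else 0)" for i j :: 'n
      using oframe_h[OF c, of "rk j" "rk i"] rk_range[of j] rk_range[of i] card_n by auto
    ultimately show ?thesis by (simp add: vec_eq_iff dg_def)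
  qed
  then have "det (adj (mat_of c) ** J ** mat_of c) = (\<Prod>k=1..p+q. s k)" by (simp add: det_dg card_n)
  moreover have "cmod (\<Prod>k=1..p+q. eta k) = 1"
    by (simp add: prod_norm[symmetric] eta_def if_distrib cong: if_cong)
  ultimately show ?thesis
    by (metis J_def card_n complex_mod_cnj det_adj det_dg det_mul mult.commute mult.right_neutral norm_mult power2_eq_square)
qed

lemma oframe_scale:
  assumes "oframe c s" "\<And>k. k \<in> {1..p+q} \<Longrightarrow> cmod (f k) = 1" 
  shows "oframe (\<lambda>k. f k *s c k) s"
proof -
  have "cnj (f k) * f k = 1" if "k \<in> {1..p+q}" for k
    using assms(2)[OF that] complex_norm_square[of "f k"] by (simp add: mult.commute)
  then show ?thesis using assms(1) unfolding oframe_def by (simp add: h_linear)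
qed

lemma SU_h: "g \<in> SU p q \<Longrightarrow> h (g *v v) (g *v w) = h v w"
  by (simp add: SU_def)

lemma SU_det: "g \<in> SU p q \<Longrightarrow> det g = 1"
  by (simp add: SU_def SL_def)

lemma SU_oframe: "g \<in> SU p q \<Longrightarrow> oframe c s \<Longrightarrow> oframe (\<lambda>k. g *v c k) s"
  by (simp add: oframe_def SU_h)

text \<open>The linear map from \<open>c\<close> to \<open>d\<close> preserves \<open>h\<close>, but
  may have a phase as its determinant. A phase put on the first vector of \<open>d\<close> repairs
  this and leaves the flag alone. The factors \<open>f\<close> are exported because
  \<open>orbit_K0\<close> has to know the images of the vectors, not only of the flag.\<close>

lemma oframe_transitive:
  assumes c: "oframe c s" and d: "oframe d s"
  obtains g f where "g \<in> SU p q" "\<And>k. f k \<noteq> 0" "\<And>k. k \<in> {1..p+q} \<Longrightarrow> g *v c k = f k *s d k" 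
    "act g (flag_of c) = flag_of d"
proof -
  have fc: "frame c" "frame d" using c d oframe_frame by auto
  let ?m = "det (mat_of c :: 'n cmat) / det (mat_of d :: 'n cmat)"
  have dn: "det (mat_of c :: 'n cmat) \<noteq> 0" "det (mat_of d :: 'n cmat) \<noteq> 0" using fc frame_iff_det by auto
  have "cmod (det (mat_of c :: 'n cmat)) = cmod (det (mat_of d :: 'n cmat))"
    using oframe_det[OF c] oframe_det[OF d] by (metis norm_ge_zero power2_eq_imp_eq)
  then have m: "cmod ?m = 1" using dn by (simp add: norm_divide)
  define d' where "d' = (\<lambda>k. rescale ?m k *s d k)"
  have d': "oframe d' s" unfolding d'_def by (rule oframe_scale[OF d]) (use m in \<open>simp add: rescale_def\<close>)
  have fd': "flag_of d' = flag_of d" unfolding d'_def using dn by (intro flag_of_scale fc) (auto simp: rescale_def)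
  have detd': "det (mat_of d' :: 'n cmat) = det (mat_of c :: 'n cmat)"
    unfolding d'_def det_mat_of_scale prod_rescale using dn by simp
  obtain C where inv: "C ** mat_of c = (mat 1 :: 'n cmat)" "mat_of c ** C = (mat 1 :: 'n cmat)"
    using dn(1) unfolding invertible_det_nz[symmetric] invertible_def by blast
  define g where "g = mat_of d' ** C"
  have gm: "g ** mat_of c = mat_of d'" by (simp add: g_def matrix_mul_assoc[symmetric] inv)
  have "det g = 1" using arg_cong[OF gm, of det] detd' dn by (simp add: det_mul)
  have gk: "g *v c k = d' k" if "k \<in> {1..p+q}" for k
    using mat_of_mult_e[of k c] mat_of_mult_e[of k d'] gm that card_n by (metis matrix_vector_mul_assoc)
  have "h (g *v v) (g *v w) = h v w" for v w
  proof -
    define x y where "x = C *v v" and "y = C *v w"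
    have vw: "v = mat_of c *v x" "w = mat_of c *v y" by (simp_all add: x_def y_def matrix_vector_mul_assoc inv)
    have "g *v v = mat_of d' *v x" "g *v w = mat_of d' *v y" unfolding vw by (simp_all add: matrix_vector_mul_assoc gm)
    then show ?thesis unfolding vw by (simp add: vw h_mat_of[OF c] h_mat_of[OF d'])
  qed
  then have SU: "g \<in> SU p q" using \<open>det g = 1\<close> by (simp add: SU_def SL_def)
  have "act g (flag_of c) = flag_of d'"
    unfolding act_flag_of by (rule flag_of_cong) (use fc frame_mult[of c g] \<open>det g = 1\<close> gk card_n in auto)
  then show ?thesis
    using that[of g "rescale ?m"] SU gk dn fd' by (auto simp: d'_def rescale_def)
qed

lemma orbit_SU: 
  assumes "oframe c s" shows "orbit (SU p q) (flag_of c) = sflags s"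
proof
  show "orbit (SU p q) (flag_of c) \<subseteq> sflags s"
    using assms SU_oframe unfolding orbit_def sflags_def by (auto simp: act_flag_of)
  show "sflags s \<subseteq> orbit (SU p q) (flag_of c)"
    unfolding sflags_def orbit_def using oframe_transitive[OF assms] by (smt (verit) image_eqI mem_Collect_eq subsetI)
qed

lemma sp_adj: "sp (g *v v) w = sp v (adj g *v w)"
proof -
  have "sp (g *v v) w = (\<Sum>i\<in>UNIV. \<Sum>j\<in>UNIV. g $ i $ j * v $ j * cnj (w $ i))"
    by (simp add: sp_def matrix_vector_mult_def sum_distrib_right)
  also have "\<dots> = (\<Sum>j\<in>UNIV. \<Sum>i\<in>UNIV. g $ i $ j * v $ j * cnj (w $ i))" by (rule sum.swap)
  also have "\<dots> = sp v (adj g *v w)"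
    by (simp add: sp_def adj_def matrix_vector_mult_def sum_distrib_left mult_ac)
  finally show ?thesis .
qed

lemma sp_axis: "sp v (axis j 1) = v $ j"
proof -
  have "sp v (axis j 1) = (\<Sum>i\<in>UNIV. if i = j then v $ i else 0)"
    unfolding sp_def by (rule sum.cong) (auto simp: axis_def)
  then show ?thesis by simp
qed

lemma unitary_iff: "unitary (g :: 'n cmat) \<longleftrightarrow> (\<forall>v w. sp (g *v v) (g *v w) = sp v w)"
proof
  assume "unitary g"
  then have "adj g ** g = mat 1" by (simp add: unitary_def adj_def)
  then show "\<forall>v w. sp (g *v v) (g *v w) = sp v w"
    by (simp add: sp_adj matrix_vector_mul_assoc)
next
  assume *: "\<forall>v w. sp (g *v v) (g *v w) = sp v w"
  have "sp (adj g *v (g *v v)) w = sp v w" for v w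
  proof -
    have "sp (g *v v) (g *v w) = cnj (sp (g *v w) (g *v v))" by (simp add: sp_def mult_ac)
    also have "\<dots> = cnj (sp w (adj g *v (g *v v)))" by (simp add: sp_adj)
    also have "\<dots> = sp (adj g *v (g *v v)) w" by (simp add: sp_def mult_ac)
    finally show ?thesis using * by simp
  qed
  then have "adj g *v (g *v v) = v" for v
    by (metis sp_axis vec_eq_iff)
  then show "unitary g" unfolding unitary_def
    by (simp add: matrix_eq adj_def flip: matrix_vector_mul_assoc)
qed

text \<open>Block diagonal means commuting with \<open>J\<close>. For such a matrix, preserving
  \<open>sp\<close> and preserving \<open>h\<close> are equivalent, because \<open>J\<close> turns
  one form into the other.\<close>

lemma K0_iff: "g \<in> K0 p q \<longleftrightarrow> g \<in> SU p q \<and> g ** J = J ** (g :: 'n cmat)"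
proof -
  have block: "(\<forall>i\<in>{1..q}. \<forall>j\<in>{q+1..p+q}. g $ idx i $ idx j = 0 \<and> g $ idx j $ idx i = 0) \<longleftrightarrow> g ** J = J ** g"
  proof -
    have "(g ** J) $ i $ j = g $ i $ j * eta (rk j)" "(J ** g) $ i $ j = eta (rk i) * g $ i $ j" for i j
      by (simp_all add: J_def dg_def matrix_matrix_mult_def if_distrib if_distribR cong: if_cong)
    then have "g ** J = J ** g \<longleftrightarrow> (\<forall>i j. g $ i $ j * eta (rk j) = eta (rk i) * g $ i $ j)"
      by (simp add: vec_eq_iff)
    also have "\<dots> \<longleftrightarrow> (\<forall>i j. (rk i \<le> q \<longleftrightarrow> rk j \<le> q) \<or> g $ i $ j = 0)"
      by (auto simp: eta_def)
    also have "\<dots> \<longleftrightarrow> (\<forall>i\<in>{1..q}. \<forall>j\<in>{q+1..p+q}. g $ idx i $ idx j = 0 \<and> g $ idx j $ idx i = 0)"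
    proof
      assume L: "\<forall>i j. (rk i \<le> q \<longleftrightarrow> rk j \<le> q) \<or> g $ i $ j = 0"
      show "\<forall>i\<in>{1..q}. \<forall>j\<in>{q+1..p+q}. g $ idx i $ idx j = 0 \<and> g $ idx j $ idx i = 0"
      proof (intro ballI)
        fix i j assume "i \<in> {1..q}" "j \<in> {q+1..p+q}"
        then have "rk (idx i :: 'n) \<le> q" "\<not> rk (idx j :: 'n) \<le> q" 
          using rk_idx[of i, where 'n='n] rk_idx[of j, where 'n='n] card_n by auto
        then show "g $ idx i $ idx j = 0 \<and> g $ idx j $ idx i = 0" using L by blast
      qed
    next
      assume R: "\<forall>i\<in>{1..q}. \<forall>j\<in>{q+1..p+q}. g $ idx i $ idx j = 0 \<and> g $ idx j $ idx i = 0"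
      show "\<forall>i j. (rk i \<le> q \<longleftrightarrow> rk j \<le> q) \<or> g $ i $ j = 0"
      proof (intro allI)
        fix i j
        show "(rk i \<le> q \<longleftrightarrow> rk j \<le> q) \<or> g $ i $ j = 0"
          using R[rule_format, of "rk i" "rk j"] R[rule_format, of "rk j" "rk i"] rk_range[of i] rk_range[of j] card_n
          by (cases "rk i \<le> q"; cases "rk j \<le> q") (auto simp: not_le Suc_le_eq)
      qed
    qed
    finally show ?thesis by blast
  qed
  have comm: "g *v (J *v v) = J *v (g *v v)" if "g ** J = J ** g" for v
    using that by (simp add: matrix_vector_mul_assoc)
  have 1: "(\<forall>v w. sp (g *v v) (g *v w) = sp v w) \<longleftrightarrow> (\<forall>v w. h (g *v v) (g *v w) = h v w)" if "g ** J = J ** g"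
    using comm[OF that] by (metis h_sp sp_h)
  show ?thesis unfolding K0_def SU_def mem_Collect_eq unitary_iff using block 1 by blast
qed

lemma aframe_oframe: "aframe c s \<Longrightarrow> oframe c s"
  by (simp add: aframe_def)

lemma K0_aframe: 
  assumes "g \<in> K0 p q" "aframe c s" shows "aframe (\<lambda>k. g *v c k) s"
proof -
  have "J *v (g *v x) = g *v (J *v x)" for x
    using assms(1) by (simp add: K0_iff matrix_vector_mul_assoc)
  then show ?thesis using assms SU_oframe by (simp add: aframe_def K0_iff vec.scale)
qed

lemma orbit_K0:
  assumes c: "aframe c s" shows "orbit (K0 p q) (flag_of c) = aflags s"
proof
  show "orbit (K0 p q) (flag_of c) \<subseteq> aflags s"
    using assms K0_aframe unfolding orbit_def aflags_def by (auto simp: act_flag_of)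
  show "aflags s \<subseteq> orbit (K0 p q) (flag_of c)"
  proof
    fix F assume "F \<in> aflags s"
    then obtain d where d: "aframe d s" "F = flag_of d" by (auto simp: aflags_def)
    obtain g f where g: "g \<in> SU p q" "\<And>k. k \<in> {1..p+q} \<Longrightarrow> g *v c k = f k *s d k" "act g (flag_of c) = flag_of d"
      using oframe_transitive[OF aframe_oframe[OF c] aframe_oframe[OF d(1)]] by metis
    \<comment> \<open>\<open>c k\<close> and \<open>d k\<close> are eigenvectors of \<open>J\<close>
      for the same eigenvalue \<open>s k\<close>, so \<open>g\<close> commutes with \<open>J\<close>
      on a basis.\<close>
    have *: "g *v (J *v c k) = J *v (g *v c k)" if "k \<in> {1..p+q}" for k
      using c d(1) that g(2)[OF that] by (simp add: aframe_def vec.scale mult.commute)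
    have "g *v (J *v v) = J *v (g *v v)" for v
    proof -
      have "vec.subspace {v. g *v (J *v v) = J *v (g *v v)}"
        by (auto simp: vec.subspace_def vec.scale vec.add)
      then have "vec.span (c ` {1..p+q}) \<subseteq> {v. g *v (J *v v) = J *v (g *v v)}"
        by (intro vec.span_minimal) (use * in auto)
      then show ?thesis using frame_span[OF oframe_frame[OF aframe_oframe[OF c]]] card_n by auto
    qed
    then have "g ** J = J ** g" by (simp add: matrix_eq flip: matrix_vector_mul_assoc)
    then have "g \<in> K0 p q" using g by (simp add: K0_iff)
    then show "F \<in> orbit (K0 p q) (flag_of c)" using g(3) d unfolding orbit_def by (metis image_eqI)
  qed
qed

text \<open>Write \<open>c k = v + a d k\<close> with \<open>v\<close> in the previous subspace.
  Both \<open>c k\<close> and \<open>d k\<close> are orthogonal to that subspace, so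
  \<open>v\<close> is isotropic and orthogonal to \<open>d k\<close>; hence the squares of
  \<open>c k\<close> and \<open>d k\<close> differ by the positive factor
  \<open>|a|^2\<close>.\<close>

lemma oframe_sign_unique:
  assumes c: "oframe c s" and d: "oframe d t" and eq: "flag_of c = flag_of d" and k: "k \<in> {1..p+q}"
  shows "s k = t k"
proof -
  have "c k \<in> flag_of d k" using eq k by (metis atLeastAtMost_iff flag_of_base order_refl)
  then obtain a where a: "c k - a *s d k \<in> flag_of d (k - 1)" using flag_of_step[of k "c k" d] k by auto
  have perp: "h v (c k) = 0" "h v (d k) = 0" if "v \<in> flag_of c (k - 1)" for v
    using that oframe_flag[OF c, of "k-1" v] oframe_flag[OF d, of "k-1" v] k eq by auto
  define v where "v = c k - a *s d k"
  have v: "v \<in> flag_of c (k - 1)" using a eq v_def by simp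
  have "h v v = 0"
  proof -
    have "h v v = h v (c k) - cnj a * h v (d k)" by (simp add: v_def h_linear)
    then show ?thesis using perp[OF v] by simp
  qed
  have ck: "c k = v + a *s d k" by (simp add: v_def)
  have "s k = h (c k) (c k)" using oframe_h[OF c k k] by simp
  also have "\<dots> = a * cnj a * t k"
    unfolding ck using \<open>h v v = 0\<close> perp[OF v] h_eq_0_sym[of v "d k"] oframe_h[OF d k k] by (simp add: h_linear)
  finally have "s k = of_real ((cmod a)\<^sup>2) * t k" by (simp only: complex_norm_square)
  then show ?thesis
    using oframe_sign[OF c k] oframe_sign[OF d k] 
    by (metis (no_types, opaque_lifting) complex_norm_square mult_cancel_right1 mult_minus1_right norm_minus_cancel norm_mult norm_of_real norm_one abs_power2 mult.right_neutral of_real_1 zero_neq_one)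
qed

lemma sflags_sign_unique:
  assumes "F \<in> sflags s" "F \<in> sflags t" "k \<in> {1..p+q}" shows "s k = t k"
  using assms oframe_sign_unique unfolding sflags_def by blast

lemma oframe_cong: 
  assumes "\<And>k. k \<in> {1..p+q} \<Longrightarrow> s k = t k" shows "oframe c s = oframe c t"
  using assms unfolding oframe_def by (smt (verit))

lemma sflags_cong: "(\<And>k. k \<in> {1..p+q} \<Longrightarrow> s k = t k) \<Longrightarrow> sflags s = sflags t"
  unfolding sflags_def using oframe_cong by metis

lemma aflags_sflags: "aflags s \<subseteq> sflags s"
  by (auto simp: aflags_def sflags_def aframe_def)

lemma sflags_flags: "sflags s \<subseteq> flags"
  by (auto simp: sflags_def intro: flag_of_flags oframe_frame)

end

section \<open>Open orbits\<close>

context pq_form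
begin

text \<open>Gram-Schmidt without normalization, for an indefinite form. If some
  \<open>gs b j\<close> is isotropic, the quotient is 0 by the convention on division; the
  triangular shape holds for any coefficients, and only orthogonality (\<open>gs_orth\<close>)
  depends on nonvanishing squares.\<close>

fun gs :: "(nat \<Rightarrow> 'n cvec) \<Rightarrow> nat \<Rightarrow> 'n cvec" where
  "gs b k = b k - (\<Sum>j\<in>{1..<k}. (h (b k) (gs b j) / h (gs b j) (gs b j)) *s gs b j)"

declare gs.simps [simp del]

lemma gs_cong: "(\<And>i. i \<in> {1..k} \<Longrightarrow> b i = c i) \<Longrightarrow> 1 \<le> k \<Longrightarrow> gs b k = gs c k"
proof (induction k rule: less_induct)
  case (less k)
  have "gs b j = gs c j" if "j \<in> {1..<k}" for j using less.IH[of j] less.prems that by simp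
  moreover have "b k = c k" using less.prems by simp
  ultimately show ?case by (simp add: gs.simps[of b k] gs.simps[of c k])
qed

lemma gs_orth: "(\<And>j. j \<in> {1..<k} \<Longrightarrow> h (gs b j) (gs b j) \<noteq> 0) \<Longrightarrow> j \<in> {1..<k} \<Longrightarrow> h (gs b k) (gs b j) = 0"
proof (induction k arbitrary: j rule: less_induct)
  case (less k)
  have orth: "h (gs b i) (gs b j) = 0" if "i \<in> {1..<k}" "i \<noteq> j" for i
  proof (cases "i < j")
    case True
    then have "h (gs b j) (gs b i) = 0" using less that by simp
    then show ?thesis by (simp add: h_eq_0_sym[of "gs b i"])
  next
    case False
    then show ?thesis using less that by simp
  qed
  have "(\<Sum>i\<in>{1..<k}. h (b k) (gs b i) / h (gs b i) (gs b i) * h (gs b i) (gs b j))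
      = (\<Sum>i\<in>{1..<k}. if i = j then h (b k) (gs b j) else 0)"
    by (rule sum.cong) (use orth less.prems in auto)
  also have "\<dots> = h (b k) (gs b j)" using less.prems by simp
  finally show ?case by (subst gs.simps) (simp add: h_linear)
qed

lemma gs_triangular:
  assumes "frame b" "k \<in> {1..p+q}" shows "gs b k \<in> flag_of b k - flag_of b (k - 1)"
  using assms(2)
proof (induction k rule: less_induct)
  case (less k)
  have "(\<Sum>j\<in>{1..<k}. (h (b k) (gs b j) / h (gs b j) (gs b j)) *s gs b j) \<in> flag_of b (k - 1)" (is "?s \<in> _")
  proof (intro vec.subspace_sum subspace_flag_of vec.subspace_scale)
    fix j assume "j \<in> {1..<k}"
    then have "gs b j \<in> flag_of b j" "j \<le> k - 1" using less.IH[of j] less.prems by auto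
    then show "gs b j \<in> flag_of b (k - 1)" using flag_of_mono[of j "k-1" b] by blast
  qed
  moreover have "b k \<in> flag_of b k" "b k \<notin> flag_of b (k - 1)"
    using less.prems flag_of_base[of k k b] frame_notin[OF assms(1), of k] card_n by auto
  moreover have "gs b k = b k - ?s" by (rule gs.simps)
  ultimately show ?case
    using flag_of_mono[of "k-1" k b] vec.subspace_diff[OF subspace_flag_of, of "b k" b k ?s]
      vec.subspace_add[OF subspace_flag_of, of "b k - ?s" b "k-1" ?s] by auto
qed

lemma gs_frame: 
  assumes "frame b" shows "frame (gs b)" "flag_of (gs b) = flag_of b"
  using triangular_frame[OF assms, of "gs b"] gs_triangular[OF assms] card_n by auto

lemma gs_normalize:
  assumes b: "frame b" and s: "\<And>k. k \<in> {1..p+q} \<Longrightarrow> s k = 1 \<or> s k = -1"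
    and pos: "\<And>k. k \<in> {1..p+q} \<Longrightarrow> 0 < Re (s k * h (gs b k) (gs b k))"
  obtains f where "\<And>k. k \<in> {1..p+q} \<Longrightarrow> f k \<noteq> 0" "oframe (\<lambda>k. f k *s gs b k) s" 
    "flag_of (\<lambda>k. f k *s gs b k) = flag_of b"
proof -
  define f :: "nat \<Rightarrow> complex" where "f = (\<lambda>k. of_real (1 / sqrt (Re (s k * h (gs b k) (gs b k)))))"
  have f: "f k \<noteq> 0" if "k \<in> {1..p+q}" for k using pos[OF that] by (simp add: f_def)
  have nz: "h (gs b k) (gs b k) \<noteq> 0" if "k \<in> {1..p+q}" for k using pos[OF that] by auto
  have "h (f k *s gs b k) (f l *s gs b l) = (if k = l then s k else 0)" 
    if kl: "k \<in> {1..p+q}" "l \<in> {1..p+q}" for k l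
  proof (cases "k = l")
    case True
    let ?x = "h (gs b k) (gs b k)"
    have "?x = of_real (Re ?x)" using h_self_real[of "gs b k"] by (simp add: of_real_Re)
    moreover have "s k * ?x = of_real (Re (s k * ?x))" using s[OF kl(1)] h_self_real[of "gs b k"] by (auto simp: of_real_Re)
    moreover have "f k * cnj (f k) = of_real (1 / Re (s k * ?x))"
      using pos[OF kl(1)] by (simp add: f_def flip: of_real_mult)
    ultimately have "f k * cnj (f k) * (s k * ?x) = 1"
      using pos[OF kl(1)] by (metis nonzero_divide_eq_eq of_real_1 of_real_mult less_numeral_extra(3))
    then have "s k * (f k * cnj (f k) * ?x) = 1" by (simp add: mult_ac)
    then have "f k * cnj (f k) * ?x = s k" using s[OF kl(1)] by (auto simp: minus_equation_iff)
    then show ?thesis using True by (simp add: h_linear mult_ac)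
  next
    case False
    then have "h (gs b k) (gs b l) = 0"
      using gs_orth[of k b l] gs_orth[of l b k] h_eq_0_sym[of "gs b k" "gs b l"] nz kl
      by (cases "k < l") auto
    then show ?thesis using False by (simp add: h_linear)
  qed
  then have "oframe (\<lambda>k. f k *s gs b k) s" using s by (simp add: oframe_def)
  moreover have "flag_of (\<lambda>k. f k *s gs b k) = flag_of b"
    using flag_of_scale[OF gs_frame(1)[OF b], of f] f gs_frame(2)[OF b] card_n by simp
  ultimately show ?thesis using that f by blast
qed

lemma sp_self_pos: 
  assumes "v \<noteq> 0" shows "0 < Re (sp v v)"
proof -
  have eq: "sp v v = of_real (\<Sum>j\<in>UNIV. (cmod (v $ j))\<^sup>2)"
    by (simp only: sp_def complex_norm_square of_real_sum)
  moreover have "sp v v \<noteq> 0" using assms sp_self_0 by blast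
  ultimately have "(\<Sum>j\<in>UNIV. (cmod (v $ j))\<^sup>2) \<noteq> 0" by (metis of_real_0)
  moreover have "(\<Sum>j\<in>UNIV. (cmod (v $ j))\<^sup>2) \<ge> 0" by (intro sum_nonneg) simp
  ultimately show ?thesis unfolding eq by (simp del: of_real_sum)
qed

text \<open>The two eigenspaces of \<open>J\<close> are orthogonal for \<open>h\<close>, so
  Gram-Schmidt subtracts from an eigenvector only multiples of earlier vectors with the same
  eigenvalue and never leaves the eigenspace.\<close>

lemma gs_aframe:
  assumes b: "frame b" and s: "\<And>k. k \<in> {1..p+q} \<Longrightarrow> s k = 1 \<or> s k = -1"
    and J: "\<And>k. k \<in> {1..p+q} \<Longrightarrow> J *v b k = s k *s b k"
  shows "flag_of b \<in> aflags s"
proof -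
  have Jgs: "k \<in> {1..p+q} \<Longrightarrow> J *v gs b k = s k *s gs b k" for k
  proof (induction k rule: less_induct)
    case (less k)
    let ?t = "\<lambda>j. (h (b k) (gs b j) / h (gs b j) (gs b j)) *s gs b j"
    have t: "J *v ?t j = s k *s ?t j" if j: "j \<in> {1..<k}" for j
    proof (cases "s j = s k")
      case True
      then show ?thesis using less j by (simp add: vec.scale mult_ac)
    next
      case False
      have "s k * h (b k) (gs b j) = h (J *v b k) (gs b j)" using J less.prems by (simp add: h_linear)
      also have "\<dots> = cnj (s j) * h (b k) (gs b j)" using less j by (simp add: h_J h_linear)
      finally have "h (b k) (gs b j) = 0" using False s[of j] s[of k] less.prems j by auto
      then show ?thesis by simp
    qed
    have "J *v gs b k = J *v b k - (\<Sum>j\<in>{1..<k}. J *v ?t j)"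
      by (subst gs.simps) (simp only: vec.diff vec.sum)
    also have "\<dots> = s k *s b k - (\<Sum>j\<in>{1..<k}. s k *s ?t j)"
      using t J[OF less.prems] by (simp only: cong: sum.cong)
    also have "\<dots> = s k *s gs b k"
      by (subst (2) gs.simps) (simp only: vec.scale_right_diff_distrib vec.scale_sum_right)
    finally show ?case .
  qed
  have "0 < Re (s k * h (gs b k) (gs b k))" if k: "k \<in> {1..p+q}" for k
  proof -
    have "gs b k \<noteq> 0" using frame_nonzero[OF gs_frame(1)[OF b]] k card_n by simp
    then show ?thesis using sp_self_pos h_eigen[OF Jgs[OF k]] by metis
  qed
  then obtain f where f: "oframe (\<lambda>k. f k *s gs b k) s" "flag_of (\<lambda>k. f k *s gs b k) = flag_of b"
    using gs_normalize[of b s, OF b s] by blast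
  then have "aframe (\<lambda>k. f k *s gs b k) s" using Jgs by (simp add: aframe_def vec.scale mult.commute)
  then show ?thesis using f(2)[symmetric] unfolding aflags_def by blast
qed

lemma tendsto_h: 
  assumes "(f \<longlongrightarrow> a) F" "(g \<longlongrightarrow> b) F" shows "((\<lambda>x. h (f x) (g x)) \<longlongrightarrow> h a b) F"
  unfolding herm_eta by (intro tendsto_intros assms)

lemma tendsto_scale:
  assumes "(f \<longlongrightarrow> a) F" "(g \<longlongrightarrow> (b :: 'n cvec)) F" shows "((\<lambda>x. f x *s g x) \<longlongrightarrow> a *s b) F"
  by (rule vec_tendstoI) (auto intro!: tendsto_intros assms)

lemma tendsto_gs:
  assumes "\<And>j. j \<in> {1..k} \<Longrightarrow> ((\<lambda>x. B x j) \<longlongrightarrow> b j) F" 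
    and "\<And>j. j \<in> {1..<k} \<Longrightarrow> h (gs b j) (gs b j) \<noteq> 0" and "1 \<le> k"
  shows "((\<lambda>x. gs (B x) k) \<longlongrightarrow> gs b k) F"
  using assms
proof (induction k rule: less_induct)
  case (less k)
  have "((\<lambda>x. gs (B x) j) \<longlongrightarrow> gs b j) F" if "j \<in> {1..<k}" for j
    using less that by simp
  moreover have "((\<lambda>x. B x k) \<longlongrightarrow> b k) F" using less.prems by simp
  ultimately show ?case
    by (subst (1 2) gs.simps) (intro tendsto_intros tendsto_scale tendsto_h; use less.prems in auto)
qed

lemma gs_oframe: 
  assumes c: "oframe c s" and "\<And>k. k \<in> {1..p+q} \<Longrightarrow> b k = c k"
  shows "k \<in> {1..p+q} \<Longrightarrow> gs b k = c k"
proof (induction k rule: less_induct)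
  case (less k)
  have "h (c k) (gs b j) = 0" if "j \<in> {1..<k}" for j
    using less that oframe_h[OF c, of k j] by simp
  then show ?case by (subst gs.simps) (simp only: assms(2)[OF less.prems] sum.neutral_const div_0 vec.scale_zero_left diff_zero cong: sum.cong)
qed

text \<open>The signs of the squares of the Gram-Schmidt vectors are strict inequalities, and these
  vectors depend continuously on the basis as long as the earlier squares do not vanish.\<close>

lemma open_sflags: "openin flag_topology (sflags s)"
  unfolding openin_flag_topology_GL
proof
  show "sflags s \<subseteq> flags" by (rule sflags_flags)
  show "open {g. det g \<noteq> 0 \<and> act g std_flag \<in> sflags s}" (is "open ?A")
  proof (subst open_subopen, intro ballI)
    fix g :: "'n cmat" assume g: "g \<in> ?A"
    then obtain c where c: "oframe c s" "act g std_flag = flag_of c" by (auto simp: sflags_def)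
    obtain B where B: "B ** g = mat 1" "g ** B = mat 1"
      using g unfolding mem_Collect_eq invertible_det_nz[symmetric] invertible_def by blast
    \<comment> \<open>\<open>R\<close> fixes \<open>std_flag\<close> and turns the columns of
      \<open>g\<close> into the orthonormal frame \<open>c\<close>. For matrices \<open>x\<close>
      near \<open>g\<close>, the columns of \<open>x ** R\<close> are then a basis for the flag of
      \<open>x\<close> that is close to \<open>c\<close>.\<close>
    define R where "R = B ** mat_of c"
    have gR: "g ** R = mat_of c" by (simp add: R_def matrix_mul_assoc B)
    have "act R std_flag = act B (act g std_flag)"
      using act_mat_of[OF oframe_frame[OF c(1)]] c(2) by (simp add: R_def act_act[symmetric])
    then have R: "act R std_flag = std_flag" by (simp add: act_act B)
    have detR: "det R \<noteq> 0"
      using arg_cong[OF gR, of det] oframe_frame[OF c(1)] by (auto simp: det_mul frame_iff_det)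
    define G where "G = (\<lambda>(g :: 'n cmat) k. (g ** R) *v e k)"
    have Gg: "G g k = c k" if "k \<in> {1..p+q}" for k using that mat_of_mult_e[of k c] card_n by (simp add: G_def gR)
    have lim: "((\<lambda>x. G x j) \<longlongrightarrow> G g j) (nhds g)" for j
      unfolding G_def matrix_vector_mult_def matrix_matrix_mult_def
      by (intro vec_tendstoI) (auto intro!: tendsto_intros filterlim_ident)
    have "\<forall>\<^sub>F x in nhds g. 0 < Re (s k * h (gs (G x) k) (gs (G x) k))" if k: "k \<in> {1..p+q}" for k
    proof -
      have "((\<lambda>x. gs (G x) k) \<longlongrightarrow> gs (G g) k) (nhds g)"
      proof (rule tendsto_gs)
        fix j assume "j \<in> {1..<k}"
        then have "j \<in> {1..p+q}" using k by simp
        then show "h (gs (G g) j) (gs (G g) j) \<noteq> 0"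
          using gs_oframe[OF c(1) Gg] oframe_h[OF c(1)] oframe_nz[OF c(1)] by simp
      qed (use k lim in auto)
      then have "((\<lambda>x. Re (s k * h (gs (G x) k) (gs (G x) k))) \<longlongrightarrow> Re (s k * h (gs (G g) k) (gs (G g) k))) (nhds g)"
        by (intro tendsto_intros tendsto_h)
      moreover have "Re (s k * h (gs (G g) k) (gs (G g) k)) = 1"
        using gs_oframe[OF c(1) Gg k] oframe_h[OF c(1) k k] oframe_sign[OF c(1) k] by auto
      ultimately show ?thesis by (intro order_tendstoD(1)) (assumption, simp only: zero_less_one)
    qed
    then have "\<forall>\<^sub>F x in nhds g. \<forall>k\<in>{1..p+q}. 0 < Re (s k * h (gs (G x) k) (gs (G x) k))"
      by (intro eventually_ball_finite) auto
    moreover have "\<forall>\<^sub>F x in nhds g. det x \<noteq> 0"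
      using eventually_nhds_in_open[OF open_det_nz] g by auto
    ultimately have "\<forall>\<^sub>F x in nhds g. x \<in> ?A"
    proof eventually_elim
      case (elim x)
      have b: "frame (G x)" unfolding G_def using elim detR by (simp add: frame_columns det_mul)
      obtain f where "oframe (\<lambda>k. f k *s gs (G x) k) s" "flag_of (\<lambda>k. f k *s gs (G x) k) = flag_of (G x)"
        using gs_normalize[of "G x" s, OF b oframe_sign[OF c(1)]] elim by blast
      then have "flag_of (G x) \<in> sflags s" unfolding sflags_def by (auto intro: exI[of _ "\<lambda>k. f k *s gs (G x) k"])
      moreover have "flag_of (G x) = act x std_flag"
        using R by (simp add: G_def act_std_flag[symmetric] act_act[symmetric])
      ultimately show ?case using elim by simp
    qed
    then show "\<exists>T. open T \<and> g \<in> T \<and> T \<subseteq> ?A" by (auto simp: eventually_nhds)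
  qed
qed

text \<open>The isotropic Gram-Schmidt vectors are repaired one after the other. If
  \<open>y = gs b k\<close> is isotropic, let \<open>z\<close> be orthogonal to the earlier vectors
  with \<open>h y z = 1\<close>; adding \<open>t z\<close> to \<open>b k\<close> changes the square
  of \<open>y\<close> to \<open>t (2 + t h z z)\<close>, nonzero for small positive
  \<open>t\<close>, and leaves the earlier vectors alone.\<close>

lemma nondegenerate_dense:
  assumes "open U" "frame b" "mat_of b \<in> U" "m \<le> p + q"
  shows "\<exists>b'. frame b' \<and> mat_of b' \<in> U \<and> (\<forall>j\<in>{1..m}. h (gs b' j) (gs b' j) \<noteq> 0)"
proof -
  have "m \<le> p + q \<Longrightarrow> \<exists>b'. frame b' \<and> mat_of b' \<in> U \<and> (\<forall>j\<in>{1..m}. h (gs b' j) (gs b' j) \<noteq> 0)"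
  proof (induction m)
    case 0 then show ?case using assms by auto
  next
    case (Suc m)
    then obtain b where b: "frame b" "mat_of b \<in> U" "\<And>j. j \<in> {1..m} \<Longrightarrow> h (gs b j) (gs b j) \<noteq> 0" by auto
    let ?k = "Suc m"
    define y where "y = gs b ?k"
    show ?case
    proof (cases "h y y = 0")
      case False
      then show ?thesis using b by (intro exI[of _ b]) (auto simp: y_def atLeastAtMostSuc_conv)
    next
      case True
      have orth: "j \<in> {1..m} \<Longrightarrow> h y (gs b j) = 0" for j unfolding y_def by (rule gs_orth) (use b in auto)
      have "y \<noteq> 0" unfolding y_def using frame_nonzero[OF gs_frame(1)[OF b(1)], of ?k] Suc.prems card_n by simp
      then obtain w where w: "h y w \<noteq> 0" using h_nondegenerate by blast
      define w' where "w' = w - (\<Sum>j\<in>{1..m}. (h w (gs b j) / h (gs b j) (gs b j)) *s gs b j)"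
      have "h y w' = h y w" unfolding w'_def h_diff_right h_sum_right h_scale_right using orth by simp
      \<comment> \<open>The conjugate compensates for \<open>h\<close> being antilinear in its
        second argument.\<close>
      define z where "z = (1 / cnj (h y w')) *s w'"
      have yz: "h y z = 1" using w \<open>h y w' = h y w\<close> by (simp add: z_def h_linear)
      then have zy: "h z y = 1" using h_sym[of z y] by (metis complex_cnj_one h_sym)
      have w'0: "h w' (gs b j) = 0" if j: "j \<in> {1..m}" for j
      proof -
        have "(\<Sum>i\<in>{1..m}. h w (gs b i) / h (gs b i) (gs b i) * h (gs b i) (gs b j))
          = (\<Sum>i\<in>{1..m}. if i = j then h w (gs b j) else 0)"
        proof (rule sum.cong)
          fix i assume i: "i \<in> {1..m}"
          have "h (gs b i) (gs b j) = 0" if "i \<noteq> j"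
            using gs_orth[of i b j] gs_orth[of j b i] h_eq_0_sym[of "gs b i" "gs b j"] i j that b(3)
            by (cases "i < j") auto
          then show "h w (gs b i) / h (gs b i) (gs b i) * h (gs b i) (gs b j) = (if i = j then h w (gs b j) else 0)"
            using b(3)[OF i] by auto
        qed simp
        then show ?thesis using j by (simp add: w'_def h_linear)
      qed
      then have z0: "h z (gs b j) = 0" if "j \<in> {1..m}" for j using that by (simp add: z_def h_linear)
      define c where "c = (\<lambda>t::real. b(?k := b ?k + of_real t *s z))"
      have gsc: "gs (c t) j = gs b j" if "j \<in> {1..m}" for j t
        by (rule gs_cong) (use that in \<open>auto simp: c_def\<close>)
      have gsk: "gs (c t) ?k = y + of_real t *s z" for t
      proof -
        have "(\<Sum>j\<in>{1..<?k}. (h (c t ?k) (gs (c t) j) / h (gs (c t) j) (gs (c t) j)) *s gs (c t) j)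
          = (\<Sum>j\<in>{1..<?k}. (h (b ?k) (gs b j) / h (gs b j) (gs b j)) *s gs b j)"
          by (rule sum.cong) (use gsc z0 in \<open>auto simp: c_def h_linear\<close>)
        then show ?thesis unfolding y_def
          by (subst (1 2) gs.simps) (simp add: c_def)
      qed
      have hk: "h (gs (c t) ?k) (gs (c t) ?k) = of_real t * (2 + of_real t * h z z)" for t
        unfolding gsk using True by (simp add: h_linear yz zy algebra_simps)
      have matc: "mat_of (c t) = mat_of b + t *\<^sub>R mat_of ((\<lambda>_. 0)(?k := z))" for t
        by (simp add: mat_of_def c_def vec_eq_iff) (simp add: scaleR_conv_of_real)
      have lim: "((\<lambda>t. mat_of (c t)) \<longlongrightarrow> mat_of b) (at_right 0)"
        unfolding matc by (auto intro!: tendsto_eq_intros)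
      have "\<forall>\<^sub>F t in at_right 0. mat_of (c t) \<in> U \<inter> {g. det g \<noteq> 0}"
        by (rule topological_tendstoD[OF lim])
          (use assms(1) b open_det_nz in \<open>auto simp: frame_iff_det intro: open_Int\<close>)
      moreover have "((\<lambda>t. 2 + of_real t * h z z) \<longlongrightarrow> 2) (at_right 0)"
        by (auto intro!: tendsto_eq_intros)
      then have "\<forall>\<^sub>F t in at_right 0. 2 + of_real t * h z z \<noteq> 0"
        by (rule tendsto_imp_eventually_ne) simp
      moreover have "\<forall>\<^sub>F t :: real in at_right 0. 0 < t" by (rule eventually_at_right_less)
      ultimately have "\<forall>\<^sub>F t in at_right 0. frame (c t) \<and> mat_of (c t) \<in> U \<and> h (gs (c t) ?k) (gs (c t) ?k) \<noteq> 0"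
        by eventually_elim (auto simp: hk frame_iff_det)
      then obtain t where t: "frame (c t)" "mat_of (c t) \<in> U" "h (gs (c t) ?k) (gs (c t) ?k) \<noteq> 0"
        using eventually_happens'[OF trivial_limit_at_right_real] by blast
      then show ?thesis using gsc b(3) by (intro exI[of _ "c t"]) (auto simp: atLeastAtMostSuc_conv)
    qed
  qed
  then show ?thesis using assms by blast
qed

lemma nondegenerate_sflags:
  assumes b: "frame b" "\<And>j. j \<in> {1..p+q} \<Longrightarrow> h (gs b j) (gs b j) \<noteq> 0"
  obtains s c where "oframe c s" "flag_of c = flag_of b"
proof -
  define s :: "nat \<Rightarrow> complex" where "s = (\<lambda>k. if Re (h (gs b k) (gs b k)) > 0 then 1 else -1)"
  have pos: "0 < Re (s k * h (gs b k) (gs b k))" if "k \<in> {1..p+q}" for k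
    using b(2)[OF that] h_self_real[of "gs b k"] by (auto simp: s_def complex_is_Real_iff complex_eq_iff)
  have sgn: "s k = 1 \<or> s k = -1" for k by (simp add: s_def)
  show ?thesis
  proof (rule gs_normalize[of b s, OF b(1) sgn pos])
    fix f assume "oframe (\<lambda>k. f k *s gs b k) s" "flag_of (\<lambda>k. f k *s gs b k) = flag_of b"
    then show ?thesis by (rule that)
  qed
qed

lemma SU_mult: "g \<in> SU p q \<Longrightarrow> k \<in> SU p q \<Longrightarrow> g ** (k :: 'n cmat) \<in> SU p q"
  by (simp add: SU_def SL_def det_mul flip: matrix_vector_mul_assoc)

lemma SU_inverse:
  assumes "g \<in> SU p q" obtains k where "k \<in> SU p q" "k ** g = mat 1" "g ** (k :: 'n cmat) = mat 1"
proof -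
  have d: "det g = 1" using assms SU_det by blast
  then have "invertible g" unfolding invertible_det_nz by simp
  then obtain k where k: "k ** g = mat 1" "g ** k = mat 1" unfolding invertible_def by blast
  have gk: "g *v (k *v v) = v" for v by (simp add: matrix_vector_mul_assoc k)
  have "h (k *v v) (k *v w) = h v w" for v w using SU_h[OF assms, of "k *v v" "k *v w"] by (simp add: gk)
  moreover have "det k = 1" using arg_cong[OF k(1), of det] d by (simp add: det_mul)
  ultimately show ?thesis using that[of k] k by (simp add: SU_def SL_def)
qed

lemma orbit_SU_act: 
  assumes "g \<in> SU p q" shows "orbit (SU p q) (act g F) = orbit (SU p q) (F :: 'n flag)"
proof
  show "orbit (SU p q) (act g F) \<subseteq> orbit (SU p q) F"
    using SU_mult[OF _ assms] by (auto simp: orbit_def act_act)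
  obtain k where k: "k \<in> SU p q" "k ** g = mat 1" "g ** k = mat 1" using SU_inverse[OF assms] .
  show "orbit (SU p q) F \<subseteq> orbit (SU p q) (act g F)"
  proof
    fix F' assume "F' \<in> orbit (SU p q) F"
    then obtain l where l: "l \<in> SU p q" "F' = act l F" by (auto simp: orbit_def)
    have "F' = act (l ** k) (act g F)" using l k by (simp add: act_act matrix_mul_assoc[symmetric])
    then show "F' \<in> orbit (SU p q) (act g F)" using SU_mult[OF l(1) k(1)] by (auto simp: orbit_def)
  qed
qed

text \<open>An open orbit meets the dense set of flags with nonvanishing Gram-Schmidt squares and is
  the orbit of any flag in it, in particular of one with an orthonormal frame.\<close>

lemma open_orbits_iff: "(D :: 'n flag set) \<in> open_orbits p q \<longleftrightarrow> (\<exists>c s. oframe c s \<and> D = sflags s)"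
proof
  assume "\<exists>c s. oframe c s \<and> D = sflags s"
  then obtain c s where c: "oframe c s" "D = sflags s" by blast
  then show "D \<in> open_orbits p q"
    using orbit_SU[OF c(1)] open_sflags[of s] flag_of_flags[OF oframe_frame[OF c(1)]] 
    unfolding open_orbits_def by blast
next
  assume "D \<in> open_orbits p q"
  then obtain F where F: "F \<in> flags" "D = orbit (SU p q) F" "openin flag_topology D" by (auto simp: open_orbits_def)
  obtain b where b: "frame b" "F = flag_of b" using F(1) flags_frame by blast
  have "act (mat 1) F \<in> D" unfolding F(2) orbit_def by (rule imageI) (simp add: SU_def SL_def)
  then have "mat_of b \<in> {g. det g \<noteq> 0 \<and> act g std_flag \<in> D}" 
    using b act_mat_of[OF b(1)] frame_iff_det by auto
  moreover have "open {g. det g \<noteq> 0 \<and> act g std_flag \<in> D}" using F(3) by (simp add: openin_flag_topology_GL)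
  ultimately obtain b' where b': "frame b'" "act (mat_of b') std_flag \<in> D" "\<forall>j\<in>{1..p+q}. h (gs b' j) (gs b' j) \<noteq> 0"
    using nondegenerate_dense[OF _ b(1) _ order_refl] by blast
  obtain c s where c: "oframe c s" "flag_of c = flag_of b'" using nondegenerate_sflags[OF b'(1)] b'(3) by blast
  have "flag_of c \<in> D" using act_mat_of[OF b'(1)] b'(2) c(2) by simp
  then obtain g where "g \<in> SU p q" "flag_of c = act g F" unfolding F(2) orbit_def by auto
  then have "D = orbit (SU p q) (flag_of c)" using orbit_SU_act F(2) by metis
  then show "\<exists>c s. oframe c s \<and> D = sflags s" using orbit_SU[OF c(1)] c(1) by blast
qed

end

section \<open>Charts of the flag manifold\<close>

lemma flag_of_e: "flag_of (e :: nat \<Rightarrow> 'n::{finite,linorder} cvec) m = {t. \<forall>i. m < rk i \<longrightarrow> t $ i = 0}"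
proof
  have "vec.subspace {t :: 'n cvec. \<forall>i. m < rk i \<longrightarrow> t $ i = 0}" by (auto simp: vec.subspace_def)
  moreover have "e k \<in> {t :: 'n cvec. \<forall>i. m < rk i \<longrightarrow> t $ i = 0}" if "k \<in> {1..m}" for k
  proof (cases "k \<le> CARD('n)")
    case True
    then show ?thesis using that rk_idx[of k, where 'n='n] by (auto simp: e_nth)
  next
    case False
    then have "rk i \<le> m" for i :: 'n using that rk_range[of i] by auto
    then show ?thesis by (auto simp: not_less[symmetric])
  qed
  ultimately show "flag_of (e :: nat \<Rightarrow> 'n cvec) m \<subseteq> {t. \<forall>i. m < rk i \<longrightarrow> t $ i = 0}"
    unfolding flag_of_def by (intro vec.span_minimal) auto
  show "{t. \<forall>i. m < rk i \<longrightarrow> t $ i = 0} \<subseteq> flag_of (e :: nat \<Rightarrow> 'n cvec) m"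
  proof
    fix t :: "'n cvec" assume "t \<in> {t. \<forall>i. m < rk i \<longrightarrow> t $ i = 0}"
    then have t: "\<And>i. m < rk i \<Longrightarrow> t $ i = 0" by simp
    have "t = mat 1 *v t" by simp
    also have "\<dots> = mat_of e *v t" using mat_of_columns[of "mat 1 :: 'n cmat"] by simp
    also have "\<dots> = (\<Sum>k=1..CARD('n). t $ idx k *s e k)" by (rule mat_of_mult)
    also have "\<dots> \<in> flag_of e m"
    proof (intro vec.subspace_sum subspace_flag_of)
      fix k assume k: "k \<in> {1..CARD('n)}"
      show "t $ idx k *s e k \<in> flag_of e m"
      proof (cases "k \<le> m")
        case True then show ?thesis using k by (intro vec.subspace_scale subspace_flag_of flag_of_base) auto
      next
        case False
        then show ?thesis using t[of "idx k"] rk_idx[OF k] vec.subspace_0[OF subspace_flag_of] by auto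
      qed
    qed
    finally show "t \<in> flag_of e m" .
  qed
qed

lemma act_std: "act M (std_flag :: 'n::{finite,linorder} flag) m = (*v) M ` {t. \<forall>i. m < rk i \<longrightarrow> t $ i = 0}"
  by (simp add: act_def std_flag_def flag_of_e)

section \<open>Unitriangular matrices, LU factorization and changes of charts\<close>

abbreviation mx :: "complex^('n \<times> 'n) \<Rightarrow> 'n::finite cmat" where
  "mx X \<equiv> (\<chi> i j. X $ (i, j))"

text \<open>Charts take their arguments in \<open>strictly_lower\<close>, while
  \<open>complex_submanifold\<close> asks for open sets and maps of the ambient space; this
  projection is what extends the chart changes.\<close>

definition low :: "complex^('n \<times> 'n) \<Rightarrow> complex^('n::{finite,linorder} \<times> 'n)" where
  "low X = (\<chi> ij. if snd ij < fst ij then X $ ij else 0)"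

lemma low_strictly_lower: "low X \<in> strictly_lower"
  by (auto simp: low_def strictly_lower_def)

lemma low_id: "X \<in> strictly_lower \<Longrightarrow> low X = X"
  by (auto simp: low_def strictly_lower_def vec_eq_iff not_less)

lemma unipotent_nth: "((mat 1 + mx X) *v (v :: 'n::{finite,linorder} cvec)) $ i = v $ i + (\<Sum>j\<in>UNIV. X $ (i, j) * v $ j)"
  by (simp add: matrix_vector_mult_add_rdistrib matrix_vector_mult_def[of "mx X"])

text \<open>The first nonzero entry of \<open>v\<close> is not changed by a lower unitriangular
  matrix.\<close>

lemma unipotent_first:
  fixes v :: "'n::{finite,linorder} cvec"
  assumes X: "X \<in> strictly_lower" and z: "\<And>j. j \<le> m \<Longrightarrow> ((mat 1 + mx X) *v v) $ j = 0" and i: "i \<le> m"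
  shows "v $ i = 0"
proof (rule ccontr)
  assume "v $ i \<noteq> 0"
  define i0 where "i0 = Min {j. v $ j \<noteq> 0}"
  have "i0 \<in> {j. v $ j \<noteq> 0}" unfolding i0_def by (rule Min_in) (use \<open>v $ i \<noteq> 0\<close> in auto)
  moreover have le: "i0 \<le> j" if "v $ j \<noteq> 0" for j unfolding i0_def by (rule Min_le) (use that in auto)
  ultimately have i0: "v $ i0 \<noteq> 0" "i0 \<le> i" using \<open>v $ i \<noteq> 0\<close> by auto
  have less: "v $ j = 0" if "j < i0" for j using le[of j] that by (meson leD)
  have "(\<Sum>j\<in>UNIV. X $ (i0, j) * v $ j) = 0"
    by (rule sum.neutral) (use X less in \<open>auto simp: strictly_lower_def not_less[symmetric]\<close>)
  then show False using z[of i0] i0 order_trans[OF i0(2) i] by (simp add: unipotent_nth)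
qed

lemma det_if_kernel: 
  assumes "\<And>v. (A :: 'n::finite cmat) *v v = 0 \<Longrightarrow> v = 0" shows "det A \<noteq> 0"
  using assms matrix_left_invertible_ker[of A] invertible_left_inverse[of A] invertible_det_nz[of A] by blast

lemma kernel_det: 
  assumes "det (A :: 'n::finite cmat) \<noteq> 0" "A *v v = 0" shows "v = 0"
  using assms matrix_left_invertible_ker[of A] invertible_left_inverse[of A] invertible_det_nz[of A] by blast

lemma det_unipotent: "X \<in> strictly_lower \<Longrightarrow> det (mat 1 + mx X :: 'n::{finite,linorder} cmat) \<noteq> 0"
proof (rule det_if_kernel)
  fix v :: "'n cvec" assume *: "X \<in> strictly_lower" "(mat 1 + mx X) *v v = 0"
  have "v $ i = 0" for i
    by (rule unipotent_first[OF *(1), of i]) (use *(2) in auto)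
  then show "v = 0" by (simp add: vec_eq_iff)
qed

text \<open>The columns beyond \<open>j\<close> are unit vectors, so the determinant is the leading
  principal minor of \<open>A\<close> up to \<open>j\<close>. Thus \<open>lu_dom\<close> asks that
  all leading minors be nonzero, the criterion for an LU factorization.\<close>

definition lead :: "'n \<Rightarrow> 'n cmat \<Rightarrow> 'n::{finite,linorder} cmat" where
  "lead j A = (\<chi> i l. if l \<le> j then A $ i $ l else if i = l then 1 else 0)"

definition lu_dom :: "'n::{finite,linorder} cmat \<Rightarrow> bool" where
  "lu_dom A \<longleftrightarrow> (\<forall>j. det (lead j A) \<noteq> 0)"

text \<open>
  By Cramer's rule, \<open>lu A\<close> is the strictly lower triangular part of the factor \<open>L\<close> in the
  factorization \<open>A = L U\<close> into a lower unitriangular and an upper triangular matrix.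
\<close>

definition lu_col :: "'n \<Rightarrow> 'n cmat \<Rightarrow> 'n::{finite,linorder} cvec" where
  "lu_col j A = (\<chi> k. det (\<chi> i l. if l = k then axis j 1 $ i else lead j A $ i $ l) / det (lead j A))"

definition lu :: "'n cmat \<Rightarrow> complex^('n::{finite,linorder} \<times> 'n)" where
  "lu A = (\<chi> ij. if snd ij < fst ij then - (lu_col (snd ij) A $ fst ij) else 0)"

lemma lead_mult: 
  "lead j A *v x = A *v (\<chi> l. if l \<le> j then x $ l else 0) + (\<chi> l. if l \<le> j then 0 else x $ l)"
proof -
  have "(\<Sum>l\<in>UNIV. lead j A $ i $ l * x $ l) =
      (\<Sum>l\<in>UNIV. A $ i $ l * (if l \<le> j then x $ l else 0)) + (\<Sum>l\<in>UNIV. if l = i then if l \<le> j then 0 else x $ l else 0)" for i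
    unfolding sum.distrib[symmetric] by (rule sum.cong) (auto simp: lead_def)
  then show ?thesis by (simp add: vec_eq_iff matrix_vector_mult_def)
qed

lemma lu_col: "det (lead j A) \<noteq> 0 \<Longrightarrow> lead j A *v x = axis j 1 \<longleftrightarrow> x = lu_col j A"
  unfolding lu_col_def by (rule cramer)

lemma lu_strictly_lower: "lu A \<in> strictly_lower"
  by (auto simp: lu_def strictly_lower_def)

lemma det_lu_dom: "lu_dom A \<Longrightarrow> det (A :: 'n::{finite,linorder} cmat) \<noteq> 0"
proof -
  assume "lu_dom A"
  moreover have "lead (Max UNIV) A = A" by (simp add: lead_def vec_eq_iff)
  ultimately show ?thesis unfolding lu_dom_def by metis
qed

lemma sum_axis: "(\<Sum>l\<in>UNIV. f l * axis j (1 :: complex) $ l) = f (j :: 'n::finite)"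
  by (simp add: axis_def if_distrib cong: if_cong)

text \<open>The solution \<open>y\<close> of \<open>lead j A *v y = axis j 1\<close>, cut off after
  \<open>j\<close>, is mapped by \<open>A\<close> to the unit vector minus the tail of
  \<open>y\<close>. This image lies in the subspace of the flag at level \<open>j\<close> and is
  column \<open>j\<close> of \<open>1 + lu A\<close>, which accounts for the minus sign in
  \<open>lu\<close>.\<close>

lemma lu_act:
  assumes "lu_dom (A :: 'n::{finite,linorder} cmat)" 
  shows "act (mat 1 + mx (lu A)) std_flag = act A std_flag"
  unfolding act_std_flag
proof (rule flag_of_eqI)
  show "frame (\<lambda>k. (mat 1 + mx (lu A)) *v e k)" by (simp add: frame_columns det_unipotent lu_strictly_lower)
  show "frame (\<lambda>k. A *v e k)" using det_lu_dom[OF assms] by (simp add: frame_columns)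
  fix k assume k: "k \<in> {1..CARD('n)}"
  define j :: 'n where "j = idx k"
  have rkj: "rk j = k" using rk_idx[OF k] by (simp add: j_def)
  let ?y = "lu_col j A"
  let ?t = "(\<chi> l. if l \<le> j then ?y $ l else 0) :: 'n cvec"
  have "axis j 1 = A *v ?t + (\<chi> l. if l \<le> j then 0 else ?y $ l)"
    using assms lu_col[of j A ?y] lead_mult[of j A ?y] by (simp add: lu_dom_def)
  then have At: "A *v ?t = axis j 1 - (\<chi> l. if l \<le> j then 0 else ?y $ l)" by simp
  have "((mat 1 + mx (lu A)) *v e k) $ i = (A *v ?t) $ i" for i
    unfolding At unipotent_nth e_def j_def[symmetric] sum_axis
    by (auto simp: axis_def lu_def)
  then have "(mat 1 + mx (lu A)) *v e k = A *v ?t" by (simp add: vec_eq_iff)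
  also have "\<dots> \<in> act A std_flag k" unfolding act_std using rkj by (auto simp: not_less[symmetric] simp flip: rk_less_iff)
  finally show "(mat 1 + mx (lu A)) *v e k \<in> flag_of (\<lambda>k. A *v e k) k" by (simp add: act_std_flag)
qed

text \<open>If the flag of \<open>A\<close> has the coordinates \<open>Y\<close>, a kernel vector of
  \<open>lead j A\<close> yields a vector of the subspace at level \<open>j\<close> whose entries up
  to \<open>j\<close> vanish, and \<open>unipotent_first\<close> makes it 0. So the minors are
  nonzero, and the columns of \<open>1 + Y\<close> solve the systems defining
  \<open>lu A\<close>.\<close>

lemma lu_unique:
  assumes Y: "Y \<in> strictly_lower" and A: "det (A :: 'n::{finite,linorder} cmat) \<noteq> 0"
    and eq: "act (mat 1 + mx Y) std_flag = act A std_flag"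
  shows "lu_dom A" "lu A = Y"
proof -
  show dom: "lu_dom A"
    unfolding lu_dom_def
  proof (intro allI det_if_kernel)
    fix j :: 'n and x assume x: "lead j A *v x = 0"
    let ?t = "(\<chi> l. if l \<le> j then x $ l else 0) :: 'n cvec"
    have "A *v ?t \<in> act A std_flag (rk j)" unfolding act_std by (auto simp: not_less[symmetric])
    then have "A *v ?t \<in> act (mat 1 + mx Y) std_flag (rk j)" using eq by simp
    then obtain t where t: "A *v ?t = (mat 1 + mx Y) *v t" "\<And>i. j < i \<Longrightarrow> t $ i = 0" unfolding act_std by auto
    have At: "A *v ?t = - (\<chi> l. if l \<le> j then 0 else x $ l)" using x unfolding lead_mult by (simp add: eq_neg_iff_add_eq_0)
    have "t $ i = 0" for i
    proof (cases "i \<le> j")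
      case True
      show ?thesis by (rule unipotent_first[OF Y _ True]) (simp add: At flip: t(1))
    qed (use t(2) in auto)
    then have "t = 0" by (simp add: vec_eq_iff)
    then have "A *v ?t = 0" using t(1) by simp
    then have "?t = 0" "(\<chi> l. if l \<le> j then 0 else x $ l) = 0" using kernel_det[OF A] At by auto
    then have *: "?t $ i = 0" "(\<chi> l. if l \<le> j then 0 else x $ l) $ i = 0" for i by simp_all
    have "x $ i = 0" for i using *[of i] by (simp split: if_splits)
    then show "x = 0" by (simp add: vec_eq_iff)
  qed
  have "lu A $ (k, j) = Y $ (k, j)" for k j
  proof (cases "j < k")
    case True
    have "(mat 1 + mx Y) *v axis j 1 \<in> act (mat 1 + mx Y) std_flag (rk j)" unfolding act_std by (auto simp: axis_def)
    then have "(mat 1 + mx Y) *v axis j 1 \<in> act A std_flag (rk j)" using eq by simp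
    then obtain z where z: "(mat 1 + mx Y) *v axis j 1 = A *v z" "\<And>i. j < i \<Longrightarrow> z $ i = 0" unfolding act_std by auto
    define x where "x = (\<chi> l. if l \<le> j then z $ l else - Y $ (l, j))"
    have "(\<chi> l. if l \<le> j then x $ l else 0) = z" using z(2) by (auto simp: vec_eq_iff x_def not_le)
    then have "lead j A *v x = (mat 1 + mx Y) *v axis j 1 + (\<chi> l. if l \<le> j then 0 else x $ l)"
      unfolding lead_mult z(1) by simp
    also have "\<dots> = axis j 1"
      using Y unfolding vec_eq_iff vector_add_component unipotent_nth sum_axis
      by (auto simp: x_def axis_def strictly_lower_def)
    finally have "x = lu_col j A" using lu_col[of j A x] dom by (simp add: lu_dom_def)
    then have "lu_col j A $ k = - Y $ (k, j)" using True[folded not_le] by (simp add: x_def flip: \<open>x = lu_col j A\<close>)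
    then show ?thesis using True by (simp add: lu_def)
  next
    case False
    then show ?thesis using Y lu_strictly_lower[of A] by (simp add: strictly_lower_def)
  qed
  then show "lu A = Y" by (simp add: vec_eq_iff)
qed

lemma unipotent_unique:
  assumes "X \<in> strictly_lower" "Y \<in> strictly_lower" 
    "act (mat 1 + mx X) std_flag = act (mat 1 + mx Y :: 'n::{finite,linorder} cmat) std_flag"
  shows "X = Y"
  using lu_unique[OF assms(1) det_unipotent[OF assms(2)] assms(3)] 
    lu_unique[OF assms(2) det_unipotent[OF assms(2)] refl] by metis

text \<open>The coordinate change between two charts, extended by the identity on the entries that
  are not strictly lower. This makes it a biholomorphic map between open sets of the ambient
  space.\<close>

definition transit :: "'n cmat \<Rightarrow> complex^('n \<times> 'n) \<Rightarrow> complex^('n::{finite,linorder} \<times> 'n)" where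
  "transit A X = lu (A ** (mat 1 + mx (low X))) + (X - low X)"

definition transit_dom :: "'n cmat \<Rightarrow> (complex^('n::{finite,linorder} \<times> 'n)) set" where
  "transit_dom A = {X. lu_dom (A ** (mat 1 + mx (low X)))}"

lemma low_transit: "low (transit A X) = lu (A ** (mat 1 + mx (low X)))"
  by (auto simp: low_def transit_def vec_eq_iff lu_def)

lemma transit_inverse:
  assumes B: "B ** A = (mat 1 :: 'n::{finite,linorder} cmat)" "A ** B = mat 1" and X: "X \<in> transit_dom A"
  shows "transit A X \<in> transit_dom B" "transit B (transit A X) = X"
proof -
  let ?Y = "lu (A ** (mat 1 + mx (low X)))"
  have "act (mat 1 + mx ?Y) std_flag = act (A ** (mat 1 + mx (low X))) std_flag"
    using X by (intro lu_act) (simp add: transit_dom_def)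
  then have "act B (act (mat 1 + mx ?Y) std_flag) = act B (act (A ** (mat 1 + mx (low X))) std_flag)" by simp
  then have eq: "act (mat 1 + mx (low X)) std_flag = act (B ** (mat 1 + mx ?Y)) std_flag"
    by (simp add: act_act matrix_mul_assoc B)
  have "det B \<noteq> 0" using arg_cong[OF B(1), of det] by (auto simp: det_mul)
  then have d: "det (B ** (mat 1 + mx ?Y)) \<noteq> 0" by (simp add: det_mul det_unipotent lu_strictly_lower)
  have 1: "lu_dom (B ** (mat 1 + mx ?Y))" "lu (B ** (mat 1 + mx ?Y)) = low X"
    using lu_unique[OF low_strictly_lower d eq] by auto
  show "transit A X \<in> transit_dom B" using 1 by (simp add: transit_dom_def low_transit)
  show "transit B (transit A X) = X"
    unfolding transit_def[of B] low_transit using 1 by (simp add: transit_def)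
qed

subsection \<open>Holomorphy\<close>

text \<open>Complex differentiability of a scalar function. The scalar multiplication of the domain
  is a parameter, so that the same rules serve functions of a vector (chart changes) and of one
  complex variable (curves in a chart).\<close>

definition chol :: "(complex \<Rightarrow> 'a \<Rightarrow> 'a) \<Rightarrow> ('a::real_normed_vector \<Rightarrow> complex) \<Rightarrow> 'a \<Rightarrow> bool" where
  "chol sc f x \<longleftrightarrow> (\<exists>f'. (f has_derivative f') (at x) \<and> (\<forall>c v. f' (sc c v) = c * f' v))"

lemma chol_const: "chol sc (\<lambda>_. a) x"
  unfolding chol_def by (rule exI[of _ "\<lambda>_. 0"]) (auto intro: derivative_eq_intros)

lemma chol_add: "chol sc f x \<Longrightarrow> chol sc g x \<Longrightarrow> chol sc (\<lambda>x. f x + g x) x"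
  unfolding chol_def by (elim exE conjE, rule exI, rule conjI, rule has_derivative_add) (auto simp: algebra_simps)

lemma chol_minus: "chol sc f x \<Longrightarrow> chol sc (\<lambda>x. - f x) x"
  unfolding chol_def by (elim exE conjE, rule exI, rule conjI, rule has_derivative_minus) auto

lemma chol_diff: "chol sc f x \<Longrightarrow> chol sc g x \<Longrightarrow> chol sc (\<lambda>x. f x - g x) x"
  unfolding chol_def by (elim exE conjE, rule exI, rule conjI, rule has_derivative_diff) (auto simp: algebra_simps)

lemma chol_mult: "chol sc f x \<Longrightarrow> chol sc g x \<Longrightarrow> chol sc (\<lambda>x. f x * g x) x"
  unfolding chol_def by (elim exE conjE, rule exI, rule conjI, rule has_derivative_mult) (auto simp: algebra_simps)

lemma chol_inverse: "chol sc f x \<Longrightarrow> f x \<noteq> 0 \<Longrightarrow> chol sc (\<lambda>x. inverse (f x)) x"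
  unfolding chol_def by (elim exE conjE, rule exI, rule conjI, rule Deriv.has_derivative_inverse) (auto simp: algebra_simps)

lemma chol_divide: "chol sc f x \<Longrightarrow> chol sc g x \<Longrightarrow> g x \<noteq> 0 \<Longrightarrow> chol sc (\<lambda>x. f x / g x) x"
  unfolding divide_inverse by (intro chol_mult chol_inverse)

lemma chol_sum: "(\<And>i. i \<in> A \<Longrightarrow> chol sc (f i) x) \<Longrightarrow> chol sc (\<lambda>x. \<Sum>i\<in>A. f i x) x"
  by (induction A rule: infinite_finite_induct) (auto intro: chol_const chol_add)

lemma chol_prod: "(\<And>i. i \<in> A \<Longrightarrow> chol sc (f i) x) \<Longrightarrow> chol sc (\<lambda>x. \<Prod>i\<in>A. f i x) x"
  by (induction A rule: infinite_finite_induct) (auto intro: chol_const chol_mult)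

lemma chol_nth: "chol (*s) (\<lambda>x. x $ i) (x :: (complex, 'm::finite) vec)"
  unfolding chol_def
  by (rule exI[of _ "\<lambda>x. x $ i"]) (auto intro: bounded_linear.has_derivative[OF bounded_linear_vec_nth] has_derivative_ident)

lemma chol_det:
  assumes "\<And>i j. chol sc (\<lambda>x. M x $ i $ j) x" shows "chol sc (\<lambda>x. det (M x :: 'n::finite cmat)) x"
  unfolding det_def by (intro chol_sum chol_mult chol_prod chol_const assms)

lemmas chol_intros = chol_const chol_add chol_minus chol_diff chol_mult chol_divide chol_sum chol_prod

lemma chol_matrix_mult:
  assumes "\<And>i j. chol sc (\<lambda>x. M x $ i $ j) x" "\<And>i j. chol sc (\<lambda>x. N x $ i $ j) x" 
  shows "chol sc (\<lambda>x. (M x ** (N x :: 'n::finite cmat)) $ i $ j) x"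
  by (simp add: matrix_matrix_mult_def) (intro chol_intros assms)

lemma chol_continuous: "chol sc f x \<Longrightarrow> isCont f x"
  unfolding chol_def by (auto intro: has_derivative_continuous)

lemma chol_lead:
  assumes "\<And>i j. chol sc (\<lambda>x. M x $ i $ j) x" shows "chol sc (\<lambda>x. lead l (M x :: 'n::{finite,linorder} cmat) $ i $ j) x"
  unfolding lead_def vec_lambda_beta using assms by (cases "j \<le> l"; cases "i = j") (simp_all add: chol_const)

lemma chol_lu:
  assumes M: "\<And>i j. chol sc (\<lambda>x. M x $ i $ j) x" and dom: "lu_dom (M x :: 'n::{finite,linorder} cmat)" 
  shows "chol sc (\<lambda>x. lu (M x) $ k) x"
proof -
  have 1: "chol sc (\<lambda>x. if l = fst k then axis (snd k) 1 $ i else lead (snd k) (M x) $ i $ l) x" for i l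
    by (cases "l = fst k") (auto intro: chol_const chol_lead M)
  have "chol sc (\<lambda>x. det (\<chi> i l. if l = fst k then axis (snd k) 1 $ i else lead (snd k) (M x) $ i $ l) / det (lead (snd k) (M x))) x"
    using dom 1 by (intro chol_divide chol_det) (auto simp: lu_dom_def intro: chol_lead M)
  then have "chol sc (\<lambda>x. - (lu_col (snd k) (M x) $ fst k)) x" unfolding lu_col_def vec_lambda_beta by (rule chol_minus)
  then show ?thesis unfolding lu_def by (cases "snd k < fst k") (auto intro: chol_const)
qed

lemma open_lu_dom:
  fixes M :: "'a::real_normed_vector \<Rightarrow> 'n::{finite,linorder} cmat"
  assumes "\<And>x i j. chol sc (\<lambda>x. M x $ i $ j) x" 
  shows "open {x. lu_dom (M x)}"
proof -
  have "{x. lu_dom (M x)} = (\<Inter>j. {x. det (lead j (M x)) \<noteq> 0})" by (auto simp: lu_dom_def)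
  moreover have "open {x. det (lead j (M x)) \<noteq> 0}" for j
  proof (intro open_Collect_neq continuous_on_const)
    show "continuous_on UNIV (\<lambda>x. det (lead j (M x)))"
      by (intro continuous_at_imp_continuous_on ballI chol_continuous[where sc=sc] chol_det chol_lead assms)
  qed
  ultimately show ?thesis by (simp add: open_INT)
qed

lemma chol_vector:
  fixes f :: "'a::real_normed_vector \<Rightarrow> (complex, 'm::finite) vec"
  assumes "\<And>k. chol sc (\<lambda>x. f x $ k) x"
  shows "\<exists>f'. (f has_derivative f') (at x) \<and> (\<forall>c v. f' (sc c v) = c *s f' v)"
proof -
  obtain d where d: "\<And>k. ((\<lambda>x. f x $ k) has_derivative d k) (at x)" "\<And>k c v. d k (sc c v) = c * d k v"
    using assms unfolding chol_def by metis
  have ax: "bounded_linear (\<lambda>z :: complex. z *s (axis k 1 :: (complex, 'm) vec))" for k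
    by (rule linear_conv_bounded_linear[THEN iffD1])
      (auto intro!: linearI simp: vec_eq_iff algebra_simps)
  have "((\<lambda>x. \<Sum>k\<in>UNIV. f x $ k *s axis k 1) has_derivative (\<lambda>v. \<Sum>k\<in>UNIV. d k v *s axis k 1)) (at x)"
    by (intro has_derivative_sum bounded_linear.has_derivative[OF ax] d)
  then have "(f has_derivative (\<lambda>v. \<Sum>k\<in>UNIV. d k v *s axis k 1)) (at x)"
    by (simp add: basis_expansion)
  then show ?thesis using d(2) by (intro exI conjI) (auto simp: vec.scale_sum_right)
qed

lemma chol_holomorphic_map_on:
  fixes f :: "(complex, 'm::finite) vec \<Rightarrow> (complex, 'k::finite) vec"
  assumes "\<And>x k. x \<in> U \<Longrightarrow> chol (*s) (\<lambda>x. f x $ k) x"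
  shows "holomorphic_map_on f U"
  unfolding holomorphic_map_on_def
proof
  fix x assume x: "x \<in> U"
  obtain f' where f': "(f has_derivative f') (at x)" "\<And>c v. f' (c *s v) = c *s f' v"
    using chol_vector[where f=f and sc="(*s)" and x=x, OF assms[OF x]] by blast
  have "f' (v + w) = f' v + f' w" for v w using linear_add[OF has_derivative_linear[OF f'(1)]] .
  then have "Vector_Spaces.linear (*s) (*s) f'" using f'(2)
    by (simp add: Vector_Spaces.linear_def module_hom_def module_hom_axioms_def vec.vector_space_axioms vec.module_axioms)
  then show "\<exists>f'. (f has_derivative f') (at x) \<and> Vector_Spaces.linear (*s) (*s) f'" using f'(1) by blast
qed

lemma chol_entries: "chol (*s) (\<lambda>X. (A ** (mat 1 + mx (low X)) :: 'n::{finite,linorder} cmat) $ i $ j) X"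
proof (rule chol_matrix_mult)
  show "chol (*s) (\<lambda>X. (mat 1 + mx (low X)) $ i $ j) X" for i j :: 'n
    by (cases "j < i") (auto simp: low_def intro!: chol_intros chol_nth)
qed (rule chol_const)

lemma open_transit_dom: "open (transit_dom A)"
  unfolding transit_dom_def by (rule open_lu_dom[where sc="(*s)"]) (rule chol_entries)

lemma chol_transit: "X \<in> transit_dom A \<Longrightarrow> chol (*s) (\<lambda>X. transit A X $ k) X"
proof -
  assume X: "X \<in> transit_dom A"
  have "chol (*s) (\<lambda>X. (X - low X) $ k) X"
    by (cases "snd k < fst k") (auto simp: low_def intro!: chol_intros chol_nth)
  moreover have "chol (*s) (\<lambda>X. lu (A ** (mat 1 + mx (low X))) $ k) X"
    using X by (intro chol_lu chol_entries) (simp add: transit_dom_def)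
  ultimately show ?thesis unfolding transit_def vector_add_component by (rule chol_add[rotated])
qed

lemma holomorphic_continuous_on: "holomorphic_map_on f U \<Longrightarrow> continuous_on U f"
  unfolding holomorphic_map_on_def
  by (intro continuous_at_imp_continuous_on ballI) (blast intro: has_derivative_continuous)

lemma holomorphic_transit: "holomorphic_map_on (transit A) (transit_dom A)"
  by (intro chol_holomorphic_map_on chol_transit)

lemma homeomorphism_transit:
  assumes B: "B ** A = (mat 1 :: 'n::{finite,linorder} cmat)" "A ** B = mat 1"
  shows "homeomorphism (transit_dom A) (transit_dom B) (transit A) (transit B)"
proof
  show "continuous_on (transit_dom A) (transit A)" "continuous_on (transit_dom B) (transit B)"
    by (intro holomorphic_continuous_on holomorphic_transit)+
qed (use transit_inverse[OF B] transit_inverse[OF B(2,1)] in auto)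

section \<open>Base cycles\<close>

context pq_form
begin

lemma flag_chart_mx: "flag_chart g X = act (g ** (mat 1 + mx X)) std_flag"
  by (simp add: flag_chart_def)

lemma J_mat_of:
  assumes "\<And>k. k \<in> {1..p+q} \<Longrightarrow> J *v c k = s k *s c k"
  shows "J ** mat_of c = mat_of c ** dg s"
proof -
  have "J *v c (rk j) = s (rk j) *s c (rk j)" for j :: 'n
    using assms[of "rk j"] rk_range[of j] card_n by simp
  then show ?thesis unfolding mat_of_dg mat_mult_mat_of by (simp add: mat_of_def vec_eq_iff)
qed

text \<open>In a chart centered at an adapted frame, \<open>J\<close> acts on coordinates by
  multiplying the entry \<open>(i, j)\<close> with the signs of \<open>i\<close> and of
  \<open>j\<close>. Adapted flags are fixed by \<open>J\<close>, so entries between opposite signs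
  vanish; conversely such a \<open>Y\<close> keeps the columns in the eigenspaces of
  \<open>J\<close>.\<close>

lemma aflags_chart:
  assumes c: "aframe c s" and Y: "Y \<in> strictly_lower"
  shows "act (mat_of c ** (mat 1 + mx Y)) std_flag \<in> aflags s \<longleftrightarrow> (\<forall>i j. s (rk i) \<noteq> s (rk j) \<longrightarrow> Y $ (i, j) = 0)"
proof
  have Jc: "\<And>k. k \<in> {1..p+q} \<Longrightarrow> J *v c k = s k *s c k" using c by (simp add: aframe_def)
  note o = aframe_oframe[OF c]
  have detM: "det (mat_of c) \<noteq> 0" using oframe_frame[OF o] frame_iff_det by blast
  have JM0: "J ** mat_of c = mat_of c ** dg s" by (rule J_mat_of) (rule Jc)
  have JM: "J *v (mat_of c *v v) = mat_of c *v (dg s *v v)" for v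
    using JM0 by (simp add: matrix_vector_mul_assoc)
  have sg: "s (rk i) = 1 \<or> s (rk i) = -1" for i :: 'n using oframe_sign[OF o] rk_range[of i] card_n by simp
  let ?b = "\<lambda>k. (mat_of c ** (mat 1 + mx Y)) *v e k"
  have fb: "frame ?b" unfolding frame_columns using detM det_unipotent[OF Y] by (simp add: det_mul)
  {
    assume L: "\<forall>i j. s (rk i) \<noteq> s (rk j) \<longrightarrow> Y $ (i, j) = 0"
    have "J *v ?b k = s k *s ?b k" if k: "k \<in> {1..p+q}" for k
    proof -
      define j :: 'n where "j = idx k"
      have rkj: "rk j = k" using k rk_idx[of k, where 'n='n] card_n by (simp add: j_def)
      have "dg s *v ((mat 1 + mx Y) *v e k) = s k *s ((mat 1 + mx Y) *v e k)"
        unfolding vec_eq_iff dg_nth vector_smult_component unipotent_nth e_def j_def[symmetric] sum_axis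
        using L rkj by (auto simp: axis_def)
      then show ?thesis by (simp add: JM vec.scale flip: matrix_vector_mul_assoc)
    qed
    then show "act (mat_of c ** (mat 1 + mx Y)) std_flag \<in> aflags s"
      unfolding act_std_flag using gs_aframe[OF fb, of s] oframe_sign[OF o] by blast
  next
    assume "act (mat_of c ** (mat 1 + mx Y)) std_flag \<in> aflags s"
    then obtain d where d: "aframe d s" "act (mat_of c ** (mat 1 + mx Y)) std_flag = flag_of d" by (auto simp: aflags_def)
    have fd: "frame d" using d(1) aframe_oframe oframe_frame by blast
    have "act J (flag_of d) = flag_of (\<lambda>k. s k *s d k)"
      unfolding act_flag_of
    proof (rule flag_of_cong[symmetric])
      show "frame (\<lambda>k. s k *s d k)" using frame_scale[OF fd, of s] oframe_nz[OF o] card_n by simp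
      show "\<And>k. k \<in> {1..CARD('n)} \<Longrightarrow> s k *s d k = J *v d k" using d(1) card_n by (simp add: aframe_def)
    qed
    also have "\<dots> = flag_of d" using flag_of_scale[OF fd, of s] oframe_nz[OF o] card_n by simp
    finally have "act (J ** (mat_of c ** (mat 1 + mx Y))) std_flag = act (mat_of c ** (mat 1 + mx Y)) std_flag"
      using d(2) by (simp add: act_act[symmetric])
    then have eq: "act (mat_of c ** (dg s ** (mat 1 + mx Y))) std_flag = act (mat_of c ** (mat 1 + mx Y)) std_flag"
      by (simp add: matrix_mul_assoc JM0)
    obtain B where B: "B ** mat_of c = (mat 1 :: 'n cmat)"
      using detM unfolding invertible_det_nz[symmetric] invertible_def by blast
    have "act B (act (mat_of c ** (dg s ** (mat 1 + mx Y))) std_flag) = act B (act (mat_of c ** (mat 1 + mx Y)) std_flag)"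
      using eq by simp
    then have eq2: "act (dg s ** (mat 1 + mx Y)) std_flag = act (mat 1 + mx Y) std_flag"
      by (simp add: act_act matrix_mul_assoc B)
    define Y' where "Y' = (\<chi> ij. s (rk (fst ij)) * Y $ ij * s (rk (snd ij)))"
    have Y': "Y' \<in> strictly_lower" using Y by (auto simp: Y'_def strictly_lower_def)
    have "dg s ** (mat 1 + mx Y) = (mat 1 + mx Y') ** dg s"
    proof -
      have "s (rk i) * ((mat 1 :: 'n cmat) $ i $ j + Y $ (i, j)) = ((mat 1 :: 'n cmat) $ i $ j + Y' $ (i, j)) * s (rk j)" for i j
        using sg[of j] by (auto simp: mat_def Y'_def algebra_simps)
      then show ?thesis
        by (simp add: vec_eq_iff matrix_matrix_mult_def dg_def if_distrib if_distribR cong: if_cong)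
    qed
    moreover have "act (dg s) (std_flag :: 'n flag) = std_flag"
    proof -
      have "dg s *v (e k :: 'n cvec) = s k *s e k" if "k \<in> {1..CARD('n)}" for k
        using rk_idx[OF that] by (auto simp: vec_eq_iff dg_nth e_nth)
      then have "flag_of (\<lambda>k. s k *s (e k :: 'n cvec)) = flag_of (\<lambda>k. dg s *v e k)"
        using frame_scale[OF frame_e[where 'n='n], of s] oframe_nz[OF o] card_n by (intro flag_of_cong) auto
      then show ?thesis unfolding act_std_flag unfolding std_flag_def
        using flag_of_scale[OF frame_e[where 'n='n], of s] oframe_nz[OF o] card_n by simp
    qed
    ultimately have "act (mat 1 + mx Y') std_flag = act (mat 1 + mx Y) std_flag"
      using eq2 by (simp flip: act_act)
    then have "Y' = Y" using unipotent_unique[OF Y' Y] by blast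
    show "\<forall>i j. s (rk i) \<noteq> s (rk j) \<longrightarrow> Y $ (i, j) = 0"
    proof (intro allI impI)
      fix i j :: 'n assume ne: "s (rk i) \<noteq> s (rk j)"
      have "Y $ (i, j) = s (rk i) * Y $ (i, j) * s (rk j)" using \<open>Y' = Y\<close> by (simp add: Y'_def vec_eq_iff)
      then show "Y $ (i, j) = 0" using ne sg[of i] sg[of j] by auto
    qed
  }
qed

text \<open>By \<open>aflags_chart\<close> the set is a linear subspace in the chart centered at any
  of its points; a chart change carries this to an arbitrary chart.\<close>

lemma aflags_submanifold: "flag_submanifold (aflags s)"
  unfolding flag_submanifold_def
proof (intro conjI ballI)
  show "aflags s \<subseteq> flags" using aflags_sflags sflags_flags by blast
  fix g :: "'n cmat" assume g: "g \<in> SL"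
  let ?S = "{X \<in> strictly_lower. flag_chart g X \<in> aflags s}"
  show "complex_submanifold ?S"
    unfolding complex_submanifold_def
  proof
    fix X0 assume X0: "X0 \<in> ?S"
    then obtain c where c: "aframe c s" "flag_chart g X0 = flag_of c" by (auto simp: aflags_def)
    let ?M = "mat_of c"
    have fc: "frame c" using c(1) aframe_oframe oframe_frame by blast
    then have detM: "det ?M \<noteq> 0" using frame_iff_det by blast
    have detg: "det g = 1" using g by (simp add: SL_def)
    obtain M' where M': "M' ** ?M = mat 1" "?M ** M' = mat 1"
      using detM unfolding invertible_det_nz[symmetric] invertible_def by blast
    have "det g \<noteq> 0" using detg by simp
    then obtain g' where g': "g' ** g = mat 1" "g ** g' = mat 1"
      unfolding invertible_det_nz[symmetric] invertible_def by blast
    \<comment> \<open>\<open>transit A\<close> leads from the chart of \<open>g\<close> to the chart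
      centered at the adapted frame \<open>c\<close> of the given point.\<close>
    define A where "A = M' ** g"
    define B where "B = g' ** ?M"
    have BA: "B ** A = mat 1"
    proof -
      have "B ** A = g' ** (?M ** M') ** g" unfolding A_def B_def by (simp only: matrix_mul_assoc)
      then show ?thesis using M' g' by simp
    qed
    have AB: "A ** B = mat 1"
    proof -
      have "A ** B = M' ** (g ** g') ** ?M" unfolding A_def B_def by (simp only: matrix_mul_assoc)
      then show ?thesis using M' g' by simp
    qed
    have MA: "?M ** (A ** Q) = g ** Q" for Q
    proof -
      have "?M ** (A ** Q) = ?M ** M' ** g ** Q" unfolding A_def by (simp only: matrix_mul_assoc)
      then show ?thesis using M' by simp
    qed
    have detA: "det A \<noteq> 0" using arg_cong[OF BA, of det] by (auto simp: det_mul)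
    let ?L = "{Y \<in> strictly_lower. \<forall>i j. s (rk i) \<noteq> s (rk j) \<longrightarrow> Y $ (i, j) = 0}"
    have X0U: "X0 \<in> transit_dom A"
    proof -
      have "act (A ** (mat 1 + mx X0)) std_flag = act M' (flag_of c)"
        unfolding c(2)[symmetric] flag_chart_mx by (simp add: A_def act_act matrix_mul_assoc)
      also have "\<dots> = std_flag" using act_mat_of[OF fc] M' by (metis act_1 act_act)
      finally have "act (mat 1 + mx 0) std_flag = act (A ** (mat 1 + mx X0)) std_flag" by (simp flip: mat_def zero_vec_def)
      then have "lu_dom (A ** (mat 1 + mx X0))"
        using X0 detA by (intro lu_unique(1)[where Y=0]) (auto simp: strictly_lower_def det_mul det_unipotent)
      then show ?thesis using X0 by (simp add: transit_dom_def low_id)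
    qed
    have img: "transit A ` (?S \<inter> transit_dom A) = ?L \<inter> transit_dom B"
    proof (intro equalityI subsetI)
      fix Y assume "Y \<in> transit A ` (?S \<inter> transit_dom A)"
      then obtain X where X: "X \<in> strictly_lower" "flag_chart g X \<in> aflags s" "X \<in> transit_dom A" "Y = transit A X" by auto
      have Y: "Y = lu (A ** (mat 1 + mx X))" using X low_id[OF X(1)] by (simp add: transit_def)
      then have Ysl: "Y \<in> strictly_lower" using lu_strictly_lower by blast
      have "act (mat 1 + mx Y) std_flag = act (A ** (mat 1 + mx X)) std_flag"
        unfolding Y using X low_id[OF X(1)] by (intro lu_act) (simp add: transit_dom_def)
      then have "act (?M ** (mat 1 + mx Y)) std_flag = flag_chart g X"
        unfolding flag_chart_mx by (simp add: MA flip: act_act) (simp add: MA act_act)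
      then show "Y \<in> ?L \<inter> transit_dom B"
        using X aflags_chart[OF c(1) Ysl] transit_inverse(1)[OF BA AB X(3)] Ysl by simp
    next
      fix Y assume Y: "Y \<in> ?L \<inter> transit_dom B"
      define X where "X = transit B Y"
      have X: "X \<in> transit_dom A" "transit A X = Y" using transit_inverse[OF AB BA, of Y] Y by (auto simp: X_def)
      have X': "X = lu (B ** (mat 1 + mx Y))" using Y low_id[of Y] by (simp add: X_def transit_def)
      then have Xsl: "X \<in> strictly_lower" using lu_strictly_lower by blast
      have "act (mat 1 + mx X) std_flag = act (B ** (mat 1 + mx Y)) std_flag"
        unfolding X' using Y low_id[of Y] by (intro lu_act) (simp add: transit_dom_def)
      then have "act (g ** (mat 1 + mx X)) std_flag = act (g ** B ** (mat 1 + mx Y)) std_flag"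
        by (simp add: matrix_mul_assoc[symmetric]) (simp flip: act_act)
      moreover have "g ** B = ?M" using g' by (simp add: B_def matrix_mul_assoc)
      ultimately have "flag_chart g X = act (?M ** (mat 1 + mx Y)) std_flag" by (simp add: flag_chart_mx)
      then have "flag_chart g X \<in> aflags s" using aflags_chart[OF c(1), of Y] Y by simp
      then show "Y \<in> transit A ` (?S \<inter> transit_dom A)" using X Xsl by (intro image_eqI[of _ _ X]) auto
    qed
    have "vec.subspace ?L" by (auto simp: vec.subspace_def strictly_lower_def)
    then show "\<exists>U V (\<phi> :: complex^('n \<times> 'n) \<Rightarrow> complex^('n \<times> 'n)) \<psi> L. open U \<and> X0 \<in> U \<and> open V \<and> homeomorphism U V \<phi> \<psi> \<and>
        holomorphic_map_on \<phi> U \<and> holomorphic_map_on \<psi> V \<and> vec.subspace L \<and> \<phi> ` (?S \<inter> U) = L \<inter> V"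
      using open_transit_dom X0U homeomorphism_transit[OF BA AB] holomorphic_transit img by blast
  qed
qed

section \<open>The complexified center of \<open>K0 p q\<close> and uniqueness of base
  cycles\<close>

definition tor :: "complex \<Rightarrow> 'n cmat" where
  "tor z = dg (\<lambda>k. if k \<le> q then exp (of_nat p * z) else exp (- of_nat q * z))"

text \<open>The exponents \<open>p\<close> on \<open>q\<close> coordinates and \<open>-q\<close> on
  \<open>p\<close> coordinates are chosen to cancel in the determinant.\<close>

lemma det_tor: "det (tor z) = 1"
proof -
  have "det (tor z) = (\<Prod>k=1..q+p. if k \<le> q then exp (of_nat p * z) else exp (- of_nat q * z))"
    by (simp add: tor_def det_dg card_n add.commute)
  also have "\<dots> = (\<Prod>k=1..q. exp (of_nat p * z)) * (\<Prod>k=q+1..q+p. exp (- of_nat q * z))"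
    by (subst prod.ub_add_nat) (auto intro!: arg_cong2[of _ _ _ _ "(*)"] prod.cong)
  also have "\<dots> = exp (of_nat q * (of_nat p * z)) * exp (of_nat p * (- of_nat q * z))"
    by (simp only: exp_of_nat_mult) simp
  also have "\<dots> = 1" by (simp add: mult_exp_exp)
  finally show ?thesis .
qed

lemma tor_J: "tor z ** J = J ** tor z"
  unfolding matrix_eq matrix_vector_mul_assoc[symmetric] vec_eq_iff by (simp add: J_def tor_def dg_nth)

lemma tor_J_vec: "tor z *v (J *v v) = J *v (tor z *v v)"
  by (simp add: matrix_vector_mul_assoc tor_J)

lemma tor_nth: "(tor z *v v) $ i = (if rk i \<le> q then exp (of_nat p * z) else exp (- of_nat q * z)) * v $ i"
  by (simp add: tor_def dg_nth)

lemma tor_imaginary_K0: "tor (\<i> * of_real t) \<in> K0 p q"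
proof -
  have n: "exp (of_nat k * (\<i> * of_real t)) * cnj (exp (of_nat k * (\<i> * of_real t))) = 1" for k
    by (simp add: exp_cnj mult_exp_exp)
  have m: "exp (- of_nat k * (\<i> * of_real t)) * cnj (exp (- of_nat k * (\<i> * of_real t))) = 1" for k
    by (simp add: exp_cnj mult_exp_exp)
  have "(tor (\<i> * of_real t) *v v) $ i * cnj ((tor (\<i> * of_real t) *v w) $ i) = v $ i * cnj (w $ i)" for v w i
  proof -
    have *: "a * x * cnj (a * y) = x * cnj y" if "a * cnj a = 1" for a x y :: complex
    proof -
      have "a * x * cnj (a * y) = a * cnj a * (x * cnj y)" by simp
      then show ?thesis unfolding that by simp
    qed
    show ?thesis unfolding tor_nth by (cases "rk i \<le> q") (simp_all only: if_True if_False *[OF n] *[OF m])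
  qed
  then have "h (tor (\<i> * of_real t) *v v) (tor (\<i> * of_real t) *v w) = h v w" for v w unfolding herm_eta by simp
  then show ?thesis by (simp add: K0_iff SU_def SL_def det_tor tor_J)
qed

lemma tor_minus: "tor z *v (v - J *v v) = exp (of_nat p * z) *s (v - J *v v)"
  by (auto simp: vec_eq_iff tor_nth J_nth eta_def)

lemma tor_plus: "tor z *v (v + J *v v) = exp (- of_nat q * z) *s (v + J *v v)"
  by (auto simp: vec_eq_iff tor_nth J_nth eta_def)

lemma tor_eigen: "J *v v = v \<Longrightarrow> tor z *v v = exp (- of_nat q * z) *s v" "J *v v = - v \<Longrightarrow> tor z *v v = exp (of_nat p * z) *s v"
  by (auto simp: vec_eq_iff tor_nth J_nth eta_def split: if_splits) 

lemma tor_self_adjoint: "h (tor (of_real t) *v v) w = h v (tor (of_real t) *v w)"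
  unfolding herm_eta tor_nth by (rule sum.cong) (auto simp: exp_cnj)

lemma sp_scale: "sp (a *s v) (a *s v) = of_real ((cmod a)\<^sup>2) * sp v v"
  unfolding complex_norm_square by (simp add: sp_def sum_distrib_left mult_ac)

text \<open>Let \<open>T\<close> be the torus element. By induction the earlier vectors are
  eigenvectors of \<open>T\<close>, so \<open>k\<close> preserves their span; since \<open>T\<close>
  is self-adjoint for \<open>h\<close>, also \<open>T c m\<close> is orthogonal to this span, and
  therefore \<open>T c m = a k c m\<close>. As \<open>k\<close> commutes with \<open>J\<close> and
  preserves \<open>sp\<close>, both components of \<open>c m\<close> in the eigenspaces of
  \<open>J\<close> are stretched by \<open>|a|\<close>. But \<open>T\<close> stretches them by
  \<open>exp (p t)\<close> and \<open>exp (- q t)\<close>, so one of them is 0.\<close>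

lemma torus_fixed_orbit:
  assumes c: "oframe c s" and t: "t \<noteq> 0" and k: "k \<in> K0 p q"
    and eq: "act (tor (of_real t)) (flag_of c) = act k (flag_of c)"
  shows "m \<in> {1..p+q} \<Longrightarrow> J *v c m = s m *s c m"
proof (induction m rule: less_induct)
  case (less m)
  let ?T = "tor (of_real t)"
  have kSU: "k \<in> SU p q" and kJ: "k *v (J *v v) = J *v (k *v v)" for v
    using k by (simp_all add: K0_iff matrix_vector_mul_assoc)
  have Tc: "\<exists>a. ?T *v c j = a *s c j" if j: "j \<in> {1..<m}" for j
  proof -
    have "J *v c j = s j *s c j" using less j by simp
    then have "J *v c j = c j \<or> J *v c j = - c j" using oframe_sign[OF c, of j] j less.prems by auto
    then show ?thesis using tor_eigen by blast
  qed
  have kc: "k *v c j \<in> flag_of c (m - 1)" if j: "j \<in> {1..<m}" for j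
  proof -
    have "k *v c j \<in> act k (flag_of c) (m - 1)"
      unfolding act_def by (intro imageI flag_of_base) (use j in auto)
    also have "\<dots> = act ?T (flag_of c) (m - 1)" by (simp only: eq)
    also have "\<dots> = vec.span ((\<lambda>k. ?T *v c k) ` {1..m-1})" by (simp only: act_flag_of) (simp only: flag_of_def)
    also have "\<dots> \<subseteq> flag_of c (m - 1)"
    proof (intro vec.span_minimal subspace_flag_of subsetI)
      fix x assume "x \<in> (\<lambda>k. ?T *v c k) ` {1..m-1}"
      then obtain i where i: "i \<in> {1..m-1}" "x = ?T *v c i" by blast
      then have "i \<in> {1..<m}" using less.prems by auto
      then obtain a where "x = a *s c i" using Tc[of i] i(2) by blast
      then show "x \<in> flag_of c (m - 1)" using i by (auto intro!: vec.subspace_scale subspace_flag_of flag_of_base)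
    qed
    finally show ?thesis .
  qed
  have Tm: "h (?T *v c m) x = 0" if x: "x \<in> flag_of c (m - 1)" for x
    using x unfolding flag_of_def
  proof (rule h_span_0')
    fix y assume "y \<in> c ` {1..m-1}"
    then obtain j where "j \<in> {1..m-1}" and j2: "y = c j" by blast
    then have j: "j \<in> {1..<m}" "y = c j" using less.prems by auto
    obtain a where "?T *v c j = a *s c j" using Tc[OF j(1)] by blast
    then show "h (?T *v c m) y = 0"
      unfolding tor_self_adjoint j(2) using oframe_h[OF c, of m j] less.prems j by (simp add: h_linear)
  qed
  have "?T *v c m \<in> act ?T (flag_of c) m" unfolding act_def by (intro imageI flag_of_base) (use less.prems in auto)
  then obtain y where y: "y \<in> flag_of c m" "?T *v c m = k *v y" unfolding eq by (auto simp: act_def)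
  have yc: "h y (c j) = 0" if "j \<in> {1..p+q}" "j \<noteq> m" for j
  proof (cases "j < m")
    case True
    then have "h (k *v y) (k *v c j) = 0" using Tm[OF kc] y that by simp
    then show ?thesis using SU_h[OF kSU] by simp
  next
    case False
    then show ?thesis using oframe_flag[OF c, of m y] y(1) that less.prems by simp
  qed
  define a where "a = s m * h y (c m)"
  have "y = (\<Sum>j=1..p+q. (s j * h y (c j)) *s c j)" by (rule oframe_expand[OF c])
  also have "\<dots> = (\<Sum>j=1..p+q. if j = m then a *s c m else 0)"
    by (rule sum.cong) (use yc in \<open>auto simp: a_def\<close>)
  also have "\<dots> = a *s c m" using less.prems by simp
  finally have Tk: "?T *v c m = a *s (k *v c m)" using y(2) by (simp add: vec.scale)
  have spk: "sp (k *v v) (k *v v) = sp v v" for v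
    unfolding sp_h kJ[symmetric] by (rule SU_h[OF kSU])
  have key: "(cmod b)\<^sup>2 = (cmod a)\<^sup>2" if "v \<noteq> 0" "?T *v v = b *s v" "?T *v v = a *s (k *v v)" for v b
  proof -
    have "of_real ((cmod b)\<^sup>2) * sp v v = of_real ((cmod a)\<^sup>2) * sp v v"
      using that(2,3) sp_scale[of b v] sp_scale[of a "k *v v"] spk[of v] by metis
    moreover have "sp v v \<noteq> 0" using that sp_self_0 by blast
    ultimately show ?thesis by (metis mult_right_cancel of_real_eq_iff)
  qed
  let ?x = "c m"
  have "?x - J *v ?x = 0 \<or> ?x + J *v ?x = 0"
  proof (rule ccontr)
    assume "\<not> ?thesis"
    then have nz: "?x - J *v ?x \<noteq> 0" "?x + J *v ?x \<noteq> 0" by auto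
    have TJ: "?T *v (J *v ?x) = a *s (k *v (J *v ?x))" unfolding tor_J_vec Tk kJ by (simp add: vec.scale)
    have "?T *v (?x - J *v ?x) = a *s (k *v (?x - J *v ?x))" "?T *v (?x + J *v ?x) = a *s (k *v (?x + J *v ?x))"
      using Tk TJ by (simp_all add: vec.diff vec.add vec.scale_right_diff_distrib vec.scale_right_distrib)
    then have "(cmod (exp (of_nat p * of_real t)))\<^sup>2 = (cmod (exp (- of_nat q * of_real t)))\<^sup>2"
      using key[OF nz(1) tor_minus] key[OF nz(2) tor_plus] by simp
    then have "cmod (exp (of_nat p * of_real t)) = cmod (exp (- of_nat q * of_real t))"
      by (rule power2_eq_imp_eq) simp_all
    then have "exp (of_nat p * t) = exp (- of_nat q * t)" by simp
    then have "(of_nat p + of_nat q) * t = 0" by (simp add: algebra_simps)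
    then show False using t q_pos by simp
  qed
  then have "J *v ?x = 1 *s ?x \<or> J *v ?x = (-1) *s ?x" by (auto simp: add_eq_0_iff)
  then obtain r where r: "r = 1 \<or> r = -1" "J *v ?x = r *s ?x" by blast
  have "?x \<noteq> 0" using frame_nonzero[OF oframe_frame[OF c]] less.prems card_n by simp
  \<comment> \<open>By positivity of \<open>sp\<close>, the eigenvalue has the sign of the square of
    \<open>c m\<close>.\<close>
  then have "0 < Re (r * s m)"
    using sp_self_pos[of ?x] h_eigen[OF r(2)] oframe_h[OF c less.prems less.prems] by simp
  then have "r = s m" using r(1) oframe_sign[OF c less.prems] by auto
  then show ?case using r(2) by simp
qed

lemma field_derivative_chol: "(f has_field_derivative d) (at x) \<Longrightarrow> chol (*) f x"
  unfolding chol_def has_field_derivative_def by (auto intro!: exI[of _ "(*) d"])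

lemma chol_tor: "chol (*) (\<lambda>z. tor z $ i $ j) z"
proof (cases "i = j \<and> rk i \<le> q")
  case True
  then show ?thesis by (auto simp: tor_def dg_def intro!: field_derivative_chol derivative_eq_intros)
next
  case False
  then show ?thesis
    by (cases "i = j") (auto simp: tor_def dg_def intro!: chol_const field_derivative_chol derivative_eq_intros)
qed

text \<open>Serves as a linear functional that vanishes on \<open>L\<close> but not at
  \<open>y\<close>: the coordinate of \<open>f\<close> to be used is one in which \<open>y\<close>
  is nonzero.\<close>

lemma separating_functional:
  assumes L: "vec.subspace L" and y: "(y :: (complex, 'm::finite) vec) \<notin> L"
  shows "\<exists>f. Vector_Spaces.linear (*s) (*s) f \<and> (\<forall>x\<in>L. f x = (0 :: (complex, 'm) vec)) \<and> f y = y"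
proof -
  obtain B where B: "B \<subseteq> L" "vec.independent B" "L \<subseteq> vec.span B" "card B = vec.dim L"
    by (rule vec.basis_exists[of L])
  then have spB: "vec.span B = L" using L vec.span_minimal[of B L] by blast
  then have ind: "vec.independent (insert y B)" using B y vec.independent_insertI[of y B] by simp
  obtain f where f: "Vector_Spaces.linear (*s) (*s) f" "\<forall>x\<in>insert y B. f x = (if x = y then y else 0)"
    using vec.linear_independent_extend[OF ind, of "\<lambda>x. if x = y then y else 0"] by (elim exE conjE) (rule that)
  have "y \<notin> B" using y B by blast
  have "f x = 0" if "x \<in> L" for x
  proof (rule vec.linear_eq_0_on_span[OF f(1), of B])
    show "\<And>x. x \<in> B \<Longrightarrow> f x = 0" using f(2) \<open>y \<notin> B\<close> by auto
  qed (use that spB in auto)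
  then show ?thesis using f by auto
qed

text \<open>In a flattening chart, the curve of the flags \<open>tor z\<close> applied to
  \<open>flag_of c\<close> is a holomorphic curve whose imaginary times lie in the linear space
  \<open>L\<close>. A functional vanishing on \<open>L\<close> is then 0 along the whole curve near
  0, so a small real time stays in the orbit.\<close>

lemma submanifold_orbit_adapted:
  assumes c: "oframe c s" and sub: "flag_submanifold (orbit (K0 p q) (flag_of c))"
  shows "\<exists>t k. t \<noteq> 0 \<and> k \<in> K0 p q \<and> act (tor (of_real t)) (flag_of c) = act k (flag_of c)"
proof -
  let ?C = "orbit (K0 p q) (flag_of c)"
  obtain g where g: "g \<in> SL" "flag_of c = act g std_flag"
    using flags_SL[OF flag_of_flags[OF oframe_frame[OF c]]] by blast
  have "det g \<noteq> 0" using g by (simp add: SL_def)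
  then obtain B where B: "B ** g = mat 1" "g ** B = mat 1"
    unfolding invertible_det_nz[symmetric] invertible_def by blast
  have "det B \<noteq> 0" using arg_cong[OF B(1), of det] by (auto simp: det_mul)
  define A where "A = (\<lambda>z. B ** (tor z ** g))"
  define X where "X = (\<lambda>z. lu (A z))"
  let ?S = "{X \<in> strictly_lower. flag_chart g X \<in> ?C}"
  let ?W = "{z. lu_dom (A z)}"
  have cA: "chol (*) (\<lambda>z. A z $ i $ j) z" for z i j
    unfolding A_def by (intro chol_matrix_mult chol_const chol_tor)
  have "tor 0 = mat 1" by (auto simp: tor_def dg_def mat_def vec_eq_iff)
  then have A0: "A 0 = mat 1" by (simp add: A_def B)
  have "mat 1 + mx (0 :: complex^('n \<times> 'n)) = mat 1" by (simp add: vec_eq_iff)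
  then have W0: "0 \<in> ?W" and X0: "X 0 = 0"
    using lu_unique[of "0 :: complex^('n \<times> 'n)" "A 0"] A0 by (simp_all add: X_def strictly_lower_def)
  have chartX: "flag_chart g (X z) = act (tor z) (flag_of c)" if "z \<in> ?W" for z
  proof -
    have "flag_chart g (X z) = act g (act (A z) std_flag)"
      unfolding flag_chart_mx X_def using lu_act[of "A z"] that by (simp flip: act_act)
    also have "\<dots> = act (g ** B ** (tor z ** g)) std_flag" by (simp add: A_def act_act matrix_mul_assoc)
    also have "\<dots> = act (tor z) (flag_of c)" unfolding g(2) by (simp add: B act_act)
    finally show ?thesis .
  qed
  have Xsl: "X z \<in> strictly_lower" for z by (simp add: X_def lu_strictly_lower)
  have inC: "act (tor (\<i> * of_real t)) (flag_of c) \<in> ?C" for t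
    unfolding orbit_def using tor_imaginary_K0 by blast
  have "0 \<in> ?S" using inC[of 0] chartX[OF W0] Xsl[of 0] X0 by simp
  moreover have "complex_submanifold ?S" using sub g(1) by (simp add: flag_submanifold_def)
  ultimately have "\<exists>U V (\<phi> :: complex^('n \<times> 'n) \<Rightarrow> complex^('n \<times> 'n)) \<psi> L. open U \<and> 0 \<in> U \<and> open V \<and> homeomorphism U V \<phi> \<psi> \<and>
        holomorphic_map_on \<phi> U \<and> holomorphic_map_on \<psi> V \<and> vec.subspace L \<and> \<phi> ` (?S \<inter> U) = L \<inter> V"
    unfolding complex_submanifold_def by (rule bspec[rotated])
  then obtain U V L and \<phi> \<psi> :: "complex^('n \<times> 'n) \<Rightarrow> complex^('n \<times> 'n)"
    where U: "open U" "0 \<in> U" "homeomorphism U V \<phi> \<psi>" "holomorphic_map_on \<phi> U" "vec.subspace L"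
      "\<phi> ` (?S \<inter> U) = L \<inter> V" by blast
  have Xd: "\<exists>X'. (X has_derivative X') (at z) \<and> (\<forall>c v. X' (c * v) = c *s X' v)" if "z \<in> ?W" for z
    unfolding X_def using that by (intro chol_vector chol_lu cA) simp
  have openW: "open ?W" by (rule open_lu_dom[where sc="(*)"]) (rule cA)
  have "continuous_on ?W X"
    by (intro continuous_at_imp_continuous_on ballI) (use Xd has_derivative_continuous in blast)
  then have "open (?W \<inter> X -` U)" using continuous_open_preimage openW U(1) by blast
  moreover have "0 \<in> ?W \<inter> X -` U" using W0 X0 U(2) by simp
  ultimately obtain r where r: "r > 0" "ball 0 r \<subseteq> ?W \<inter> X -` U" using open_contains_ball by blast
  \<comment> \<open>At imaginary times \<open>tor z\<close> belongs to
    \<open>K0 p q\<close>.\<close>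
  have imag: "\<phi> (X z) \<in> L" if "z \<in> ball 0 r" "Re z = 0" for z
  proof -
    have "z = \<i> * of_real (Im z)" using that(2) by (simp add: complex_eq_iff)
    then have "act (tor z) (flag_of c) \<in> ?C" using inC by metis
    moreover have "z \<in> ?W" "X z \<in> U" using that(1) r by auto
    ultimately have "X z \<in> ?S \<inter> U" using chartX Xsl by simp
    then show ?thesis using U(6) by blast
  qed
  have all: "\<phi> (X z0) \<in> L" if z0: "z0 \<in> ball 0 r" for z0
  proof (rule ccontr)
    assume no: "\<phi> (X z0) \<notin> L"
    let ?y = "\<phi> (X z0)"
    obtain f :: "complex^('n \<times> 'n) \<Rightarrow> complex^('n \<times> 'n)" 
      where f: "Vector_Spaces.linear (*s) (*s) f" "\<forall>x\<in>L. f x = 0" "f ?y = ?y"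
      using separating_functional[OF U(5) no] by blast
    have "?y \<noteq> 0" using no vec.subspace_0[OF U(5)] by metis
    then obtain k where k: "?y $ k \<noteq> 0" by (auto simp: vec_eq_iff)
    let ?F = "\<lambda>z. f (\<phi> (X z)) $ k"
    have fadd: "f (v + w) = f v + f w" and fsc: "f (a *s v) = a *s f v" for v w a
      using f(1) by (simp_all add: Vector_Spaces.linear_def module_hom_def module_hom_axioms_def)
    have fsR: "f (a *\<^sub>R v) = a *\<^sub>R f v" for a v
    proof -
      have "a *\<^sub>R w = complex_of_real a *s w" for w :: "complex^('n \<times> 'n)"
        unfolding vec_eq_iff vector_scaleR_component vector_smult_component by (simp add: scaleR_conv_of_real)
      then show ?thesis using fsc by simp
    qed
    have "bounded_linear f" by (intro linear_conv_bounded_linear[THEN iffD1] linearI fadd fsR)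
    then have fk: "bounded_linear (\<lambda>v. f v $ k)"
      using bounded_linear_compose[OF bounded_linear_vec_nth, of f] by blast
    have hol: "?F holomorphic_on ball 0 r"
      unfolding holomorphic_on_def field_differentiable_def
    proof (intro ballI)
      fix z :: complex assume "z \<in> ball 0 r"
      then have z: "z \<in> ?W" "X z \<in> U" using r by auto
      obtain X' where X': "(X has_derivative X') (at z)" "\<And>c v. X' (c * v) = c *s X' v" using Xd[OF z(1)] by blast
      obtain p' where p': "(\<phi> has_derivative p') (at (X z))" "Vector_Spaces.linear (*s) (*s) p'"
        using U(4) z(2) unfolding holomorphic_map_on_def by blast
      have psc: "p' (a *s v) = a *s p' v" for a v
        using p'(2) by (simp add: Vector_Spaces.linear_def module_hom_def module_hom_axioms_def)
      have "((\<lambda>z. \<phi> (X z)) has_derivative (\<lambda>v. p' (X' v))) (at z)"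
        using diff_chain_at[OF X'(1) p'(1)] by (simp add: o_def)
      then have "(?F has_derivative (\<lambda>v. f (p' (X' v)) $ k)) (at z)"
        by (rule bounded_linear.has_derivative[OF fk])
      moreover have "(\<lambda>v. f (p' (X' v)) $ k) = (*) (f (p' (X' 1)) $ k)"
      proof
        fix v
        have "X' v = v *s X' 1" using X'(2)[of v 1] by simp
        then show "f (p' (X' v)) $ k = f (p' (X' 1)) $ k * v" by (simp only: psc fsc vector_smult_component mult.commute)
      qed
      ultimately have "(?F has_field_derivative (f (p' (X' 1)) $ k)) (at z)"
        unfolding has_field_derivative_def by (simp only:)
      then show "\<exists>f'. (?F has_field_derivative f') (at z within ball 0 r)"
        using has_field_derivative_at_within by blast
    qed
    \<comment> \<open>The identity theorem needs the zeros on the imaginary axis to accumulate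
      inside the disc.\<close>
    have lim: "0 islimpt {z \<in> ball 0 r. Re z = 0}"
      unfolding islimpt_approachable
    proof (intro allI impI)
      fix d :: real assume "d > 0"
      define t where "t = min d r / 2"
      have "0 < t" "t < d" "t < r" using \<open>d > 0\<close> r(1) by (auto simp: t_def min_def)
      then show "\<exists>x'\<in>{z \<in> ball 0 r. Re z = 0}. x' \<noteq> 0 \<and> dist x' 0 < d"
        by (intro bexI[of _ "\<i> * of_real t"]) (auto simp: norm_mult)
    qed
    have "?F z0 = 0"
      by (rule analytic_continuation[OF hol open_ball connected_ball _ _ lim])
        (use imag f(2) r(1) z0 in auto)
    then show False using f(3) k by simp
  qed
  define t where "t = r / 2"
  have t: "t \<noteq> 0" "of_real t \<in> ball (0 :: complex) r" using r(1) by (auto simp: t_def)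
  have "of_real t \<in> ?W \<inter> X -` U" using t(2) r(2) by (rule rev_subsetD)
  then have XU: "X (of_real t) \<in> U" "of_real t \<in> ?W" by auto
  then have "\<phi> (X (of_real t)) \<in> L \<inter> V" using all[OF t(2)] U(3) unfolding homeomorphism_def by blast
  then have "\<phi> (X (of_real t)) \<in> \<phi> ` (?S \<inter> U)" by (simp only: U(6))
  \<comment> \<open>A point of the orbit has the same image under the flattening map; injectivity on
    \<open>U\<close> identifies it with the point of the curve.\<close>
  then obtain Y where Y: "Y \<in> ?S" "Y \<in> U" "\<phi> (X (of_real t)) = \<phi> Y" by (elim imageE IntE)
  have "X (of_real t) = \<psi> (\<phi> (X (of_real t)))" by (rule homeomorphism_apply1[OF U(3) XU(1), symmetric])
  also have "\<dots> = \<psi> (\<phi> Y)" by (simp only: Y(3))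
  also have "\<dots> = Y" by (rule homeomorphism_apply1[OF U(3) Y(2)])
  finally have "X (of_real t) \<in> ?S" using Y(1) by (simp only:)
  then have "act (tor (of_real t)) (flag_of c) \<in> ?C" unfolding mem_Collect_eq chartX[OF XU(2)] by (rule conjunct2)
  then obtain k where "k \<in> K0 p q" "act (tor (of_real t)) (flag_of c) = act k (flag_of c)" unfolding orbit_def by (elim imageE)
  then show ?thesis using t(1) by (intro exI conjI)
qed

text \<open>A competing \<open>K0\<close>-orbit is given by an orthonormal frame with the same
  signs, and the submanifold condition makes this frame adapted.\<close>

lemma base_cycle_eq:
  assumes c: "aframe c s" shows "base_cycle p q (sflags s) = aflags s"
  unfolding base_cycle_def
proof (rule the_equality)
  have "flag_of c \<in> sflags s" using aframe_oframe[OF c] by (auto simp: sflags_def)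
  then show "(\<exists>F\<in>sflags s. aflags s = orbit (K0 p q) F) \<and> aflags s \<subseteq> sflags s \<and> flag_submanifold (aflags s)"
    using orbit_K0[OF c] aflags_sflags aflags_submanifold by blast
next
  fix C assume "(\<exists>F\<in>sflags s. C = orbit (K0 p q) F) \<and> C \<subseteq> sflags s \<and> flag_submanifold C"
  then obtain d where d: "oframe d s" "C = orbit (K0 p q) (flag_of d)" "flag_submanifold C" by (auto simp: sflags_def)
  obtain t k where "t \<noteq> 0" "k \<in> K0 p q" "act (tor (of_real t)) (flag_of d) = act k (flag_of d)"
    using submanifold_orbit_adapted[OF d(1)] d(2,3) by blast
  then have "aframe d s" using torus_fixed_orbit[OF d(1)] d(1) by (simp add: aframe_def)
  then show "C = aflags s" using orbit_K0 d(2) by blast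
qed

end

section \<open>Combinatorics of the strictly pairing condition\<close>

text \<open>The placement rule read off from the finished word: two boxes are adjacent after
  ignoring filled ones iff everything between them belongs to an earlier, outer pair.\<close>

definition paired :: "nat \<Rightarrow> (nat \<Rightarrow> nat) \<Rightarrow> nat \<Rightarrow> bool" where
  "paired n w i \<longleftrightarrow> (\<exists>a b. 1 \<le> a \<and> a < b \<and> b \<le> n \<and> w a = n - i + 1 \<and> w b = i \<and>
     (\<forall>c. a < c \<and> c < b \<longrightarrow> w c < i \<or> n - i + 1 < w c))"

definition middle_increasing :: "nat \<Rightarrow> nat \<Rightarrow> (nat \<Rightarrow> nat) \<Rightarrow> bool" where
  "middle_increasing p q w \<longleftrightarrow> (\<forall>j k. 1 \<le> j \<and> j < k \<and> k \<le> p + q \<and> w j \<in> {q+1..p} \<and> w k \<in> {q+1..p} \<longrightarrow> w j < w k)"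

lemma permutes_range: "w permutes {1..n} \<Longrightarrow> 1 \<le> k \<Longrightarrow> k \<le> n \<Longrightarrow> 1 \<le> w k \<and> w k \<le> (n::nat)"
  using permutes_in_image[of w "{1..n}" k] by simp

lemma permutes_inj_eq: "w permutes S \<Longrightarrow> w a = w b \<longleftrightarrow> a = b"
  by (meson injD permutes_inj)

lemma permutes_surj_interval: "w permutes {1..n} \<Longrightarrow> 1 \<le> v \<Longrightarrow> v \<le> (n::nat) \<Longrightarrow> \<exists>k. 1 \<le> k \<and> k \<le> n \<and> w k = v"
  using permutes_image[of w "{1..n}"] by (metis atLeastAtMost_iff imageE)

lemma pairs_placed_paired:
  assumes "pairs_placed n i r" "w permutes {1..n}" "2 * i \<le> n" "\<forall>k\<in>dom r. r k = Some (w k)"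
  shows "dom r = {k \<in> {1..n}. w k \<le> i \<or> n - i + 1 \<le> w k} \<and> (\<forall>j\<in>{1..i}. paired n w j)"
  using assms
proof (induction rule: pairs_placed.induct)
  case none
  have "\<not> (w k \<le> 0 \<or> n - 0 + 1 \<le> w k)" if "k \<in> {1..n}" for k using permutes_range[OF none(1), of k] that by simp
  then show ?case by auto
next
  case (place i r a b)
  note w = place.prems(1)
  have wa: "w a = n - i + 1" and wb: "w b = i" 
    using place.prems(3)[rule_format, of a] place.prems(3)[rule_format, of b] place.hyps by simp_all
  have agree: "\<forall>k\<in>dom r. r k = Some (w k)"
  proof
    fix k assume k: "k \<in> dom r"
    then have "k \<noteq> a" "k \<noteq> b" using place.hyps by auto
    then show "r k = Some (w k)" using place.prems(3)[rule_format, of k] k by simp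
  qed
  have IH: "dom r = {k \<in> {1..n}. w k \<le> i - 1 \<or> n - (i - 1) + 1 \<le> w k}" "\<forall>j\<in>{1..i-1}. paired n w j"
    using place.IH[OF w _ agree] place.prems(2) by auto
  have dom: "dom (r(a \<mapsto> n - i + 1, b \<mapsto> i)) = {k \<in> {1..n}. w k \<le> i \<or> n - i + 1 \<le> w k}"
  proof (rule set_eqI)
    fix k
    have "k = a \<longleftrightarrow> w k = n - i + 1" "k = b \<longleftrightarrow> w k = i" using permutes_inj_eq[OF w] wa wb by metis+
    moreover have "a \<in> {1..n}" "b \<in> {1..n}" using place.hyps by auto
    moreover have "k \<in> dom r \<longleftrightarrow> k \<in> {1..n} \<and> (w k \<le> i - 1 \<or> n - (i - 1) + 1 \<le> w k)" using IH(1) by simp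
    ultimately show "k \<in> dom (r(a \<mapsto> n - i + 1, b \<mapsto> i)) \<longleftrightarrow> k \<in> {k \<in> {1..n}. w k \<le> i \<or> n - i + 1 \<le> w k}"
      using place.hyps(2) place.prems(2) by auto
  qed
  have "w c < i \<or> n - i + 1 < w c" if "a < c" "c < b" for c
  proof -
    have "c \<in> dom r" using that place.hyps by auto
    then show ?thesis using IH(1) place.hyps(2) place.prems(2) by auto
  qed
  then have "paired n w i" unfolding paired_def using wa wb place.hyps by (intro exI[of _ a] exI[of _ b]) auto
  moreover have "{1..i} = insert i {1..i-1}" using place.hyps(2) by auto
  ultimately have all: "\<forall>j\<in>{1..i}. paired n w j" using IH(2) by (simp del: atLeastAtMost_iff)
  show ?case by (intro conjI dom all)
qed

lemma paired_pairs_placed: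
  assumes w: "w permutes {1..n}" 
  shows "2 * i \<le> n \<Longrightarrow> \<forall>j\<in>{1..i}. paired n w j \<Longrightarrow>
    pairs_placed n i (\<lambda>k. if k \<in> {1..n} \<and> (w k \<le> i \<or> n - i + 1 \<le> w k) then Some (w k) else None)"
proof (induction i)
  case 0
  have "(\<lambda>k. if k \<in> {1..n} \<and> (w k \<le> 0 \<or> n - 0 + 1 \<le> w k) then Some (w k) else None) = Map.empty"
    using permutes_range[OF w] by fastforce
  then show ?case using none by simp
next
  case (Suc i)
  let ?R = "\<lambda>i k. if k \<in> {1..n} \<and> (w k \<le> i \<or> n - i + 1 \<le> w k) then Some (w k) else None"
  have IH: "pairs_placed n i (?R i)" using Suc by simp
  have "paired n w (Suc i)" using Suc.prems(2) by simp
  then obtain a b where ab: "1 \<le> a" "a < b" "b \<le> n" "w a = n - Suc i + 1" "w b = Suc i"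
    "\<forall>c. a < c \<and> c < b \<longrightarrow> w c < Suc i \<or> n - Suc i + 1 < w c"
    unfolding paired_def by (elim exE conjE)
  have dom: "dom (?R i) = {k \<in> {1..n}. w k \<le> i \<or> n - i + 1 \<le> w k}" by (auto simp: dom_def split: if_splits)
  have "pairs_placed n (Suc i) ((?R i)(a \<mapsto> n - Suc i + 1, b \<mapsto> Suc i))"
  proof (rule place)
    show "pairs_placed n (Suc i - 1) (?R i)" using IH by simp
    show "{a<..<b} \<subseteq> dom (?R i)"
    proof
      fix c assume c: "c \<in> {a<..<b}"
      then show "c \<in> dom (?R i)" unfolding dom using ab(1,3) ab(6)[rule_format, of c] Suc.prems(1) by auto
    qed
  qed (unfold dom, use ab Suc.prems(1) in auto)
  moreover have "(?R i)(a \<mapsto> n - Suc i + 1, b \<mapsto> Suc i) = ?R (Suc i)"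
  proof
    fix k
    have "k = a \<longleftrightarrow> w k = n - Suc i + 1" "k = b \<longleftrightarrow> w k = Suc i" using permutes_inj_eq[OF w] ab by metis+
    then show "((?R i)(a \<mapsto> n - Suc i + 1, b \<mapsto> Suc i)) k = ?R (Suc i) k"
      using ab Suc.prems(1) by auto
  qed
  ultimately show ?case by simp
qed

lemma strictly_pairing_iff:
  assumes "q \<le> p"
  shows "strictly_pairing p q w \<longleftrightarrow> w permutes {1..p+q} \<and> (\<forall>i\<in>{1..q}. paired (p+q) w i) \<and> middle_increasing p q w"
proof
  assume s: "strictly_pairing p q w"
  then obtain r where w: "w permutes {1..p+q}" and r: "pairs_placed (p + q) q r" "\<forall>k\<in>dom r. r k = Some (w k)"
    and m: "strict_mono_on ({1..p+q} - dom r) w" unfolding strictly_pairing_def by blast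
  have d: "dom r = {k \<in> {1..p+q}. w k \<le> q \<or> (p + q) - q + 1 \<le> w k}" "\<forall>j\<in>{1..q}. paired (p+q) w j"
    using pairs_placed_paired[OF r(1) w _ r(2)] assms by auto
  have "middle_increasing p q w"
    unfolding middle_increasing_def
  proof (intro allI impI; elim conjE)
    fix j k assume "1 \<le> j" "j < k" "k \<le> p + q" "w j \<in> {q+1..p}" "w k \<in> {q+1..p}"
    then have "j \<in> {1..p+q} - dom r" "k \<in> {1..p+q} - dom r" unfolding d by auto
    then show "w j < w k" using m \<open>j < k\<close> by (auto simp: strict_mono_on_def)
  qed
  then show "w permutes {1..p+q} \<and> (\<forall>i\<in>{1..q}. paired (p+q) w i) \<and> middle_increasing p q w" using w d(2) by blast
next
  assume a: "w permutes {1..p+q} \<and> (\<forall>i\<in>{1..q}. paired (p+q) w i) \<and> middle_increasing p q w"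
  then have w: "w permutes {1..p+q}" by blast
  let ?r = "\<lambda>k. if k \<in> {1..p+q} \<and> (w k \<le> q \<or> (p + q) - q + 1 \<le> w k) then Some (w k) else None"
  have r: "pairs_placed (p + q) q ?r" using paired_pairs_placed[OF w, of q] a assms by simp
  have d: "dom ?r = {k \<in> {1..p+q}. w k \<le> q \<or> p + 1 \<le> w k}" by (auto simp: dom_def split: if_splits)
  have c: "{1..p+q} - dom ?r = {k \<in> {1..p+q}. w k \<in> {q+1..p}}" unfolding d by auto
  have "w ` {k \<in> {1..p+q}. w k \<in> {q+1..p}} = {q+1..p}"
  proof
    show "{q+1..p} \<subseteq> w ` {k \<in> {1..p+q}. w k \<in> {q+1..p}}"
    proof
      fix v assume v: "v \<in> {q+1..p}"
      then obtain k where "1 \<le> k" "k \<le> p + q" "w k = v" using permutes_surj_interval[OF w, of v] by auto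
      then show "v \<in> w ` {k \<in> {1..p+q}. w k \<in> {q+1..p}}" using v by auto
    qed
  qed auto
  moreover have "strict_mono_on {k \<in> {1..p+q}. w k \<in> {q+1..p}} w"
    using a by (auto simp: strict_mono_on_def middle_increasing_def)
  moreover have "\<forall>k\<in>dom ?r. ?r k = Some (w k)" by (auto simp: dom_def split: if_splits)
  ultimately show "strictly_pairing p q w"
    unfolding strictly_pairing_def using w r c by (intro conjI exI[of _ ?r]) auto
qed

section \<open>Ballot words and their inversions\<close>

definition cnt :: "(nat \<Rightarrow> nat) \<Rightarrow> nat \<Rightarrow> nat set \<Rightarrow> nat" where
  "cnt w k S = card {l \<in> {1..k}. w l \<in> S}"

text \<open>The case \<open>i = 1\<close> is the condition that comes from geometry. The parameter
  \<open>i\<close> restricts it to the inner word of the letters from \<open>i\<close> to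
  \<open>n - i + 1\<close>, as does the one of \<open>invs\<close>; inductions peel off one outer
  pair at a time.\<close>

definition ballot :: "nat \<Rightarrow> nat \<Rightarrow> nat \<Rightarrow> (nat \<Rightarrow> nat) \<Rightarrow> bool" where
  "ballot n q i w \<longleftrightarrow> (\<forall>j\<in>{i..q}. \<forall>k\<le>n. cnt w k {i..j} \<le> cnt w k {n-j+1..n-i+1})"

definition invs :: "nat \<Rightarrow> nat \<Rightarrow> (nat \<Rightarrow> nat) \<Rightarrow> (nat \<times> nat) set" where
  "invs n i w = {(j, k). 1 \<le> j \<and> j < k \<and> k \<le> n \<and> w k < w j \<and> i \<le> w k \<and> w j \<le> n - i + 1}"

lemma finite_invs [simp]: "finite (invs n i w)"
  by (rule finite_subset[of _ "{1..n} \<times> {1..n}"]) (auto simp: invs_def)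

lemma perm_length_invs: 
  assumes "w permutes {1..n}" shows "perm_length n w = card (invs n 1 w)"
proof -
  have "{(i, j). 1 \<le> i \<and> i < j \<and> j \<le> n \<and> w j < w i} = invs n 1 w"
    unfolding invs_def using permutes_range[OF assms] by (auto; fastforce)
  then show ?thesis by (simp add: perm_length_def)
qed

lemma cnt_mono: "k \<le> k' \<Longrightarrow> cnt w k S \<le> cnt w k' S"
  unfolding cnt_def by (rule card_mono) auto

lemma cnt_insert: "1 \<le> k \<Longrightarrow> cnt w k S = cnt w (k - 1) S + (if w k \<in> S then 1 else 0)"
proof -
  assume k: "1 \<le> k"
  have "{1..k} = insert k {1..k-1}" using k by auto
  then have "{l \<in> {1..k}. w l \<in> S} = (if w k \<in> S then insert k {l \<in> {1..k-1}. w l \<in> S} else {l \<in> {1..k-1}. w l \<in> S})"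
    by auto
  moreover have "k \<notin> {l \<in> {1..k-1}. w l \<in> S}" using k by auto
  ultimately show ?thesis unfolding cnt_def by (cases "w k \<in> S") (simp_all del: atLeastAtMost_iff)
qed

lemma cnt_const: 
  assumes "a \<le> k" "\<And>l. a < l \<Longrightarrow> l \<le> k \<Longrightarrow> w l \<notin> S" shows "cnt w k S = cnt w a S"
  unfolding cnt_def by (rule arg_cong[of _ _ card]) (use assms in \<open>force simp: not_less[symmetric]\<close>)

lemma cnt_split: "S \<inter> T = {} \<Longrightarrow> cnt w k (S \<union> T) = cnt w k S + cnt w k T"
  unfolding cnt_def by (subst card_Un_disjoint[symmetric]) (auto intro: arg_cong[of _ _ card])

lemma cnt_single:
  assumes w: "w permutes {1..n}" and b: "1 \<le> b" shows "cnt w k {w b} = (if b \<le> k then 1 else 0)"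
proof -
  have "{l \<in> {1..k}. w l \<in> {w b}} = (if b \<le> k then {b} else {})" using permutes_inj_eq[OF w] b by auto
  then show ?thesis by (simp add: cnt_def)
qed

lemma cnt_transpose:
  assumes "1 \<le> c" "c < b" 
  shows "k < c \<Longrightarrow> cnt (w \<circ> Transposition.transpose c b) k S = cnt w k S"
    "b \<le> k \<Longrightarrow> cnt (w \<circ> Transposition.transpose c b) k S = cnt w k S"
    "c \<le> k \<Longrightarrow> k < b \<Longrightarrow> cnt (w \<circ> Transposition.transpose c b) k S + (if w c \<in> S then 1 else 0) = cnt w k S + (if w b \<in> S then 1 else 0)"
proof -
  show "cnt (w \<circ> Transposition.transpose c b) k S = cnt w k S" if "k < c"
    unfolding cnt_def by (rule arg_cong[of _ _ card]) (use that assms in \<open>auto simp: Transposition.transpose_def\<close>)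
  show "cnt (w \<circ> Transposition.transpose c b) k S = cnt w k S" if "b \<le> k"
  proof -
    have "bij_betw (Transposition.transpose c b) {l \<in> {1..k}. (w \<circ> Transposition.transpose c b) l \<in> S} {l \<in> {1..k}. w l \<in> S}"
      by (rule bij_betw_byWitness[where f'="Transposition.transpose c b"]) (use that assms in \<open>auto simp: Transposition.transpose_def\<close>)
    then show ?thesis unfolding cnt_def by (rule bij_betw_same_card)
  qed
  show "cnt (w \<circ> Transposition.transpose c b) k S + (if w c \<in> S then 1 else 0) = cnt w k S + (if w b \<in> S then 1 else 0)" if "c \<le> k" "k < b"
  proof -
    let ?A = "{l \<in> {1..k} - {c}. w l \<in> S}"
    have "cnt f k S = card {l \<in> {1..k} - {c}. f l \<in> S} + (if f c \<in> S then 1 else 0)" for f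
    proof -
      have "{l \<in> {1..k}. f l \<in> S} = (if f c \<in> S then insert c {l \<in> {1..k} - {c}. f l \<in> S} else {l \<in> {1..k} - {c}. f l \<in> S})"
        using assms that by auto
      moreover have "c \<notin> {l \<in> {1..k} - {c}. f l \<in> S}" by simp
      ultimately show ?thesis unfolding cnt_def by simp
    qed
    moreover have "{l \<in> {1..k} - {c}. (w \<circ> Transposition.transpose c b) l \<in> S} = ?A" using that by (auto simp: Transposition.transpose_def)
    ultimately show ?thesis by simp
  qed
qed

text \<open>Undoing an inversion lowers their number, also within the inner word. An inversion of
  the new word is sent to its transposed pair of positions if these are still in order, and to
  itself otherwise; this is injective and misses \<open>(c, b)\<close>.\<close>

lemma invs_transpose:
  assumes w: "w permutes {1..n}" and cb: "1 \<le> c" "c < b" "b \<le> n" "w b < w c" "i \<le> w b" "w c \<le> n - i + 1"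
  shows "card (invs n i (w \<circ> Transposition.transpose c b)) < card (invs n i w)"
proof -
  define t where "t = Transposition.transpose c b"
  have tc: "t c = b" "t b = c" "\<And>l. l \<noteq> c \<Longrightarrow> l \<noteq> b \<Longrightarrow> t l = l" by (auto simp: t_def transpose_def)
  have tt: "t (t l) = l" for l by (simp add: t_def)
  define f where "f = (\<lambda>(l, k). if t l < t k then (t l, t k) else (l, k))"
  have img: "f (l, k) \<in> invs n i w - {(c, b)}" and shape: "\<not> t l < t k \<Longrightarrow> (l = c \<and> c < k \<and> k < b) \<or> (k = b \<and> c < l \<and> l < b)"
    if lk: "(l, k) \<in> invs n i (w \<circ> t)" for l k
  proof -
    have lk': "1 \<le> l" "l < k" "k \<le> n" "w (t k) < w (t l)" "i \<le> w (t k)" "w (t l) \<le> n - i + 1"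
      using lk by (auto simp: invs_def)
    have ne: "\<not> (l = c \<and> k = b)" using lk'(4) cb(4) tc by auto
    show sh: "(l = c \<and> c < k \<and> k < b) \<or> (k = b \<and> c < l \<and> l < b)" if "\<not> t l < t k"
      using that lk'(2) cb(2) ne tc(1,2) tc(3)[of l] tc(3)[of k] by (cases "l = c"; cases "l = b"; cases "k = c"; cases "k = b") auto
    have tr: "1 \<le> t l" "t k \<le> n"
      using lk'(1) cb(1,2) tc(1,2) tc(3)[of l] by (cases "l = c"; cases "l = b"; auto)
        (use lk'(3) cb(2,3) tc(1,2) tc(3)[of k] in \<open>cases "k = c"; cases "k = b"; auto\<close>)
    show "f (l, k) \<in> invs n i w - {(c, b)}"
    proof (cases "t l < t k")
      case True
      have "(t l, t k) \<noteq> (c, b)"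
      proof
        assume "(t l, t k) = (c, b)"
        then have "l = b" "k = c" using tt[of l] tt[of k] tc(1,2) by auto
        then show False using lk'(2) cb(2) by simp
      qed
      then show ?thesis using True lk' tr by (auto simp: f_def invs_def)
    next
      case False
      have "w k < w l" "i \<le> w k" "w l \<le> n - i + 1" "(l, k) \<noteq> (c, b)"
        using sh[OF False] lk' cb tc(1,2) tc(3)[of l] tc(3)[of k] by auto
      then show ?thesis using False lk' by (auto simp: f_def invs_def)
    qed
  qed
  have "inj_on f (invs n i (w \<circ> t))"
  proof (rule inj_onI)
    fix x y assume xy: "x \<in> invs n i (w \<circ> t)" "y \<in> invs n i (w \<circ> t)" "f x = f y"
    obtain l k l' k' where x: "x = (l, k)" "y = (l', k')" by fastforce
    have *: False if "(l, k) \<in> invs n i (w \<circ> t)" "(l', k') \<in> invs n i (w \<circ> t)" "t l < t k" "\<not> t l' < t k'" "(t l, t k) = (l', k')" for l k l' k'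
    proof -
      have "l < k" using that(1) by (simp add: invs_def)
      have "l = t l'" "k = t k'" using that(5) tt[of l] tt[of k] by auto
      then show False using shape[OF that(2,4)] \<open>l < k\<close> tc(1,2) tc(3)[of l'] tc(3)[of k'] by auto
    qed
    show "x = y"
    proof (cases "t l < t k"; cases "t l' < t k'")
      assume "t l < t k" "t l' < t k'"
      then have "t l = t l'" "t k = t k'" using xy(3) x by (simp_all add: f_def)
      then have "t (t l) = t (t l')" "t (t k) = t (t k')" by simp_all
      then show ?thesis using x by (simp add: tt)
    next
      assume A: "t l < t k" "\<not> t l' < t k'"
      have "f x = (t l, t k)" "f y = (l', k')" using A x by (simp_all add: f_def)
      then have eq: "(t l, t k) = (l', k')" using xy(3) by (simp only:)
      show ?thesis using *[OF _ _ A eq] xy(1,2) unfolding x by blast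
    next
      assume A: "\<not> t l < t k" "t l' < t k'"
      have "f x = (l, k)" "f y = (t l', t k')" using A x by (simp_all add: f_def)
      then have eq: "(t l', t k') = (l, k)" using xy(3) by (simp only:)
      show ?thesis using *[OF _ _ A(2,1) eq] xy(1,2) unfolding x by blast
    next
      assume "\<not> t l < t k" "\<not> t l' < t k'"
      then show ?thesis using xy(3) x by (simp add: f_def)
    qed
  qed
  moreover have "f ` invs n i (w \<circ> t) \<subseteq> invs n i w - {(c, b)}"
  proof
    fix z assume "z \<in> f ` invs n i (w \<circ> t)"
    then obtain l k where lk: "(l, k) \<in> invs n i (w \<circ> t)" "z = f (l, k)" by (metis imageE prod.exhaust)
    show "z \<in> invs n i w - {(c, b)}" unfolding lk(2) by (rule img[OF lk(1)])
  qed
  ultimately have "card (invs n i (w \<circ> t)) \<le> card (invs n i w - {(c, b)})"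
    by (rule card_inj_on_le) simp
  also have "\<dots> < card (invs n i w)"
  proof (rule psubset_card_mono)
    have "(c, b) \<in> invs n i w" using cb by (simp add: invs_def)
    then show "invs n i w - {(c, b)} \<subset> invs n i w" by blast
  qed simp
  finally show ?thesis by (simp add: t_def)
qed

lemma card_value_positions:
  assumes w: "w permutes {1..n}" and "1 \<le> i" "2 * i \<le> n + 1"
  shows "card {k \<in> {1..n}. w k \<in> {i..n-i+1}} = n + 2 - 2 * i"
proof -
  have "bij_betw w {k \<in> {1..n}. w k \<in> {i..n-i+1}} {i..n-i+1}"
    unfolding bij_betw_def
  proof
    show "inj_on w {k \<in> {1..n}. w k \<in> {i..n-i+1}}" using permutes_inj_eq[OF w] by (auto simp: inj_on_def)
    show "w ` {k \<in> {1..n}. w k \<in> {i..n-i+1}} = {i..n-i+1}"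
    proof
      show "{i..n-i+1} \<subseteq> w ` {k \<in> {1..n}. w k \<in> {i..n-i+1}}"
      proof
        fix v assume v: "v \<in> {i..n-i+1}"
        moreover have "n - i + 1 \<le> n" using assms(2,3) by linarith
        ultimately have "1 \<le> v" "v \<le> n" using assms(2) by auto
        then obtain k where "1 \<le> k" "k \<le> n" "w k = v" using permutes_surj_interval[OF w, of v] by blast
        then show "v \<in> w ` {k \<in> {1..n}. w k \<in> {i..n-i+1}}" using v by auto
      qed
    qed auto
  qed
  then have "card {k \<in> {1..n}. w k \<in> {i..n-i+1}} = card {i..n-i+1}" by (rule bij_betw_same_card)
  then show ?thesis using assms by simp
qed

text \<open>The largest inner letter, at \<open>a\<close>, is inverted with every inner letter after
  it, and the smallest, at \<open>b\<close>, with every inner letter before it. Every other inner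
  letter is hit once, those between \<open>a\<close> and \<open>b\<close> twice, and the pair
  \<open>(a, b)\<close> itself adds one.\<close>

lemma invs_step:
  assumes w: "w permutes {1..n}" and i: "1 \<le> i" "2 * i \<le> n" 
    and ab: "1 \<le> a" "a < b" "b \<le> n" "w a = n - i + 1" "w b = i"
  shows "card (invs n i w) = card (invs n (i + 1) w) + (n + 1 - 2 * i) + card {c. a < c \<and> c < b \<and> w c \<in> {i..n-i+1}}"
proof -
  let ?N = "{k \<in> {1..n}. w k \<in> {i..n-i+1}}"
  let ?A = "{k \<in> ?N. a < k}" and ?B = "{k \<in> ?N. k < b}" and ?M = "{c. a < c \<and> c < b \<and> w c \<in> {i..n-i+1}}"
  have wa: "w k = n - i + 1 \<longleftrightarrow> k = a" and wb: "w k = i \<longleftrightarrow> k = b" for k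
    using permutes_inj_eq[OF w, of k a] permutes_inj_eq[OF w, of k b] ab by simp_all
  have dec: "invs n i w = invs n (i + 1) w \<union> (Pair a ` ?A \<union> (\<lambda>k. (k, b)) ` ?B)"
  proof (intro equalityI subsetI)
    fix x assume "x \<in> invs n i w"
    then obtain j k where x: "x = (j, k)" "1 \<le> j" "j < k" "k \<le> n" "w k < w j" "i \<le> w k" "w j \<le> n - i + 1"
      by (auto simp: invs_def)
    show "x \<in> invs n (i + 1) w \<union> (Pair a ` ?A \<union> (\<lambda>k. (k, b)) ` ?B)"
    proof (cases "j = a \<or> k = b")
      case True
      then show ?thesis using x by auto
    next
      case False
      then have "w j \<noteq> n - i + 1" "w k \<noteq> i" using wa wb by auto
      then show ?thesis using x by (auto simp: invs_def)
    qed
  next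
    fix x assume "x \<in> invs n (i + 1) w \<union> (Pair a ` ?A \<union> (\<lambda>k. (k, b)) ` ?B)"
    then consider "x \<in> invs n (i + 1) w" | k where "k \<in> ?A" "x = (a, k)" | k where "k \<in> ?B" "x = (k, b)" by blast
    then show "x \<in> invs n i w"
    proof cases
      case 1 then show ?thesis by (auto simp: invs_def)
    next
      case 2
      then have "w k \<noteq> n - i + 1" using wa[of k] by auto
      then show ?thesis using 2 ab by (auto simp: invs_def)
    next
      case 3
      then have "w k \<noteq> i" using wb[of k] by auto
      then show ?thesis using 3 ab by (auto simp: invs_def)
    qed
  qed
  have disj: "invs n (i + 1) w \<inter> (Pair a ` ?A \<union> (\<lambda>k. (k, b)) ` ?B) = {}"
    using ab by (auto simp: invs_def)
  have "card (Pair a ` ?A \<union> (\<lambda>k. (k, b)) ` ?B) + card (Pair a ` ?A \<inter> (\<lambda>k. (k, b)) ` ?B) = card ?A + card ?B"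
    by (subst card_Un_Int[symmetric]) (auto simp: card_image inj_on_def)
  moreover have "Pair a ` ?A \<inter> (\<lambda>k. (k, b)) ` ?B = {(a, b)}" using ab i by auto
  ultimately have 1: "card (Pair a ` ?A \<union> (\<lambda>k. (k, b)) ` ?B) + 1 = card ?A + card ?B" by simp
  have "?A \<union> ?B = ?N" using ab by auto
  moreover have "?A \<inter> ?B = ?M" using ab by auto
  ultimately have "card ?A + card ?B = card ?N + card ?M"
    using card_Un_Int[of ?A ?B] by simp
  moreover have "card ?N = n + 2 - 2 * i" using card_value_positions[OF w i(1)] i by simp
  ultimately have "card (Pair a ` ?A \<union> (\<lambda>k. (k, b)) ` ?B) = (n + 1 - 2 * i) + card ?M" using 1 i by linarith
  then show ?thesis unfolding dec by (subst card_Un_disjoint) (use disj in auto)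
qed

text \<open>The product solves the recursion of \<open>invs_step\<close> with nothing between the
  entries: \<open>(p - i) (q - i) + (p + q + 1 - 2 i) = (p + 1 - i) (q + 1 - i)\<close>. It starts
  from 0, the increasing middle word.\<close>

lemma paired_length:
  assumes w: "w permutes {1..p+q}" and qp: "q \<le> p" and i: "1 \<le> i" "i \<le> q + 1" 
    and pr: "\<forall>j\<in>{i..q}. paired (p+q) w j" and mid: "middle_increasing p q w"
  shows "card (invs (p+q) i w) = (p + 1 - i) * (q + 1 - i)"
  using i(2,1) pr
proof (induction i rule: inc_induct)
  case base
  have "invs (p+q) (q+1) w = {}"
  proof (rule ccontr)
    assume "invs (p+q) (q+1) w \<noteq> {}"
    then obtain j k where "1 \<le> j" "j < k" "k \<le> p + q" "w k < w j" "q + 1 \<le> w k" "w j \<le> p"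
      by (auto simp: invs_def)
    moreover from this have "w j \<in> {q+1..p}" "w k \<in> {q+1..p}" by auto
    ultimately have "w j < w k" using mid unfolding middle_increasing_def by blast
    then show False using \<open>w k < w j\<close> by simp
  qed
  then show ?case by simp
next
  case (step i)
  have "paired (p+q) w i" using step.prems(2) step.hyps by simp
  then obtain a b where ab: "1 \<le> a" "a < b" "b \<le> p + q" "w a = p + q - i + 1" "w b = i" 
    "\<forall>c. a < c \<and> c < b \<longrightarrow> w c < i \<or> p + q - i + 1 < w c"
    unfolding paired_def by (elim exE conjE)
  have "{c. a < c \<and> c < b \<and> w c \<in> {i..p+q-i+1}} = {}" using ab(6) by fastforce
  moreover have "2 * i \<le> p + q" using step.hyps qp by simp
  ultimately have "card (invs (p+q) i w) = card (invs (p+q) (i + 1) w) + (p + q + 1 - 2 * i)"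
    using invs_step[OF w step.prems(1) _ ab(1-5)] by (simp only: card.empty add_0_right)
  also have "card (invs (p+q) (i + 1) w) = (p + 1 - (i + 1)) * (q + 1 - (i + 1))"
    using step.IH step.prems by simp
  finally have "card (invs (p+q) i w) = (p - i) * (q - i) + (p + q + 1 - 2 * i)" by simp
  moreover obtain x where "q = i + x" using step.hyps le_Suc_ex[of i q] by auto
  moreover obtain y where "p = i + y" using step.hyps qp le_Suc_ex[of i p] by auto
  ultimately show ?case by (simp add: algebra_simps)
qed

text \<open>Moving \<open>i\<close> to the left, in exchange for the smallest inner letter in
  between, can hurt only prefixes ending from \<open>c\<close> on and before \<open>b\<close>. If
  \<open>w c\<close> is at most \<open>j\<close>, the exchange does not change the count of small
  letters. Otherwise no letter counted as small occurs between \<open>a\<close> and the end of the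
  prefix, so the entry \<open>n - i + 1\<close> at \<open>a\<close> leaves a slack of one, which
  pays for the additional \<open>i\<close>.\<close>

lemma swap_small:
  assumes w: "w permutes {1..n}" and qn: "2 * q \<le> n" and i: "1 \<le> i" "i \<le> q" and bal: "ballot n q i w"
    and ab: "1 \<le> a" "a < b" "b \<le> n" "w a = n - i + 1" "w b = i"
    and c: "a < c" "c < b" "i < w c" "w c \<le> q" 
    and min: "\<And>l. a < l \<Longrightarrow> l < b \<Longrightarrow> w l \<in> {i..n-i+1} \<Longrightarrow> w c \<le> w l"
  shows "ballot n q i (w \<circ> Transposition.transpose c b)"
  unfolding ballot_def
proof (intro ballI allI impI)
  fix j k assume j: "j \<in> {i..q}" and k: "k \<le> n"
  have c1: "1 \<le> c" using ab c by simp
  have B: "cnt w k {i..j} \<le> cnt w k {n-j+1..n-i+1}" using bal j k by (simp add: ballot_def)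
  show "cnt (w \<circ> Transposition.transpose c b) k {i..j} \<le> cnt (w \<circ> Transposition.transpose c b) k {n-j+1..n-i+1}"
  proof (cases "c \<le> k \<and> k < b")
    case False
    then show ?thesis using B cnt_transpose(1,2)[OF c1 c(2)] by (metis not_le)
  next
    case True
    have "w c \<notin> {n-j+1..n-i+1}" "w b \<notin> {n-j+1..n-i+1}" using c ab j qn i by auto
    then have L: "cnt (w \<circ> Transposition.transpose c b) k {n-j+1..n-i+1} = cnt w k {n-j+1..n-i+1}"
      using cnt_transpose(3)[OF c1 c(2), of k w "{n-j+1..n-i+1}"] True by (simp del: atLeastAtMost_iff)
    show ?thesis
    proof (cases "w c \<le> j")
      case True
      then show ?thesis using L B cnt_transpose(3)[OF c1 c(2), of k w "{i..j}"] \<open>c \<le> k \<and> k < b\<close> c ab j by simp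
    next
      case False
      have "cnt w k {i..j} = cnt w (a - 1) {i..j}"
      proof (rule cnt_const)
        show "a - 1 \<le> k" using \<open>c \<le> k \<and> k < b\<close> c(1) by arith
        fix l assume l: "a - 1 < l" "l \<le> k"
        show "w l \<notin> {i..j}"
        proof (cases "l = a")
          case True then show ?thesis using ab j qn by auto
        next
          case False
          then have "a < l" "l < b" using l \<open>c \<le> k \<and> k < b\<close> by auto
          moreover have "w l \<in> {i..j} \<Longrightarrow> w l \<in> {i..n-i+1}" using j qn by auto
          ultimately show ?thesis using min[of l] \<open>\<not> w c \<le> j\<close> by (meson atLeastAtMost_iff le_trans)
        qed
      qed
      also have "\<dots> \<le> cnt w (a - 1) {n-j+1..n-i+1}" using bal j k ab by (simp add: ballot_def)
      also have "\<dots> + 1 \<le> cnt w a {n-j+1..n-i+1}" using cnt_insert[OF ab(1), of w "{n-j+1..n-i+1}"] ab(4) diff_le_mono2[of i j n] j by simp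
      also have "\<dots> \<le> cnt w k {n-j+1..n-i+1}" by (rule cnt_mono) (use \<open>c \<le> k \<and> k < b\<close> c in simp)
      finally show ?thesis
        using L cnt_transpose(3)[OF c1 c(2), of k w "{i..j}"] \<open>c \<le> k \<and> k < b\<close> False ab j by simp
    qed
  qed
qed

text \<open>The counterpart for the case that all inner letters in between exceed \<open>q\<close>:
  now \<open>n - i + 1\<close> is moved to the right, in exchange for the largest of them. Either
  that letter is counted as large too, or the slack of one created at \<open>a\<close> covers the
  loss, because no small letter follows before \<open>b\<close>.\<close>

lemma swap_large:
  assumes w: "w permutes {1..n}" and qn: "2 * q \<le> n" and i: "1 \<le> i" "i \<le> q" and bal: "ballot n q i w"
    and ab: "1 \<le> a" "a < b" "b \<le> n" "w a = n - i + 1" "w b = i"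
    and c: "a < c" "c < b" "w c \<in> {i..n-i+1}" 
    and max: "\<And>l. a < l \<Longrightarrow> l < b \<Longrightarrow> w l \<in> {i..n-i+1} \<Longrightarrow> w l \<le> w c"
    and big: "\<And>l. a < l \<Longrightarrow> l < b \<Longrightarrow> w l \<in> {i..n-i+1} \<Longrightarrow> q < w l"
  shows "ballot n q i (w \<circ> Transposition.transpose a c)"
  unfolding ballot_def
proof (intro ballI allI impI)
  fix j k assume j: "j \<in> {i..q}" and k: "k \<le> n"
  have B: "cnt w k {i..j} \<le> cnt w k {n-j+1..n-i+1}" using bal j k by (simp add: ballot_def)
  show "cnt (w \<circ> Transposition.transpose a c) k {i..j} \<le> cnt (w \<circ> Transposition.transpose a c) k {n-j+1..n-i+1}"
  proof (cases "a \<le> k \<and> k < c")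
    case False
    then show ?thesis using B cnt_transpose(1,2)[OF ab(1) c(1)] by (metis not_le)
  next
    case True
    have "w a \<notin> {i..j}" "w c \<notin> {i..j}" using c ab j qn i big[OF c] by auto
    then have S: "cnt (w \<circ> Transposition.transpose a c) k {i..j} = cnt w k {i..j}"
      using cnt_transpose(3)[OF ab(1) c(1), of k w "{i..j}"] True by (simp del: atLeastAtMost_iff)
    show ?thesis
    proof (cases "n - j + 1 \<le> w c")
      case True
      have "w a \<in> {n-j+1..n-i+1}" using ab(4) diff_le_mono2[of i j n] j by simp
      moreover have "w c \<in> {n-j+1..n-i+1}" using True c(3) by simp
      ultimately have "cnt (w \<circ> Transposition.transpose a c) k {n-j+1..n-i+1} = cnt w k {n-j+1..n-i+1}"
        using cnt_transpose(3)[OF ab(1) c(1), of k w "{n-j+1..n-i+1}"] \<open>a \<le> k \<and> k < c\<close> by (simp del: atLeastAtMost_iff)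
      then show ?thesis using S B by (simp only:)
    next
      case False
      have "cnt w k {i..j} = cnt w (a - 1) {i..j}"
      proof (rule cnt_const)
        show "a - 1 \<le> k" using \<open>a \<le> k \<and> k < c\<close> by arith
        fix l assume l: "a - 1 < l" "l \<le> k"
        show "w l \<notin> {i..j}"
        proof (cases "l = a")
          case True then show ?thesis using ab j qn by auto
        next
          case False
          then have "a < l" "l < b" using l \<open>a \<le> k \<and> k < c\<close> c(2) by auto
          moreover have "w l \<in> {i..j} \<Longrightarrow> w l \<in> {i..n-i+1}" using j qn by auto
          ultimately show ?thesis using big[of l] j by (meson atLeastAtMost_iff le_trans not_le)
        qed
      qed
      also have "\<dots> \<le> cnt w (a - 1) {n-j+1..n-i+1}" using bal j k ab by (simp add: ballot_def)
      also have "\<dots> + 1 = cnt w a {n-j+1..n-i+1}" using cnt_insert[OF ab(1), of w "{n-j+1..n-i+1}"] ab(4) diff_le_mono2[of i j n] j by simp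
      also have "\<dots> \<le> cnt w k {n-j+1..n-i+1}" by (rule cnt_mono) (use \<open>a \<le> k \<and> k < c\<close> in simp)
      finally have "cnt w k {i..j} + 1 \<le> cnt w k {n-j+1..n-i+1}" by simp
      moreover have "w a \<in> {n-j+1..n-i+1}" using ab(4) diff_le_mono2[of i j n] j by simp
      moreover have "w c \<notin> {n-j+1..n-i+1}" using False by simp
      ultimately show ?thesis
        using S cnt_transpose(3)[OF ab(1) c(1), of k w "{n-j+1..n-i+1}"] \<open>a \<le> k \<and> k < c\<close> by (simp del: atLeastAtMost_iff)
    qed
  qed
qed

lemma ballot_first:
  assumes w: "w permutes {1..n}" and i: "i \<le> q" and bal: "ballot n q i w"
    and ab: "1 \<le> a" "1 \<le> b" "b \<le> n" "w a = n - i + 1" "w b = i" and ne: "2 * i \<le> n"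
  shows "a < b"
proof -
  have "cnt w b {i..i} \<le> cnt w b {n-i+1..n-i+1}" using bal[unfolded ballot_def, rule_format, of i b] i ab by simp
  moreover have "cnt w b {i..i} = 1" using cnt_single[OF w ab(2), of b] ab by simp
  moreover have "cnt w b {n-i+1..n-i+1} = (if a \<le> b then 1 else 0)" using cnt_single[OF w ab(1), of b] ab by simp
  ultimately have "a \<le> b" by (auto split: if_splits)
  moreover have "a \<noteq> b" using ab ne by auto
  ultimately show ?thesis by simp
qed

text \<open>Deleting an adjacent pair affects the comparison only for prefixes that contain
  \<open>a\<close> but not \<open>b\<close>. Between these positions no inner letter occurs, so such
  a prefix may be cut back to \<open>a - 1\<close>.\<close>

lemma ballot_next:
  assumes w: "w permutes {1..n}" and qn: "2 * q \<le> n" and i: "1 \<le> i" "i \<le> q" and bal: "ballot n q i w"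
    and ab: "1 \<le> a" "a < b" "b \<le> n" "w a = n - i + 1" "w b = i"
    and adj: "\<And>c. a < c \<Longrightarrow> c < b \<Longrightarrow> w c < i \<or> n - i + 1 < w c"
  shows "ballot n q (i + 1) w"
  unfolding ballot_def
proof (intro ballI allI impI)
  fix j k assume j: "j \<in> {i+1..q}" and k: "k \<le> n"
  have b1: "1 \<le> b" using ab by simp
  have S: "cnt w k {i..j} = (if b \<le> k then 1 else 0) + cnt w k {i+1..j}" for k
  proof -
    have "{i..j} = {i} \<union> {i+1..j}" using j by auto
    then have "cnt w k {i..j} = cnt w k {i} + cnt w k {i+1..j}" using cnt_split[of "{i}" "{i+1..j}"] by simp
    then show ?thesis using cnt_single[OF w b1, of k] ab by simp
  qed
  have L: "cnt w k {n-j+1..n-i+1} = (if a \<le> k then 1 else 0) + cnt w k {n-j+1..n-i}" for k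
  proof -
    have "{n-j+1..n-i+1} = {n-i+1} \<union> {n-j+1..n-i}" using j by auto
    then have "cnt w k {n-j+1..n-i+1} = cnt w k {n-i+1} + cnt w k {n-j+1..n-i}" using cnt_split[of "{n-i+1}" "{n-j+1..n-i}"] by simp
    then show ?thesis using cnt_single[OF w ab(1), of k] ab by simp
  qed
  have B: "cnt w k {i..j} \<le> cnt w k {n-j+1..n-i+1}" if "k \<le> n" for k using bal j that by (simp add: ballot_def)
  have eq: "n - (i + 1) + 1 = n - i" using i qn by simp
  have "cnt w k {i+1..j} \<le> cnt w k {n-j+1..n-i}"
  proof (cases "a \<le> k \<and> k < b")
    case False
    then have "(b \<le> k) = (a \<le> k)" using ab(2) by auto
    then show ?thesis using B[OF k] unfolding S[of k] L[of k] by simp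
  next
    case True
    have out: "w l \<notin> {i+1..j} \<and> w l \<notin> {n-j+1..n-i}" if "a - 1 < l" "l \<le> k" for l
    proof (cases "l = a")
      case True then show ?thesis using ab j qn by auto
    next
      case False
      then have "a < l" "l < b" using that True by auto
      then show ?thesis using adj[of l] j qn by auto
    qed
    have "cnt w k {i+1..j} = cnt w (a - 1) {i+1..j}" "cnt w k {n-j+1..n-i} = cnt w (a - 1) {n-j+1..n-i}"
      by (rule cnt_const; use out True in auto)+
    moreover have "\<not> b \<le> a - 1" "\<not> a \<le> a - 1" "a - 1 \<le> n" using ab(1-3) by linarith+
    then have "cnt w (a - 1) {i+1..j} \<le> cnt w (a - 1) {n-j+1..n-i}"
      using B[of "a - 1"] S[of "a - 1"] L[of "a - 1"] by simp
    ultimately show ?thesis by simp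
  qed
  then show "cnt w k {i+1..j} \<le> cnt w k {n-j+1..n-(i+1)+1}" unfolding eq .
qed

text \<open>Outer induction over the pairs, inner induction over the number of inversions. If
  nothing stands between the entries of the pair, it is deleted. If something does, a swap gives a
  ballot word with fewer inversions to which the bound already applies, so the bound is strict for
  \<open>w\<close>.\<close>

lemma ballot_length:
  assumes qp: "q \<le> p" and i: "1 \<le> i" "i \<le> q + 1" and w: "w permutes {1..p+q}" and bal: "ballot (p+q) q i w"
  shows "(p + 1 - i) * (q + 1 - i) \<le> card (invs (p+q) i w) \<and>
    (card (invs (p+q) i w) = (p + 1 - i) * (q + 1 - i) \<longrightarrow> (\<forall>j\<in>{i..q}. paired (p+q) w j) \<and> middle_increasing p q w)"
  using i(2,1) w bal
proof (induction i arbitrary: w rule: inc_induct)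
  case base
  have "middle_increasing p q w" if "card (invs (p+q) (q+1) w) = 0"
    unfolding middle_increasing_def
  proof (intro allI impI; elim conjE)
    fix j k assume jk: "1 \<le> j" "j < k" "k \<le> p + q" "w j \<in> {q+1..p}" "w k \<in> {q+1..p}"
    have "invs (p+q) (q+1) w = {}" using that by simp
    then have "(j, k) \<notin> invs (p+q) (q+1) w" by simp
    moreover have "w j \<noteq> w k" using permutes_inj_eq[OF base(2)] jk by simp
    ultimately show "w j < w k" using jk by (auto simp: invs_def)
  qed
  then show ?case by simp
next
  case (step i)
  let ?n = "p + q"
  have iq: "i \<le> q" "2 * i \<le> ?n" "2 * q \<le> ?n" using step.hyps qp by auto
  have arith: "(p - i) * (q - i) + (p + q + 1 - 2 * i) = (p + 1 - i) * (q + 1 - i)"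
  proof -
    obtain x where "q = i + x" using iq le_Suc_ex[of i q] by auto
    moreover obtain y where "p = i + y" using iq qp le_Suc_ex[of i p] by auto
    ultimately show ?thesis by (simp add: algebra_simps)
  qed
  show ?case
    using step.prems(2,3)
  proof (induction "card (invs ?n i w)" arbitrary: w rule: less_induct)
    case less
    note w = less.prems(1) and bal = less.prems(2)
    have "1 \<le> ?n - i + 1" "?n - i + 1 \<le> ?n" using iq step.prems(1) by linarith+
    then obtain a where a: "1 \<le> a" "a \<le> ?n" "w a = ?n - i + 1" using permutes_surj_interval[OF w, of "?n - i + 1"] by blast
    obtain b where b: "1 \<le> b" "b \<le> ?n" "w b = i" using permutes_surj_interval[OF w, of i] iq step.prems(1) by auto
    have ab: "1 \<le> a" "a < b" "b \<le> ?n" "w a = ?n - i + 1" "w b = i"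
      using a b ballot_first[OF w iq(1) bal a(1) b(1,2) a(3) b(3) iq(2)] by auto
    let ?M = "{c. a < c \<and> c < b \<and> w c \<in> {i..?n-i+1}}"
    have finM: "finite ?M" by (rule finite_subset[of _ "{..b}"]) auto
    have stp: "card (invs ?n i w) = card (invs ?n (i + 1) w) + (?n + 1 - 2 * i) + card ?M"
      by (rule invs_step[OF w step.prems(1) iq(2) ab])
    show ?case
    proof (cases "?M = {}")
      case True
      then have adj: "w c < i \<or> ?n - i + 1 < w c" if "a < c" "c < b" for c using that by (auto simp: not_le)
      have nb: "ballot ?n q (i + 1) w" by (rule ballot_next[OF w iq(3) step.prems(1) iq(1) bal ab adj])
      have IH: "(p + 1 - (i + 1)) * (q + 1 - (i + 1)) \<le> card (invs ?n (i + 1) w)"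
        "card (invs ?n (i + 1) w) = (p + 1 - (i + 1)) * (q + 1 - (i + 1)) \<Longrightarrow> (\<forall>j\<in>{i+1..q}. paired ?n w j) \<and> middle_increasing p q w"
        using step.IH[of w] w nb step.prems(1) by simp_all
      have pi: "paired ?n w i" unfolding paired_def using ab adj by (intro exI[of _ a] exI[of _ b]) auto
      have "{i..q} = insert i {i+1..q}" using iq by auto
      then have ins: "\<And>P. (\<forall>j\<in>{i..q}. P j) \<longleftrightarrow> P i \<and> (\<forall>j\<in>{i+1..q}. P j)" by (simp only: ball_simps)
      have e1: "p + 1 - (i + 1) = p - i" "q + 1 - (i + 1) = q - i" by simp_all
      have eq: "card (invs ?n i w) = card (invs ?n (i + 1) w) + (?n + 1 - 2 * i)"
        using stp unfolding True by (simp only: card.empty add_0_right)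
      have 1: "(p + 1 - i) * (q + 1 - i) \<le> card (invs ?n i w)"
        unfolding eq arith[symmetric] using IH(1) unfolding e1 by (rule add_right_mono)
      have 2: "(\<forall>j\<in>{i..q}. paired ?n w j) \<and> middle_increasing p q w"
        if c: "card (invs ?n i w) = (p + 1 - i) * (q + 1 - i)"
      proof -
        have "card (invs ?n (i + 1) w) = (p - i) * (q - i)" using c unfolding eq arith[symmetric] by (simp only: add_right_cancel)
        then have ih: "(\<forall>j\<in>{i+1..q}. paired ?n w j) \<and> middle_increasing p q w" by (rule IH(2)[unfolded e1])
        show ?thesis unfolding ins by (intro conjI pi ih[THEN conjunct1] ih[THEN conjunct2])
      qed
      show ?thesis by (rule conjI, rule 1, rule impI, rule 2)
    next
      case False
      have "\<exists>w'. w' permutes {1..?n} \<and> ballot ?n q i w' \<and> card (invs ?n i w') < card (invs ?n i w)"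
      proof -
        have "Min (w ` ?M) \<in> w ` ?M" using finM False by (intro Min_in) auto
        then obtain c where c1: "Min (w ` ?M) = w c" "c \<in> ?M" by (elim imageE)
        have c: "c \<in> ?M" "\<And>l. l \<in> ?M \<Longrightarrow> w c \<le> w l"
          unfolding c1(1)[symmetric] by (rule c1(2)) (intro Min_le finite_imageI finM imageI)
        have "Max (w ` ?M) \<in> w ` ?M" using finM False by (intro Max_in) auto
        then obtain d where d1: "Max (w ` ?M) = w d" "d \<in> ?M" by (elim imageE)
        have d: "d \<in> ?M" "\<And>l. l \<in> ?M \<Longrightarrow> w l \<le> w d"
          unfolding d1(1)[symmetric] by (rule d1(2)) (intro Max_ge finite_imageI finM imageI)
        have c': "a < c" "c < b" "w c \<in> {i..?n-i+1}" and d': "a < d" "d < b" "w d \<in> {i..?n-i+1}" using c d by auto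
        have ci: "i < w c" using permutes_inj_eq[OF w, of c b] c' ab by (simp add: le_neq_implies_less)
        have dn: "w d < ?n - i + 1" using permutes_inj_eq[OF w, of d a] d' ab by (simp add: le_neq_implies_less)
        show ?thesis
        proof (cases "w c \<le> q")
          case True
          have "ballot ?n q i (w \<circ> Transposition.transpose c b)"
            by (rule swap_small[OF w iq(3) step.prems(1) iq(1) bal ab c'(1,2) ci True]) (use c(2) in auto)
          moreover have "card (invs ?n i (w \<circ> Transposition.transpose c b)) < card (invs ?n i w)"
            by (rule invs_transpose[OF w]) (use c' ab ci in auto)
          moreover have "(w \<circ> Transposition.transpose c b) permutes {1..?n}"
            by (intro permutes_compose w permutes_swap_id) (use c' ab in auto)
          ultimately show ?thesis by blast
        next
          case False
          have "ballot ?n q i (w \<circ> Transposition.transpose a d)"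
          proof (rule swap_large[OF w iq(3) step.prems(1) iq(1) bal ab d'])
            fix l assume l: "a < l" "l < b" "w l \<in> {i..?n-i+1}"
            show "w l \<le> w d" using d(2) l by simp
            show "q < w l" using c(2)[of l] l False by simp
          qed
          moreover have "card (invs ?n i (w \<circ> Transposition.transpose a d)) < card (invs ?n i w)"
            by (rule invs_transpose[OF w]) (use d' ab dn in auto)
          moreover have "(w \<circ> Transposition.transpose a d) permutes {1..?n}"
            by (intro permutes_compose w permutes_swap_id) (use d' ab in auto)
          ultimately show ?thesis by blast
        qed
      qed
      then obtain w' where "w' permutes {1..?n}" "ballot ?n q i w'" "card (invs ?n i w') < card (invs ?n i w)" by blast
      then have "(p + 1 - i) * (q + 1 - i) < card (invs ?n i w)" using less.hyps[of w'] by linarith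
      then show ?thesis by simp
    qed
  qed
qed

lemma length_iff_strictly_pairing:
  assumes "1 \<le> q" "q \<le> p" and w: "w permutes {1..p+q}" and bal: "ballot (p+q) q 1 w"
  shows "perm_length (p+q) w = p * q \<longleftrightarrow> strictly_pairing p q w"
  unfolding strictly_pairing_iff[OF assms(2)] perm_length_invs[OF w]
  using ballot_length[OF assms(2) order_refl _ w bal] paired_length[OF w assms(2) order_refl] w by auto

text \<open>A position with an inner letter lies outside the interval of every outer pair, so the
  prefix up to it contains both entries of that pair or none.\<close>

lemma balanced:
  assumes w: "w permutes {1..n}" 
  shows "2 * m \<le> n \<Longrightarrow> \<forall>j\<in>{1..m}. paired n w j \<Longrightarrow> m < w k \<Longrightarrow> w k \<le> n - m \<Longrightarrow> 
    cnt w k {1..m} = cnt w k {n-m+1..n}"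
proof (induction m)
  case 0
  then show ?case by (simp add: cnt_def)
next
  case (Suc m)
  have "paired n w (Suc m)" using Suc.prems(2) by simp
  then obtain x y where xy: "1 \<le> x" "x < y" "y \<le> n" "w x = n - Suc m + 1" "w y = Suc m"
    "\<forall>c. x < c \<and> c < y \<longrightarrow> w c < Suc m \<or> n - Suc m + 1 < w c"
    unfolding paired_def by (elim exE conjE)
  have "\<not> (x < k \<and> k < y)" using xy(6)[rule_format, of k] Suc.prems by auto
  moreover have "x \<noteq> k" "y \<noteq> k" using xy(4,5) Suc.prems by auto
  ultimately have eq: "(x \<le> k) = (y \<le> k)" using xy(2) by auto
  have y1: "1 \<le> y" using xy(1,2) by simp
  have nm: "n - Suc m + 1 = n - m" using Suc.prems(1) by simp
  have "{1..Suc m} = {1..m} \<union> {Suc m}" by auto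
  then have 1: "cnt w k {1..Suc m} = cnt w k {1..m} + cnt w k {Suc m}"
    using cnt_split[of "{1..m}" "{Suc m}"] by simp
  have "{n-m..n} = {n-m} \<union> {n-m+1..n}" by auto
  then have 2: "cnt w k {n-m..n} = cnt w k {n-m} + cnt w k {n-m+1..n}"
    using cnt_split[of "{n-m}" "{n-m+1..n}"] by simp
  have "cnt w k {1..m} = cnt w k {n-m+1..n}" by (rule Suc.IH) (use Suc.prems in auto)
  then show ?case
    unfolding nm 1 2 using cnt_single[OF w y1, of k] cnt_single[OF w xy(1), of k] eq xy(4,5) nm by simp
qed

text \<open>The inequality \<open>dom\<close> says that \<open>v\<close> is below \<open>w\<close>
  in the Bruhat order. Pairs are identified from the outside: \<open>dom\<close> puts
  \<open>i\<close> in \<open>v\<close> not later than in \<open>w\<close>, and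
  \<open>n - i + 1\<close> not earlier, while the ballot condition keeps \<open>n - i + 1\<close>
  before \<open>i\<close>. The positions strictly between are taken by outer letters on which both
  words agree, so both entries are at the same places as in \<open>w\<close>.\<close>

lemma dominance_unique:
  assumes q1: "1 \<le> q" and qp: "q \<le> p" and w: "w permutes {1..p+q}" and pr: "\<forall>i\<in>{1..q}. paired (p+q) w i" and mid: "middle_increasing p q w"
    and v: "v permutes {1..p+q}" and bal: "ballot (p+q) q 1 v"
    and dom: "\<And>i k. i \<le> p + q \<Longrightarrow> k \<le> p + q \<Longrightarrow> cnt w k {1..i} \<le> cnt v k {1..i}"
  shows "v = w"
proof -
  let ?n = "p + q"
  let ?V = "\<lambda>i. {i..?n-i+1}"
  have agree: "i \<le> q + 1 \<Longrightarrow> 1 \<le> i \<Longrightarrow> \<forall>l\<in>{1..?n}. (w l \<notin> ?V i \<or> v l \<notin> ?V i) \<longrightarrow> v l = w l" for i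
  proof (induction i)
    case 0 then show ?case by simp
  next
    case (Suc i)
    show ?case
    proof (cases "i = 0")
      case True
      then show ?thesis using permutes_range[OF w] permutes_range[OF v] by fastforce
    next
      case False
      have i: "1 \<le> i" "i \<le> q" "2 * i \<le> ?n" using False Suc.prems qp by auto
      have IH: "v l = w l" if "l \<in> {1..?n}" "w l \<notin> ?V i \<or> v l \<notin> ?V i" for l using Suc False that by simp
      have Vsub: "x \<in> ?V i \<or> x < i \<or> ?n - i + 1 < x" for x by auto
      have "paired ?n w i" using pr i by simp
      then obtain a b where ab: "1 \<le> a" "a < b" "b \<le> ?n" "w a = ?n - i + 1" "w b = i" 
        "\<forall>c. a < c \<and> c < b \<longrightarrow> w c < i \<or> ?n - i + 1 < w c"
        unfolding paired_def by (elim exE conjE)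
      have cnteq: "cnt v k S = cnt w k S" if "k \<le> ?n" "S \<inter> ?V i = {}" for k S
      proof -
        have "w l \<in> S \<longleftrightarrow> v l \<in> S" if "l \<in> {1..k}" for l
          using IH[of l] that \<open>k \<le> ?n\<close> \<open>S \<inter> ?V i = {}\<close> by (metis IntI atLeastAtMost_iff empty_iff order_trans)
        then have "{l \<in> {1..k}. v l \<in> S} = {l \<in> {1..k}. w l \<in> S}" by auto
        then show ?thesis by (simp add: cnt_def)
      qed
      have "1 \<le> ?n - i + 1" "?n - i + 1 \<le> ?n" using i by linarith+
      then obtain a' where a': "1 \<le> a'" "a' \<le> ?n" "v a' = ?n - i + 1" using permutes_surj_interval[OF v, of "?n - i + 1"] by blast
      obtain b' where b': "1 \<le> b'" "b' \<le> ?n" "v b' = i" using permutes_surj_interval[OF v, of i] i by auto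
      have split1: "cnt x k {1..i} = cnt x k {1..i-1} + cnt x k {i}" for x k
      proof -
        have "{1..i} = {1..i-1} \<union> {i}" using i by auto
        then show ?thesis using cnt_split[of "{1..i-1}" "{i}"] i by simp
      qed
      have b1: "1 \<le> b" using ab by simp
      have bb: "b' \<le> b"
      proof -
        have "cnt v b {i} \<ge> cnt w b {i}"
          using dom[of i b] i ab split1[of w b] split1[of v b] cnteq[of b "{1..i-1}"] by simp
        moreover have "cnt w b {i} = 1" using cnt_single[OF w b1, of b] ab by simp
        moreover have "cnt v b {i} = (if b' \<le> b then 1 else 0)" using cnt_single[OF v b'(1), of b] b' by simp
        ultimately show ?thesis by (simp split: if_splits)
      qed
      have aa: "a \<le> a'"
      proof (rule ccontr)
        assume "\<not> a \<le> a'"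
        \<comment> \<open>The three counts add up to the length of the prefix, so the lower bound on
          the letters up to \<open>n - i\<close> becomes an upper bound on
          \<open>n - i + 1\<close>.\<close>
        have total: "cnt x (a-1) {1..?n-i} + cnt x (a-1) {?n-i+1} + cnt x (a-1) {?n-i+2..?n} = a - 1" if x: "x permutes {1..?n}" for x
        proof -
          have "cnt x (a-1) {1..?n-i} + cnt x (a-1) {?n-i+1} = cnt x (a-1) ({1..?n-i} \<union> {?n-i+1})"
            by (rule cnt_split[symmetric]) auto
          then have "cnt x (a-1) {1..?n-i} + cnt x (a-1) {?n-i+1} + cnt x (a-1) {?n-i+2..?n} = cnt x (a-1) (({1..?n-i} \<union> {?n-i+1}) \<union> {?n-i+2..?n})"
            by (subst cnt_split) auto
          also have "({1..?n-i} \<union> {?n-i+1}) \<union> {?n-i+2..?n} = {1..?n}" using i by auto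
          also have "cnt x (a-1) {1..?n} = card {1..a-1}"
            unfolding cnt_def by (rule arg_cong[of _ _ card]) (use permutes_range[OF x] ab in force)
          finally show ?thesis by simp
        qed
        have "cnt v (a-1) {?n-i+1} = 1" using cnt_single[OF v a'(1), of "a-1"] a' \<open>\<not> a \<le> a'\<close> by simp
        moreover have "cnt w (a-1) {?n-i+1} = 0" using cnt_single[OF w ab(1), of "a-1"] ab by simp
        moreover have "cnt v (a-1) {?n-i+2..?n} = cnt w (a-1) {?n-i+2..?n}" by (rule cnteq) (use ab in auto)
        moreover have "cnt w (a-1) {1..?n-i} \<le> cnt v (a-1) {1..?n-i}" by (rule dom) (use ab in auto)
        ultimately show False using total[OF w] total[OF v] by linarith
      qed
      have ab': "a' < b'"
      proof -
        have "cnt v b' {1..i} \<le> cnt v b' {?n-i+1..?n}" using bal i b' by (simp add: ballot_def)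
        moreover have "cnt v b' {i} = 1" using cnt_single[OF v b'(1), of b'] b' by simp
        moreover have "cnt v b' {?n-i+1..?n} = cnt v b' {?n-i+1} + cnt v b' {?n-i+2..?n}"
        proof -
          have "{?n-i+1..?n} = {?n-i+1} \<union> {?n-i+2..?n}" using i by auto
          then show ?thesis using cnt_split[of "{?n-i+1}" "{?n-i+2..?n}"] by simp
        qed
        \<comment> \<open>The ballot condition compares all letters up to \<open>i\<close> with all
          letters from \<open>n - i + 1\<close> on; by \<open>balanced\<close> the outer ones
          cancel, and a single \<open>n - i + 1\<close> is left to precede \<open>i\<close>.\<close>
        moreover have "cnt v b' {?n-i+2..?n} = cnt v b' {1..i-1}"
        proof -
          have wb': "w b' \<in> ?V i"
          proof (rule ccontr)
            assume "w b' \<notin> ?V i"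
            then have "v b' = w b'" using IH[of b'] b' by simp
            moreover have "i \<in> ?V i" using i by simp
            ultimately show False using b'(3) \<open>w b' \<notin> ?V i\<close> by simp
          qed
          have "cnt w b' {1..i-1} = cnt w b' {?n-(i-1)+1..?n}"
            by (rule balanced[OF w]) (use pr i wb' in auto)
          moreover have "?n - (i - 1) + 1 = ?n - i + 2" using i by simp
          ultimately have "cnt w b' {?n-i+2..?n} = cnt w b' {1..i-1}" by (simp only:)
          then show ?thesis using cnteq[of b' "{?n-i+2..?n}"] cnteq[of b' "{1..i-1}"] b' by simp
        qed
        ultimately have "1 \<le> cnt v b' {?n-i+1}" using split1[of v b'] by linarith
        then have "a' \<le> b'" using cnt_single[OF v a'(1), of b'] a' by (simp split: if_splits)
        moreover have "a' \<noteq> b'" using a' b' i by auto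
        ultimately show ?thesis by simp
      qed
      have inside: "v c = w c \<and> v c \<notin> ?V i" if "a < c" "c < b" for c
        using IH[of c] ab(6)[rule_format, of c] that ab(1,3) by auto
      have "a' \<notin> {a<..<b}" "b' \<notin> {a<..<b}" using inside[of a'] inside[of b'] a' b' i by auto
      then have eq: "a' = a" "b' = b" using aa ab' bb by auto
      show ?thesis
      proof (intro ballI impI)
        fix l assume l: "l \<in> {1..?n}" "w l \<notin> ?V (Suc i) \<or> v l \<notin> ?V (Suc i)"
        show "v l = w l"
        proof (cases "l = a \<or> l = b")
          case True then show ?thesis using eq a' b' ab by auto
        next
          case False
          then have "w l \<noteq> i" "w l \<noteq> ?n - i + 1" "v l \<noteq> i" "v l \<noteq> ?n - i + 1"
            using permutes_inj_eq[OF w, of l a] permutes_inj_eq[OF w, of l b] permutes_inj_eq[OF v, of l a'] permutes_inj_eq[OF v, of l b'] eq ab a' b' by auto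
          then have "w l \<notin> ?V i \<or> v l \<notin> ?V i" using l(2) by auto
          then show ?thesis using IH l by blast
        qed
      qed
    qed
  qed
  have ag: "v l = w l" if "l \<in> {1..?n}" "w l \<notin> {q+1..p} \<or> v l \<notin> {q+1..p}" for l
  proof -
    have "?n - (q + 1) + 1 = p" using q1 qp by simp
    then show ?thesis using agree[of "q+1"] that by (simp only:)
  qed
  \<comment> \<open>For middle letters, \<open>v k > w k\<close> would violate dominance at the
    letter \<open>w k\<close>, because those of \<open>w\<close> increase; and
    \<open>v k < w k\<close> would repeat a letter that \<open>v\<close> has already used.\<close>
  have mideq: "k \<in> {1..?n} \<Longrightarrow> w k \<in> {q+1..p} \<Longrightarrow> v k = w k" for k
  proof (induction k rule: less_induct)
    case (less k)
    have vk: "v k \<in> {q+1..p}"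
    proof (rule ccontr)
      assume n: "v k \<notin> {q+1..p}"
      then have "v k = w k" using ag[OF less.prems(1)] by blast
      then show False using n less.prems(2) by metis
    qed
    have "v k \<le> w k"
    proof (rule ccontr)
      assume gt: "\<not> v k \<le> w k"
      have sub: "{l \<in> {1..k}. v l \<in> {1..w k}} \<subset> {l \<in> {1..k}. w l \<in> {1..w k}}"
      proof
        show "{l \<in> {1..k}. v l \<in> {1..w k}} \<subseteq> {l \<in> {1..k}. w l \<in> {1..w k}}"
        proof
          fix l assume l: "l \<in> {l \<in> {1..k}. v l \<in> {1..w k}}"
          then have ln: "l \<in> {1..?n}" using less.prems by auto
          show "l \<in> {l \<in> {1..k}. w l \<in> {1..w k}}"
          proof (cases "w l \<in> {q+1..p}")
            case True
            then have "w l \<le> w k" using mid less.prems l ln unfolding middle_increasing_def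
              by (cases "l = k") (auto intro: less_imp_le)
            then show ?thesis using l True by auto
          next
            case False then show ?thesis using ag[OF ln] l by auto
          qed
        qed
        have "k \<in> {l \<in> {1..k}. w l \<in> {1..w k}}" "k \<notin> {l \<in> {1..k}. v l \<in> {1..w k}}" using gt less.prems by auto
        then show "{l \<in> {1..k}. v l \<in> {1..w k}} \<noteq> {l \<in> {1..k}. w l \<in> {1..w k}}" by blast
      qed
      then have "cnt v k {1..w k} < cnt w k {1..w k}" unfolding cnt_def by (intro psubset_card_mono) auto
      then show False using dom[of "w k" k] less.prems by auto
    qed
    moreover have "\<not> v k < w k"
    proof
      assume lt: "v k < w k"
      obtain l where l: "1 \<le> l" "l \<le> ?n" "w l = v k" using permutes_surj_interval[OF w, of "v k"] vk by auto
      have "l < k"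
      proof (rule ccontr)
        assume "\<not> l < k"
        then have "k < l" using l lt by (metis nat_neq_iff)
        then have "w k < w l" using mid[unfolded middle_increasing_def, rule_format, of k l] less.prems l vk by simp
        then show False using lt l by simp
      qed
      then have "v l = w l" using less.IH[of l] l vk by simp
      then have "v l = v k" using l by simp
      then show False using permutes_inj_eq[OF v] \<open>l < k\<close> by auto
    qed
    ultimately show ?case by simp
  qed
  show "v = w"
  proof
    fix l
    show "v l = w l"
    proof (cases "l \<in> {1..?n}")
      case True then show ?thesis using ag mideq by blast
    next
      case False then show ?thesis using permutes_not_in[OF v] permutes_not_in[OF w] by simp
    qed
  qed
qed

section \<open>Bruhat cells with respect to the Iwasawa-Borel subgroup\<close>

text \<open>The map from invertible matrices to flags is open: two matrices with the same flag
  differ by a right factor fixing \<open>std_flag\<close>, and right multiplication by it is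
  continuous.\<close>

lemma openin_image_std_flag:
  fixes W :: "'n::{finite,linorder} cmat set"
  assumes W: "open W" "\<And>g. g \<in> W \<Longrightarrow> det g \<noteq> 0"
  shows "openin flag_topology ((\<lambda>g. act g std_flag) ` W)"
  unfolding openin_flag_topology_GL
proof
  show "(\<lambda>g. act g std_flag) ` W \<subseteq> flags" using W(2) act_flags[OF _ std_flag_flags] by blast
  show "open {g. det g \<noteq> 0 \<and> act g std_flag \<in> (\<lambda>g. act g std_flag) ` W}" (is "open ?P")
  proof (subst open_subopen, intro ballI)
    fix g assume "g \<in> ?P"
    then obtain g' where g: "det g \<noteq> 0" "g' \<in> W" "act g std_flag = act g' std_flag" by auto
    obtain B where B: "B ** g = mat 1" "g ** B = mat 1"
      using g(1) unfolding invertible_det_nz[symmetric] invertible_def by blast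
    define f where "f = (\<lambda>x :: 'n cmat. x ** (B ** g'))"
    have "act (B ** g') std_flag = act B (act g std_flag)" using g(3) by (simp flip: act_act)
    then have std: "act (B ** g') std_flag = std_flag" by (simp add: act_act B)
    have "continuous_on UNIV f"
      unfolding f_def matrix_matrix_mult_def by (intro continuous_intros continuous_on_vec_lambda)
    then have "open (f -` W)" using open_vimage[OF W(1)] by blast
    then have "open (f -` W \<inter> {g. det g \<noteq> 0})" by (intro open_Int open_det_nz)
    moreover have "f g = g'" unfolding f_def by (simp add: matrix_mul_assoc B)
    then have "g \<in> f -` W \<inter> {g. det g \<noteq> 0}" using g by simp
    moreover have "f -` W \<inter> {g. det g \<noteq> 0} \<subseteq> ?P"
    proof
      fix x assume x: "x \<in> f -` W \<inter> {g. det g \<noteq> 0}"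
      have "act (f x) std_flag = act x (act (B ** g') std_flag)" unfolding f_def by (simp only: act_act)
      then have "act x std_flag = act (f x) std_flag" by (simp only: std)
      then show "x \<in> ?P" using x by auto
    qed
    ultimately show "\<exists>T. open T \<and> g \<in> T \<and> T \<subseteq> ?P" by (intro exI conjI)
  qed
qed

lemma frame_disjoint:
  assumes b: "frame (b :: nat \<Rightarrow> 'n::{finite,linorder} cvec)" and PR: "P \<subseteq> {1..CARD('n)}" "R \<subseteq> {1..CARD('n)}" "P \<inter> R = {}"
  shows "vec.span (b ` P) \<inter> vec.span (b ` R) = {0}"
proof -
  have fin: "finite P" "finite R" using finite_subset[OF PR(1)] finite_subset[OF PR(2)] by simp_all
  have "{x + y |x y. x \<in> vec.span (b ` P) \<and> y \<in> vec.span (b ` R)} = vec.span (b ` (P \<union> R))"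
    unfolding image_Un vec.span_Un by simp
  then have "card (P \<union> R) + vec.dim (vec.span (b ` P) \<inter> vec.span (b ` R)) = card P + card R"
    using vec.dim_sums_Int[OF vec.subspace_span vec.subspace_span, of "b ` P" "b ` R"] frame_dim(2)[OF b] PR
    by simp
  then have "vec.dim (vec.span (b ` P) \<inter> vec.span (b ` R)) = 0" using card_Un_disjoint[OF fin PR(3)] by simp
  moreover have "0 \<in> vec.span (b ` P) \<inter> vec.span (b ` R)" by (simp add: vec.span_zero)
  ultimately show ?thesis using vec.dim_eq_0[of "vec.span (b ` P) \<inter> vec.span (b ` R)"] by blast
qed

context pq_form
begin

abbreviation U :: "nat \<Rightarrow> 'n cvec" where
  "U \<equiv> u p q"

abbreviation V :: "nat \<Rightarrow> 'n cvec set" where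
  "V \<equiv> flag_of U"

section \<open>Coordinates of the Iwasawa basis and orthogonality in its flag\<close>

lemma h_e: "k \<in> {1..p+q} \<Longrightarrow> h x (e k) = eta k * x $ idx k"
proof -
  assume k: "k \<in> {1..p+q}"
  have "h x (e k) = (\<Sum>j\<in>UNIV. if j = idx k then eta (rk j) * x $ j else 0)"
    unfolding herm_eta by (rule sum.cong) (auto simp: e_nth)
  also have "\<dots> = eta k * x $ idx k" using rk_idx[of k, where 'n='n] k card_n by simp
  finally show ?thesis .
qed

lemma e_idx: "k \<in> {1..p+q} \<Longrightarrow> l \<in> {1..p+q} \<Longrightarrow> (e k :: 'n cvec) $ idx l = (if k = l then 1 else 0)"
  using idx_eq_iff[of l k, where 'n='n] card_n by (auto simp: e_nth)

lemma vec_eqI: "(\<And>l. l \<in> {1..p+q} \<Longrightarrow> x $ idx l = y $ idx l) \<Longrightarrow> x = (y :: 'n cvec)"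
  using rk_range[where 'n='n] card_n idx_rk by (metis vec_eq_iff)

lemma h_e_e: "k \<in> {1..p+q} \<Longrightarrow> l \<in> {1..p+q} \<Longrightarrow> h (e k) (e l) = (if k = l then eta k else 0)"
  by (simp add: h_e e_idx)

lemma J_e: "k \<in> {1..p+q} \<Longrightarrow> J *v e k = eta k *s e k"
  using rk_idx[of k, where 'n='n] card_n by (auto simp: vec_eq_iff J_nth e_nth)

lemma U_small: "i \<le> q \<Longrightarrow> U i = e i + e (2*q - i + 1)"
  by (simp add: u_def)

lemma U_mid: "q < i \<Longrightarrow> i \<le> p \<Longrightarrow> U i = e (q + i)"
  by (simp add: u_def)

lemma U_large: "1 \<le> i \<Longrightarrow> i \<le> q \<Longrightarrow> U (p + q - i + 1) = e i - e (2*q - i + 1)"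
proof -
  assume i: "1 \<le> i" "i \<le> q"
  have "\<not> p + q - i + 1 \<le> q" "\<not> p + q - i + 1 \<le> p" "p + q - (p + q - i + 1) + 1 = i" using i q_le_p by arith+
  then show ?thesis unfolding u_def Let_def by (simp only: if_False)
qed

lemma U_small_coord:
  assumes "i \<in> {1..q}" "l \<in> {1..p+q}" 
  shows "U i $ idx l = (if l = i \<or> l = 2*q - i + 1 then 1 else 0)"
proof -
  have "i \<in> {1..p+q}" "2*q - i + 1 \<in> {1..p+q}" "i \<noteq> 2*q - i + 1" "i \<le> q" using assms q_le_p by auto
  then show ?thesis using assms(2) by (simp only: U_small vector_add_component e_idx) auto
qed

lemma U_large_coord:
  assumes "i \<in> {1..q}" "l \<in> {1..p+q}" 
  shows "U (p + q - i + 1) $ idx l = (if l = i then 1 else if l = 2*q - i + 1 then -1 else 0)"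
proof -
  have "i \<in> {1..p+q}" "2*q - i + 1 \<in> {1..p+q}" "i \<noteq> 2*q - i + 1" "1 \<le> i" "i \<le> q" using assms q_le_p by auto
  then show ?thesis using assms(2) by (simp only: U_large vector_minus_component e_idx) auto
qed

lemma U_mid_coord:
  assumes "i \<in> {q+1..p}" "l \<in> {1..p+q}" 
  shows "U i $ idx l = (if l = q + i then 1 else 0)"
proof -
  have "q + i \<in> {1..p+q}" "q < i" "i \<le> p" using assms by auto
  then show ?thesis using assms(2) by (simp only: U_mid e_idx) auto
qed

lemma index_cases:
  assumes "k \<in> {1..p+q}"
  obtains i where "i \<in> {1..q}" "k = i" | i where "i \<in> {q+1..p}" "k = i" | i where "i \<in> {1..q}" "k = p + q - i + 1"
proof (cases "k \<le> q")
  case True then show ?thesis using that(1)[of k] assms by auto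
next
  case False
  show ?thesis
  proof (cases "k \<le> p")
    case True then show ?thesis using that(2)[of k] assms False by auto
  next
    case False
    then have "p + q - k + 1 \<in> {1..q}" "k = p + q - (p + q - k + 1) + 1" using assms by auto
    then show ?thesis using that(3) by blast
  qed
qed

lemma frame_U: "frame U"
proof (rule frame_if_span)
  let ?S = "vec.span (U ` {1..CARD('n)})"
  have inS: "U k \<in> ?S" if "k \<in> {1..p+q}" for k using that card_n by (intro vec.span_base) auto
  have pair: "e i \<in> ?S \<and> e (2*q - i + 1) \<in> ?S" if i: "i \<in> {1..q}" for i
  proof -
    have a: "U i \<in> ?S" "U (p + q - i + 1) \<in> ?S" using inS i q_le_p by auto
    have "e i = (1/2) *s (U i + U (p + q - i + 1))" "e (2*q - i + 1) = (1/2) *s (U i - U (p + q - i + 1))"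
    proof -
      have i': "1 \<le> i" "i \<le> q" using i by auto
      show "e i = (1/2) *s (U i + U (p + q - i + 1))" "e (2*q - i + 1) = (1/2) *s (U i - U (p + q - i + 1))"
        unfolding U_small[OF i'(2)] U_large[OF i'] vec_eq_iff by simp_all
    qed
    then show ?thesis using a by (simp add: vec.span_add vec.span_diff vec.span_scale)
  qed
  have "e k \<in> ?S" if k: "k \<in> {1..p+q}" for k
  proof -
    consider "k \<in> {1..q}" | "2*q - k + 1 \<in> {1..q}" "k = 2*q - (2*q - k + 1) + 1" | "k - q \<in> {q+1..p}" "k = q + (k - q)"
      using k by fastforce
    then show ?thesis
    proof cases
      case 3
      then have "U (k - q) = e k" using U_mid[of "k - q"] by auto
      then show ?thesis using inS[of "k - q"] 3 by auto
    qed (use pair in metis)+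
  qed
  then have "e ` {1..CARD('n)} \<subseteq> ?S" using card_n by auto
  then have "vec.span (e ` {1..CARD('n)}) \<subseteq> ?S" by (rule vec.span_minimal) simp
  then show "?S = UNIV" using frame_span[OF frame_e[where 'n='n]] by auto
qed

lemma h_U_small: "i \<in> {1..q} \<Longrightarrow> h x (U i) = x $ idx (2*q - i + 1) - x $ idx i"
proof -
  assume i: "i \<in> {1..q}"
  have m: "i \<in> {1..p+q}" "2*q - i + 1 \<in> {1..p+q}" "i \<le> q" "\<not> 2*q - i + 1 \<le> q" using i q_le_p by auto
  show ?thesis unfolding U_small[OF m(3)] h_add_right h_e[OF m(1)] h_e[OF m(2)] eta_def using m(3,4) by simp
qed

lemma V_coord:
  assumes x: "x \<in> V m" and l: "l \<in> {1..p+q}" and z: "\<And>i. i \<in> {1..m} \<Longrightarrow> U i $ idx l = 0" shows "x $ idx l = 0"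
proof -
  have "vec.subspace {x :: 'n cvec. x $ idx l = 0}" by (auto simp: vec.subspace_def)
  then have "V m \<subseteq> {x. x $ idx l = 0}" unfolding flag_of_def by (rule vec.span_minimal[rotated]) (use z in auto)
  then show ?thesis using x by blast
qed

text \<open>For \<open>k\<close> up to \<open>q\<close>, the product with \<open>U k\<close> is the
  difference of the coordinates \<open>2 q - k + 1\<close> and \<open>k\<close>. These coincide in
  every basis vector \<open>U j\<close> except \<open>U (n - k + 1)\<close>, and the latter is
  excluded by the bound on \<open>k + j\<close>.\<close>

lemma V_orthogonal:
  assumes x: "x \<in> V i" and y: "y \<in> V (p + q - i)" and i: "i \<le> q" shows "h x y = 0"
proof -
  have UU: "h (U k) (U j) = 0" if k: "k \<in> {1..q}" and j: "j \<in> {1..p+q}" "k + j \<le> p + q" for j k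
  proof -
    have kk: "k \<in> {1..p+q}" "2*q - k + 1 \<in> {1..p+q}" using k q_le_p by auto
    have "U j $ idx (2*q - k + 1) = U j $ idx k"
      using j(1)
    proof (cases rule: index_cases)
      case (1 m)
      then show ?thesis unfolding 1(2) U_small_coord[OF 1(1) kk(1)] U_small_coord[OF 1(1) kk(2)] using k by auto
    next
      case (2 m)
      then show ?thesis unfolding 2(2) U_mid_coord[OF 2(1) kk(1)] U_mid_coord[OF 2(1) kk(2)] using k by auto
    next
      case (3 m)
      then have "m \<noteq> k" using j(2) k q_le_p by auto
      then show ?thesis unfolding 3(2) U_large_coord[OF 3(1) kk(1)] U_large_coord[OF 3(1) kk(2)] using 3(1) k by auto
    qed
    then have "h (U j) (U k) = 0" by (simp only: h_U_small[OF k] diff_self)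
    then show ?thesis by (simp add: h_eq_0_sym)
  qed
  show ?thesis
    using x unfolding flag_of_def
  proof (rule h_span_0)
    fix z assume "z \<in> U ` {1..i}"
    then obtain k where k: "k \<in> {1..i}" "z = U k" by blast
    show "h z y = 0"
      using y unfolding flag_of_def
    proof (rule h_span_0')
      fix z' assume "z' \<in> U ` {1..p+q-i}"
      then obtain j where j: "j \<in> {1..p+q-i}" "z' = U j" by blast
      show "h z z' = 0" unfolding k(2) j(2) by (rule UU) (use k j i in auto)
    qed
  qed
qed

lemma V_isotropic: "x \<in> V i \<Longrightarrow> y \<in> V i \<Longrightarrow> i \<le> q \<Longrightarrow> h x y = 0"
proof -
  assume a: "x \<in> V i" "y \<in> V i" "i \<le> q"
  have "i \<le> p + q - i" using a(3) q_le_p by linarith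
  then have "y \<in> V (p + q - i)" using a(2) flag_of_mono[of i "p + q - i" U] by blast
  then show ?thesis using V_orthogonal a(1,3) by blast
qed

text \<open>The flag of \<open>b\<close> has relative position \<open>w\<close> to the reference
  flag \<open>V\<close>: each \<open>b k\<close> is a combination of the \<open>U j\<close> with
  leading term \<open>U (w k)\<close>. This describes the orbits of \<open>B_I p q\<close> by
  frames, without mentioning the group.\<close>

definition relpos :: "(nat \<Rightarrow> nat) \<Rightarrow> (nat \<Rightarrow> 'n cvec) \<Rightarrow> bool" where
  "relpos w b \<longleftrightarrow> (\<forall>k\<in>{1..p+q}. b k \<in> V (w k) - V (w k - 1))"

definition cell :: "(nat \<Rightarrow> nat) \<Rightarrow> 'n flag set" where
  "cell w = {flag_of b | b. relpos w b}"

lemma relpos_frame: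
  assumes w: "w permutes {1..p+q}" and b: "relpos w b"
  shows "frame (\<lambda>i. b (inv w i))" "flag_of (\<lambda>i. b (inv w i)) = V" "frame b"
proof -
  let ?d = "\<lambda>i. b (inv w i)"
  have iw: "w (inv w i) = i" for i using permutes_inverses(1)[OF w] .
  have "inv w i \<in> {1..p+q}" if "i \<in> {1..p+q}" for i using permutes_in_image[OF permutes_inv[OF w]] that by blast
  then have d: "?d i \<in> V i - V (i - 1)" if "i \<in> {1..CARD('n)}" for i
    using b that unfolding relpos_def card_n by (metis iw)
  show f: "frame ?d" and "flag_of ?d = V" using triangular_frame[OF frame_U d] by auto
  have "inv w ` {1..p+q} = {1..p+q}" using permutes_image[OF permutes_inv[OF w]] .
  then have "?d ` {1..CARD('n)} = b ` {1..CARD('n)}" unfolding card_n by (metis image_image)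
  then show "frame b" using frame_span[OF f] by (intro frame_if_span) simp
qed

lemma orbit_B_I:
  assumes w: "w permutes {1..p+q}"
  shows "orbit (B_I p q) (flag_of (U \<circ> w)) = cell w"
proof (intro equalityI subsetI)
  fix F assume "F \<in> orbit (B_I p q) (flag_of (U \<circ> w))"
  then obtain g where g: "det g = 1" "act g V = V" "F = act g (flag_of (U \<circ> w))" by (auto simp: orbit_def B_I_def SL_def)
  have gV: "(*v) g ` V i = V i" for i using g(2) unfolding act_def by (rule fun_cong)
  have gU: "g *v U i \<in> V i - V (i - 1)" if i: "i \<in> {1..p+q}" for i
  proof
    have "U i \<in> V i" using i by (intro flag_of_base) auto
    then show "g *v U i \<in> V i" using gV[of i] by blast
    show "g *v U i \<notin> V (i - 1)"
    proof
      assume "g *v U i \<in> V (i - 1)"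
      then obtain y where y: "y \<in> V (i - 1)" "g *v U i = g *v y" using gV[of "i-1"] by blast
      have "g *v (U i - y) = 0" using y(2) by (simp add: vec.diff)
      moreover have "det g \<noteq> 0" using g(1) by simp
      ultimately have "U i - y = 0" using kernel_det by blast
      then show False using y(1) frame_notin[OF frame_U, of i] i card_n by auto
    qed
  qed
  have "relpos w (\<lambda>k. g *v U (w k))"
    unfolding relpos_def using gU permutes_in_image[OF w] by blast
  moreover have "F = flag_of (\<lambda>k. g *v U (w k))" unfolding g(3) act_flag_of by (simp add: o_def)
  ultimately show "F \<in> cell w" unfolding cell_def by blast
next
  fix F assume "F \<in> cell w"
  then obtain b where b: "relpos w b" "F = flag_of b" by (auto simp: cell_def)
  let ?d = "\<lambda>i. b (inv w i)"
  note fd = relpos_frame[OF w b(1)]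
  have wi: "inv w (w i) = i" for i using permutes_inverses(2)[OF w] .
  have dU: "det (mat_of U) \<noteq> 0" and dd: "det (mat_of ?d) \<noteq> 0" using frame_U fd(1) frame_iff_det by blast+
  obtain C where C: "C ** mat_of U = mat 1" "mat_of U ** C = mat 1"
    using dU unfolding invertible_det_nz[symmetric] invertible_def by blast
  \<comment> \<open>The factor that brings the determinant of \<open>g\<close> to 1; flags do not
    notice it.\<close>
  define r where "r = rescale (det (mat_of U) / det (mat_of ?d))"
  have rn: "r k \<noteq> 0" for k using dU dd by (simp add: r_def rescale_def)
  let ?d' = "\<lambda>i. r i *s ?d i"
  define g where "g = mat_of ?d' ** C"
  have gm: "g ** mat_of U = mat_of ?d'" by (simp add: g_def matrix_mul_assoc[symmetric] C)
  have "det g * det (mat_of U) = det (mat_of ?d')" using arg_cong[OF gm, of det] by (simp add: det_mul)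
  also have "\<dots> = det (mat_of U)" unfolding det_mat_of_scale r_def prod_rescale using dd by simp
  finally have "det g = 1" using dU by simp
  have gU: "g *v U k = ?d' k" if "k \<in> {1..p+q}" for k
    using mat_of_mult_e[of k U] mat_of_mult_e[of k ?d'] gm that card_n by (metis matrix_vector_mul_assoc)
  have "act g V = flag_of ?d'"
    unfolding act_flag_of using \<open>det g = 1\<close> gU card_n by (intro flag_of_cong frame_mult frame_U) auto
  also have "\<dots> = V" using flag_of_scale[OF fd(1), of r] rn fd(2) by simp
  finally have gB: "g \<in> B_I p q" using \<open>det g = 1\<close> by (simp add: B_I_def SL_def)
  have "act g (flag_of (U \<circ> w)) = flag_of (\<lambda>k. r (w k) *s b k)"
    unfolding act_flag_of
  proof (rule flag_of_cong[symmetric])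
    show "frame (\<lambda>k. r (w k) *s b k)" by (rule frame_scale[OF fd(3)]) (rule rn)
    fix k assume "k \<in> {1..CARD('n)}"
    then have "w k \<in> {1..p+q}" using permutes_in_image[OF w] card_n by simp
    then show "r (w k) *s b k = g *v (U \<circ> w) k" using gU by (simp add: wi)
  qed
  also have "\<dots> = F" unfolding b(2) by (rule flag_of_scale[OF fd(3)]) (rule rn)
  finally show "F \<in> orbit (B_I p q) (flag_of (U \<circ> w))" unfolding orbit_def using gB by blast
qed

text \<open>\<open>m k\<close> is the first level at which \<open>V\<close> meets \<open>F k\<close>
  outside \<open>F (k - 1)\<close>. If two levels \<open>k < l\<close> had the same value, the
  leading terms of \<open>b k\<close> and \<open>b l\<close> could be cancelled, and the result
  would reach \<open>F l\<close> from a smaller subspace of \<open>V\<close>.\<close>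

lemma bruhat:
  assumes F: "F \<in> flags"
  shows "\<exists>w. w permutes {1..p+q} \<and> F \<in> cell w"
proof -
  obtain b0 where b0: "frame b0" "F = flag_of b0" using F flags_frame by blast
  let ?P = "\<lambda>k i. \<exists>x. x \<in> F k \<and> x \<in> V i \<and> x \<notin> F (k - 1)"
  define m where "m = (\<lambda>k. LEAST i. ?P k i)"
  have Vn: "V (p + q) = UNIV" using flag_of_full[OF frame_U] card_n by simp
  have ex: "?P k (p + q)" if "k \<in> {1..p+q}" for k
    using frame_notin[OF b0(1), of k] flag_of_base[of k k b0] that card_n b0(2) Vn by auto
  have Pm: "?P k (m k)" if "k \<in> {1..p+q}" for k unfolding m_def by (rule LeastI) (rule ex[OF that])
  have mle: "m k \<le> p + q" if "k \<in> {1..p+q}" for k unfolding m_def by (rule Least_le) (rule ex[OF that])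
  have sub0: "0 \<in> F k" for k unfolding b0(2) by (rule vec.subspace_0[OF subspace_flag_of])
  have m1: "1 \<le> m k" if "k \<in> {1..p+q}" for k
  proof (rule ccontr)
    assume "\<not> 1 \<le> m k"
    then have "m k = 0" by simp
    then show False using Pm[OF that] sub0 by auto
  qed
  have "\<forall>k. \<exists>x. k \<in> {1..p+q} \<longrightarrow> x \<in> F k \<and> x \<in> V (m k) \<and> x \<notin> F (k - 1)" using Pm by blast
  then obtain b where b: "\<And>k. k \<in> {1..p+q} \<Longrightarrow> b k \<in> F k" "\<And>k. k \<in> {1..p+q} \<Longrightarrow> b k \<in> V (m k)"
    "\<And>k. k \<in> {1..p+q} \<Longrightarrow> b k \<notin> F (k - 1)" using choice by metis
  have nV: "b k \<notin> V (m k - 1)" if k: "k \<in> {1..p+q}" for k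
  proof
    assume "b k \<in> V (m k - 1)"
    then have "?P k (m k - 1)" using b(1,3)[OF k] by blast
    then have "m k \<le> m k - 1" unfolding m_def by (rule Least_le)
    then show False using m1[OF k] by simp
  qed
  have Fmono: "i \<le> j \<Longrightarrow> F i \<subseteq> F j" for i j unfolding b0(2) by (rule flag_of_mono)
  have inj: False if kl: "k \<in> {1..p+q}" "l \<in> {1..p+q}" "k < l" "m k = m l" for k l
  proof -
    obtain c d where c: "b k - c *s U (m l) \<in> V (m l - 1)" and d: "b l - d *s U (m l) \<in> V (m l - 1)"
      using b(2)[OF kl(1)] b(2)[OF kl(2)] flag_of_step[OF m1[OF kl(2)], of _ U] kl(4) by auto
    have "c \<noteq> 0" using c nV[OF kl(1)] kl(4) by auto
    let ?y = "b l - (d / c) *s b k"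
    have "?y = (b l - d *s U (m l)) - (d / c) *s (b k - c *s U (m l))"
      using \<open>c \<noteq> 0\<close> by (simp add: vec.scale_right_diff_distrib)
    then have yV: "?y \<in> V (m l - 1)" using c d by (simp only: vec.subspace_diff[OF subspace_flag_of] vec.subspace_scale[OF subspace_flag_of])
    have "k \<le> l - 1" using kl(3) by arith
    then have bk: "b k \<in> F (l - 1)" using b(1)[OF kl(1)] Fmono[of k "l - 1"] by blast
    then have "b k \<in> F l" using Fmono[of "l - 1" l] by auto
    then have yF: "?y \<in> F l" using b(1)[OF kl(2)] unfolding b0(2)
      by (intro vec.subspace_diff[OF subspace_flag_of] vec.subspace_scale[OF subspace_flag_of])
    have "?y \<in> F (l - 1)"
    proof (rule ccontr)
      assume "?y \<notin> F (l - 1)"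
      then have "?P l (m l - 1)" using yV yF by blast
      then have "m l \<le> m l - 1" unfolding m_def by (rule Least_le)
      then show False using m1[OF kl(2)] by simp
    qed
    then have "?y + (d / c) *s b k \<in> F (l - 1)" using bk unfolding b0(2)
      by (intro vec.subspace_add[OF subspace_flag_of] vec.subspace_scale[OF subspace_flag_of])
    then show False using b(3)[OF kl(2)] by simp
  qed
  define w where "w = (\<lambda>k. if k \<in> {1..p+q} then m k else k)"
  have "inj_on w {1..p+q}"
  proof (rule linorder_inj_onI)
    fix k l :: nat assume "k < l" "k \<in> {1..p+q}" "l \<in> {1..p+q}"
    then show "w k \<noteq> w l" using inj[of k l] by (auto simp: w_def)
  qed auto
  moreover have "w ` {1..p+q} \<subseteq> {1..p+q}" using m1 mle by (auto simp: w_def)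
  ultimately have "w ` {1..p+q} = {1..p+q}" by (intro endo_inj_surj) auto
  then have "bij_betw w {1..p+q} {1..p+q}" using \<open>inj_on w {1..p+q}\<close> by (simp add: bij_betw_def)
  then have "w permutes {1..p+q}" by (rule bij_imp_permutes) (unfold w_def, rule if_not_P)
  moreover have "relpos w b" unfolding relpos_def using b(2) nV by (simp add: w_def)
  moreover have "F = flag_of b"
    unfolding b0(2) by (rule triangular_frame(2)[OF b0(1), symmetric]) (use b(1,3) b0(2) card_n in auto)
  ultimately show ?thesis unfolding cell_def by blast
qed

text \<open>Suppose that among the first \<open>k\<close> letters those up to \<open>j\<close>
  outnumber those from \<open>n - j + 1\<close> on. The \<open>b l\<close> at the former span a
  subspace of \<open>V j\<close> too large to be separated by the products with the
  \<open>b l\<close> at the latter, so some nonzero \<open>x\<close> in it is orthogonal to these.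
  The remaining \<open>b l\<close> of the prefix lie in \<open>V (n - j)\<close>, which is
  orthogonal to \<open>V j\<close>. Hence \<open>x\<close> is in the radical of the subspace at
  level \<open>k\<close>, which is nondegenerate.\<close>

lemma nondegenerate_ballot:
  assumes w: "w permutes {1..p+q}" and b: "relpos w b" and c: "oframe c s" and eq: "flag_of b = flag_of c"
  shows "ballot (p+q) q 1 w"
  unfolding ballot_def
proof (intro ballI allI impI, rule ccontr)
  fix j k assume j: "j \<in> {1..q}" and k: "k \<le> p + q" and "\<not> cnt w k {1..j} \<le> cnt w k {p+q-j+1..p+q-1+1}"
  then have lt: "cnt w k {p+q-j+1..p+q} < cnt w k {1..j}" using q_pos by simp
  let ?A = "{l \<in> {1..k}. w l \<in> {1..j}}" and ?B = "{l \<in> {1..k}. w l \<in> {p+q-j+1..p+q}}"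
  \<comment> \<open>The vectors \<open>e l\<close> only serve to bundle the products into one linear
    map, so that a comparison of dimensions gives a kernel vector.\<close>
  define f where "f = (\<lambda>x. \<Sum>l\<in>?B. h x (b l) *s (e l :: 'n cvec))"
  let ?S = "vec.span (b ` ?A)"
  have lin: "Vector_Spaces.linear (*s) (*s) f"
    by (simp add: Vector_Spaces.linear_def module_hom_def module_hom_axioms_def vec.vector_space_axioms vec.module_axioms
        f_def h_linear vec.scale_left_distrib sum.distrib vec.scale_sum_right)
  have dS: "vec.dim ?S = card ?A" by (rule frame_dim(2)[OF relpos_frame(3)[OF w b]]) (use k card_n in auto)
  have "f ` ?S \<subseteq> vec.span (e ` ?B)"
    unfolding f_def by (rule image_subsetI) (intro vec.span_sum vec.span_scale vec.span_base imageI)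
  then have "vec.dim (f ` ?S) \<le> card (e ` ?B :: 'n cvec set)" by (rule vec.dim_le_card) simp
  also have "\<dots> \<le> card ?B" by (rule card_image_le) simp
  also have "\<dots> < vec.dim ?S" using lt dS by (simp add: cnt_def)
  finally have "vec.dim (f ` ?S) \<noteq> vec.dim ?S" by simp
  then have "\<not> inj_on f ?S" using vec.dim_image_eq[OF lin, of ?S] by (auto simp: vec.span_span)
  then obtain x0 x1 where x01: "x0 \<in> ?S" "x1 \<in> ?S" "f x0 = f x1" "x0 \<noteq> x1" unfolding inj_on_def by blast
  define x where "x = x0 - x1"
  have xS: "x \<in> ?S" unfolding x_def using x01 by (intro vec.span_diff)
  have fx: "f x = 0" using x01(3) unfolding f_def x_def by (simp add: h_linear vec.scale_left_diff_distrib sum_subtractf)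
  have hB: "h x (b l) = 0" if l: "l \<in> ?B" for l
  proof -
    have "f x $ idx l = (\<Sum>m\<in>?B. if m = l then h x (b l) else 0)"
      unfolding f_def sum_component by (rule sum.cong) (use l k e_idx in auto)
    then show ?thesis using fx l by simp
  qed
  have "?S \<subseteq> V j"
  proof (intro vec.span_minimal subspace_flag_of subsetI)
    fix z assume "z \<in> b ` ?A"
    then obtain l where l: "l \<in> ?A" "z = b l" by blast
    then have "b l \<in> V (w l)" using b k unfolding relpos_def by auto
    then show "z \<in> V j" using l flag_of_mono[of "w l" j U] by auto
  qed
  then have xV: "x \<in> V j" using xS by blast
  have hb: "h x (b l) = 0" if l: "l \<in> {1..k}" for l
  proof (cases "l \<in> ?B")
    case False
    have "w l \<le> p + q" using permutes_range[OF w, of l] l k by simp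
    then have "w l \<le> p + q - j" using False l by auto
    moreover have "b l \<in> V (w l)" using b l k unfolding relpos_def by auto
    ultimately have "b l \<in> V (p + q - j)" using flag_of_mono[of "w l" "p+q-j" U] by auto
    then show ?thesis using V_orthogonal[OF xV] j by simp
  qed (rule hB)
  have xF: "x \<in> flag_of c k"
  proof -
    have "?S \<subseteq> flag_of b k" unfolding flag_of_def by (intro vec.span_mono image_mono) auto
    then show ?thesis using xS eq by auto
  qed
  have "h x (c l) = 0" if l: "l \<in> {1..p+q}" for l
  proof (cases "l \<le> k")
    case True
    then have "c l \<in> flag_of b k" unfolding eq using l by (intro flag_of_base) auto
    then show ?thesis unfolding flag_of_def by (rule h_span_0') (use hb in auto)
  next
    case False
    then show ?thesis using oframe_flag[OF c k, of x] xF l by auto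
  qed
  then have "x = 0" using oframe_expand[OF c, of x] by simp
  then show False using x01(4) by (simp add: x_def)
qed

text \<open>Semicontinuity of intersections with \<open>V i\<close>. At \<open>F\<close>, the
  vectors \<open>b0 l\<close> with \<open>l\<close> up to \<open>k\<close> and
  \<open>v l > i\<close> are independent modulo \<open>V i\<close>, and this persists for nearby
  flags. So the level \<open>k\<close> of a nearby flag meets \<open>V i\<close> in dimension at
  most \<open>cnt v k {1..i}\<close>, whereas a flag in \<open>cell w\<close> meets it in dimension
  at least \<open>cnt w k {1..i}\<close>.\<close>

lemma closure_dominance:
  assumes w: "w permutes {1..p+q}" and v: "v permutes {1..p+q}" 
    and F: "F \<in> flag_topology closure_of cell w" "F \<in> cell v" and i: "i \<le> p + q" and k: "k \<le> p + q"
  shows "cnt w k {1..i} \<le> cnt v k {1..i}"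
proof (rule ccontr)
  assume "\<not> ?thesis"
  then have lt: "cnt v k {1..i} < cnt w k {1..i}" by simp
  obtain b0 where b0: "relpos v b0" "F = flag_of b0" using F(2) by (auto simp: cell_def)
  note f0 = relpos_frame(3)[OF v b0(1)]
  \<comment> \<open>Only the vectors that are independent modulo \<open>V i\<close> are replaced by
    columns of \<open>g\<close>; the others keep \<open>V i\<close> spanned by members of the
    frame.\<close>
  define T where "T = (\<lambda>(g :: 'n cmat) l. if l \<le> k \<and> i < v l then g *v e l else b0 l)"
  let ?W = "{g :: 'n cmat. det g \<noteq> 0} \<inter> {g. det (mat_of (T g) :: 'n cmat) \<noteq> 0}"
  have "open {g. det (mat_of (T g) :: 'n cmat) \<noteq> 0}"
  proof (intro open_Collect_neq continuous_on_const continuous_on_det)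
    fix a b :: 'n
    show "continuous_on UNIV (\<lambda>g. (mat_of (T g) :: 'n cmat) $ a $ b)"
      by (cases "rk b \<le> k \<and> i < v (rk b)") (auto simp: mat_of_def T_def matrix_vector_mult_def intro!: continuous_intros)
  qed
  then have oW: "open ?W" by (intro open_Int open_det_nz)
  let ?M = "mat_of b0 :: 'n cmat"
  have "det ?M \<noteq> 0" using f0 frame_iff_det by blast
  moreover have "mat_of (T ?M) = ?M"
    using mat_of_mult_e[of _ b0] rk_range by (auto simp: mat_of_def[of "T _"] T_def vec_eq_iff) (auto simp: mat_of_def)
  ultimately have MW: "?M \<in> ?W" by simp
  have op: "openin flag_topology ((\<lambda>g. act g std_flag) ` ?W)" by (rule openin_image_std_flag[OF oW]) simp
  have FW: "F \<in> (\<lambda>g. act g std_flag) ` ?W" using MW act_mat_of[OF f0] b0(2) by (metis image_eqI)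
  have "\<forall>T. F \<in> T \<and> openin flag_topology T \<longrightarrow> (\<exists>y. y \<in> cell w \<and> y \<in> T)"
    using F(1) unfolding in_closure_of by (rule conjunct2)
  then have "\<exists>y. y \<in> cell w \<and> y \<in> (\<lambda>g. act g std_flag) ` ?W" using conjI[OF FW op] by (elim allE impE)
  then obtain F' where F': "F' \<in> cell w" "F' \<in> (\<lambda>g. act g std_flag) ` ?W" by (elim exE conjE)
  obtain b where b: "relpos w b" "F' = flag_of b" using F'(1) by (auto simp: cell_def)
  obtain g where g: "det g \<noteq> 0" "det (mat_of (T g) :: 'n cmat) \<noteq> 0" "F' = act g std_flag" using F'(2) by auto
  note fb = relpos_frame(3)[OF w b(1)]
  have fT: "frame (T g)" using g(2) frame_iff_det by blast
  let ?P = "{l \<in> {1..k}. i < v l}" and ?R = "{l \<in> {1..p+q}. v l \<le> i}" and ?Q = "{l \<in> {1..k}. w l \<in> {1..i}}"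
  have TR: "T g ` ?R = b0 ` ?R" by (rule image_cong) (auto simp: T_def)
  have spR: "vec.span (T g ` ?R) = V i"
  proof (rule vec.subspace_dim_equal)
    show "vec.span (T g ` ?R) \<subseteq> V i"
    proof (intro vec.span_minimal subspace_flag_of subsetI)
      fix z assume "z \<in> T g ` ?R"
      then obtain l where l: "l \<in> ?R" "z = b0 l" unfolding TR by blast
      then have "b0 l \<in> V (v l)" using b0(1) unfolding relpos_def by auto
      then show "z \<in> V i" using l flag_of_mono[of "v l" i U] by auto
    qed
    have "bij_betw v ?R {1..i}"
      unfolding bij_betw_def
    proof
      show "inj_on v ?R" using permutes_inj_eq[OF v] by (auto simp: inj_on_def)
      show "v ` ?R = {1..i}"
      proof (intro equalityI subsetI)
        fix x assume "x \<in> {1..i}"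
        then obtain l where "1 \<le> l" "l \<le> p + q" "v l = x" using permutes_surj_interval[OF v, of x] i by auto
        then show "x \<in> v ` ?R" using \<open>x \<in> {1..i}\<close> by (intro image_eqI[of _ _ l]) auto
      next
        fix x assume "x \<in> v ` ?R"
        then show "x \<in> {1..i}" using permutes_range[OF v] by auto
      qed
    qed
    then have "card ?R = i" using bij_betw_same_card by fastforce
    moreover have "vec.dim (vec.span (T g ` ?R)) = card ?R" by (rule frame_dim(2)[OF fT]) (use card_n in auto)
    moreover have "vec.dim (V i) = i" using dim_flag_of[OF frame_U, of i] i card_n by simp
    ultimately show "vec.dim (V i) \<le> vec.dim (vec.span (T g ` ?R))" by (simp only: order_refl)
  qed (auto simp: subspace_flag_of)
  have disj: "vec.span (T g ` ?P) \<inter> V i = {0}"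
    unfolding spR[symmetric] by (rule frame_disjoint[OF fT]) (use k card_n in auto)
  have spQ: "vec.span (b ` ?Q) \<subseteq> V i"
  proof (intro vec.span_minimal subspace_flag_of subsetI)
    fix z assume "z \<in> b ` ?Q"
    then obtain l where l: "l \<in> ?Q" "z = b l" by blast
    then have "b l \<in> V (w l)" using b(1) k unfolding relpos_def by auto
    then show "z \<in> V i" using l flag_of_mono[of "w l" i U] by auto
  qed
  have int: "vec.span (T g ` ?P) \<inter> vec.span (b ` ?Q) = {0}"
  proof
    show "vec.span (T g ` ?P) \<inter> vec.span (b ` ?Q) \<subseteq> {0}" using disj spQ by blast
    show "{0} \<subseteq> vec.span (T g ` ?P) \<inter> vec.span (b ` ?Q)" by (simp add: vec.span_zero)
  qed
  have dP: "vec.dim (vec.span (T g ` ?P)) = card ?P" by (rule frame_dim(2)[OF fT]) (use k card_n in auto)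
  have dQ: "vec.dim (vec.span (b ` ?Q)) = card ?Q" by (rule frame_dim(2)[OF fb]) (use k card_n in auto)
  have d0: "vec.dim {0 :: 'n cvec} = 0" by simp
  have d: "vec.dim {x + y |x y. x \<in> vec.span (T g ` ?P) \<and> y \<in> vec.span (b ` ?Q)} = card ?P + card ?Q"
    using vec.dim_sums_Int[OF vec.subspace_span vec.subspace_span, of "T g ` ?P" "b ` ?Q"]
    unfolding int dP dQ d0 by (simp only: add_0_right)
  have F'k: "flag_of b k = flag_of (\<lambda>l. g *v e l) k" using b(2) g(3) by (simp add: act_std_flag)
  have sub: "{x + y |x y. x \<in> vec.span (T g ` ?P) \<and> y \<in> vec.span (b ` ?Q)} \<subseteq> flag_of b k"
  proof -
    have "vec.span (T g ` ?P) \<subseteq> flag_of b k" unfolding F'k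
    proof (intro vec.span_minimal subspace_flag_of subsetI)
      fix z assume "z \<in> T g ` ?P"
      then obtain l where l: "l \<in> ?P" "z = g *v e l" by (auto simp: T_def)
      then show "z \<in> flag_of (\<lambda>l. g *v e l) k" by (auto intro: flag_of_base)
    qed
    moreover have "vec.span (b ` ?Q) \<subseteq> flag_of b k" unfolding flag_of_def by (intro vec.span_mono image_mono) auto
    ultimately show ?thesis using vec.subspace_add[OF subspace_flag_of] by blast
  qed
  have "vec.dim (flag_of b k) = k" using dim_flag_of[OF fb, of k] k card_n by simp
  then have "card ?P + card ?Q \<le> k" using vec.dim_subset[OF sub] unfolding d by (simp only:)
  moreover have "card ?P + cnt v k {1..i} = k"
  proof -
    have "card ?P + card {l \<in> {1..k}. v l \<in> {1..i}} = card (?P \<union> {l \<in> {1..k}. v l \<in> {1..i}})"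
      by (rule card_Un_disjoint[symmetric]) auto
    also have "?P \<union> {l \<in> {1..k}. v l \<in> {1..i}} = {1..k}" using permutes_range[OF v] k by (auto simp: not_le)
    finally show ?thesis by (simp add: cnt_def)
  qed
  ultimately show False using lt by (simp add: cnt_def)
qed

end

section \<open>Intersections with open orbits and base cycles\<close>

lemma gamma_arith:
  assumes "1 \<le> q" "q \<le> p"
  shows "v \<in> {1..p+q} \<Longrightarrow> \<gamma> p q v \<in> {1..p+q}" "inj_on (\<gamma> p q) {1..p+q}"
    "i \<in> {1..q} \<Longrightarrow> \<gamma> p q i = i" "i \<in> {1..q} \<Longrightarrow> \<gamma> p q (p + q - i + 1) = 2 * q - i + 1" 
    "i \<in> {q+1..p} \<Longrightarrow> \<gamma> p q i = q + i"
  using assms by (auto simp: \<gamma>_def inj_on_def)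

text \<open>Closed form of the product of the transpositions for \<open>i\<close> in
  \<open>I\<close>, acting on letters. The guard \<open>v \<le> n\<close> is there because truncated
  subtraction would give the mirror image 1 to every larger \<open>v\<close>.\<close>

definition swp :: "nat \<Rightarrow> nat set \<Rightarrow> nat \<Rightarrow> nat" where
  "swp n I v = (if v \<in> I \<or> v \<le> n \<and> n - v + 1 \<in> I then n - v + 1 else v)"

lemma swp_range: "v \<in> {1..n} \<Longrightarrow> swp n I v \<in> {1..n}"
  by (auto simp: swp_def)

lemma swp_swp: "v \<in> {1..n} \<Longrightarrow> swp n I (swp n I v) = v"
  by (auto simp: swp_def)

lemma swp_simps:
  assumes "I \<subseteq> {1..q}" "1 \<le> q" "q \<le> p"
  shows "i \<in> {1..q} \<Longrightarrow> swp (p+q) I i = (if i \<in> I then p + q - i + 1 else i)"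
    "i \<in> {1..q} \<Longrightarrow> swp (p+q) I (p + q - i + 1) = (if i \<in> I then i else p + q - i + 1)"
    "v \<in> {q+1..p} \<Longrightarrow> swp (p+q) I v = v"
proof -
  have I: "j \<in> I \<Longrightarrow> 1 \<le> j \<and> j \<le> q" for j using assms(1) by auto
  show "i \<in> {1..q} \<Longrightarrow> swp (p+q) I i = (if i \<in> I then p + q - i + 1 else i)"
    using I[of "p + q - i + 1"] assms by (auto simp: swp_def)
  show "swp (p+q) I (p + q - i + 1) = (if i \<in> I then i else p + q - i + 1)" if i: "i \<in> {1..q}"
  proof -
    have 1: "p + q - (p + q - i + 1) + 1 = i" "p + q - i + 1 \<le> p + q" using i assms by auto
    have 2: "p + q - i + 1 \<notin> I" using I[of "p + q - i + 1"] i assms by auto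
    show ?thesis unfolding swp_def 1(1) using 1(2) 2 by (simp only: simp_thms)
  qed
  show "v \<in> {q+1..p} \<Longrightarrow> swp (p+q) I v = v"
    using I[of "p + q - v + 1"] I[of v] by (auto simp: swp_def)
qed

lemma swp_insert:
  assumes "i \<in> {1..q}" "i \<notin> I" "I \<subseteq> {1..q}" "q \<le> p"
  shows "Transposition.transpose (p + q - i + 1) i \<circ> swp (p+q) I = swp (p+q) (insert i I)"
proof
  fix v
  have I: "j \<in> I \<Longrightarrow> 1 \<le> j \<and> j \<le> q \<and> j \<noteq> i" for j using assms by auto
  have n: "p + q - i + 1 \<notin> I" using I[of "p + q - i + 1"] assms by auto
  consider "v = i" | "v = p + q - i + 1" | "v \<noteq> i" "v \<noteq> p + q - i + 1" by blast
  then show "(Transposition.transpose (p + q - i + 1) i \<circ> swp (p+q) I) v = swp (p+q) (insert i I) v"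
  proof cases
    case 1
    then have "swp (p+q) I v = i" using assms n by (simp add: swp_def)
    then show ?thesis using 1 by (simp add: swp_def)
  next
    case 2
    have e: "p + q - (p + q - i + 1) + 1 = i" "p + q - i + 1 \<le> p + q" using assms by auto
    have "swp (p+q) I v = p + q - i + 1" unfolding 2 swp_def e(1) using n assms(2) by (simp only: simp_thms if_False)
    moreover have "swp (p+q) (insert i I) v = i" unfolding 2 swp_def e(1) using e(2) by simp
    ultimately show ?thesis by simp
  next
    case 3
    have "swp (p+q) I v \<noteq> i" "swp (p+q) I v \<noteq> p + q - i + 1"
      using 3 I[of v] I[of "p + q - v + 1"] assms by (auto simp: swp_def)
    moreover have "swp (p+q) (insert i I) v = swp (p+q) I v"
    proof -
      have "v \<le> p + q \<Longrightarrow> p + q - v + 1 \<noteq> i" using 3(2) assms(1) by (cases "v = 0") auto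
      then show ?thesis using 3(1) by (auto simp: swp_def)
    qed
    ultimately show ?thesis by (simp add: Transposition.transpose_def)
  qed
qed

lemma foldr_swp:
  assumes "q \<le> p" "distinct is" "set is \<subseteq> {1..q}"
  shows "foldr (\<lambda>i. (\<circ>) (Transposition.transpose (p + q - i + 1) i)) is w = swp (p+q) (set is) \<circ> w"
  using assms(2,3)
proof (induction "is")
  case Nil
  then show ?case by (simp add: swp_def fun_eq_iff)
next
  case (Cons i "is")
  have IH: "foldr (\<lambda>i. (\<circ>) (Transposition.transpose (p + q - i + 1) i)) is w = swp (p+q) (set is) \<circ> w"
    by (rule Cons.IH) (use Cons.prems in auto)
  have "foldr (\<lambda>i. (\<circ>) (Transposition.transpose (p + q - i + 1) i)) (i # is) w
      = Transposition.transpose (p + q - i + 1) i \<circ> (swp (p+q) (set is) \<circ> w)"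
    by (simp only: foldr.simps o_apply IH)
  also have "\<dots> = (Transposition.transpose (p + q - i + 1) i \<circ> swp (p+q) (set is)) \<circ> w"
    by (rule comp_assoc[symmetric])
  also have "Transposition.transpose (p + q - i + 1) i \<circ> swp (p+q) (set is) = swp (p+q) (insert i (set is))"
    by (rule swp_insert[OF _ _ _ assms(1)]) (use Cons.prems in auto)
  finally show ?case by (simp only: list.set)
qed

lemma Perm_swp:
  assumes "q \<le> p" shows "Perm p q w = {\<gamma> p q \<circ> (swp (p+q) I \<circ> w) | I. I \<subseteq> {1..q}}"
proof (intro equalityI subsetI)
  fix v assume "v \<in> Perm p q w"
  then obtain xs where xs: "distinct xs" "set xs \<subseteq> {1..q}"
    "v = \<gamma>_I p q (foldr (\<lambda>i. (\<circ>) (Transposition.transpose (p + q - i + 1) i)) xs w)" unfolding Perm_def by blast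
  have "v = \<gamma> p q \<circ> (swp (p+q) (set xs) \<circ> w)"
    unfolding xs(3) \<gamma>_I_def foldr_swp[OF assms xs(1,2)] by (rule refl)
  then show "v \<in> {\<gamma> p q \<circ> (swp (p+q) I \<circ> w) | I. I \<subseteq> {1..q}}" using xs(2) by blast
next
  fix v assume "v \<in> {\<gamma> p q \<circ> (swp (p+q) I \<circ> w) | I. I \<subseteq> {1..q}}"
  then obtain I where I: "I \<subseteq> {1..q}" "v = \<gamma> p q \<circ> (swp (p+q) I \<circ> w)" by blast
  obtain xs where xs: "set xs = I" "distinct xs" using finite_distinct_list[of I] finite_subset[OF I(1)] by auto
  have sub: "set xs \<subseteq> {1..q}" using xs(1) I(1) by simp
  have "v = \<gamma>_I p q (foldr (\<lambda>i. (\<circ>) (Transposition.transpose (p + q - i + 1) i)) xs w)"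
    unfolding \<gamma>_I_def foldr_swp[OF assms xs(2) sub] xs(1) I(2) by (rule refl)
  then show "v \<in> Perm p q w" unfolding Perm_def using xs I(1) by blast
qed

section \<open>A fixed strictly pairing word: hyperbolic planes and signs\<close>

locale strict_word = pq_form p q ty for p q :: nat and ty :: "'n::{finite,linorder} itself" +
  fixes w :: "nat \<Rightarrow> nat"
  assumes w: "w permutes {1..p+q}" and pr: "\<forall>i\<in>{1..q}. paired (p+q) w i" and mid: "middle_increasing p q w"
begin

definition pa :: "nat \<Rightarrow> nat" where "pa i = inv w (p + q - i + 1)"
definition pb :: "nat \<Rightarrow> nat" where "pb i = inv w i"

lemma w_pa: "w (pa i) = p + q - i + 1" and w_pb: "w (pb i) = i"
  using permutes_inverses(1)[OF w] by (simp_all add: pa_def pb_def)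

lemma pa_w: "w k = p + q - i + 1 \<Longrightarrow> k = pa i" and pb_w: "w k = i \<Longrightarrow> k = pb i"
  using permutes_inverses(2)[OF w, of k] by (simp_all only: pa_def pb_def)

lemma pos:
  assumes "i \<in> {1..q}"
  shows "1 \<le> pa i" "pa i < pb i" "pb i \<le> p + q" "pa i < c \<Longrightarrow> c < pb i \<Longrightarrow> w c < i \<or> p + q - i + 1 < w c"
proof -
  have "paired (p+q) w i" using pr assms by blast
  then obtain a b where ab: "1 \<le> a" "a < b" "b \<le> p + q" "w a = p + q - i + 1" "w b = i" 
    "\<forall>c. a < c \<and> c < b \<longrightarrow> w c < i \<or> p + q - i + 1 < w c"
    unfolding paired_def by (elim exE conjE)
  have e: "a = pa i" "b = pb i" using pa_w[OF ab(4)] pb_w[OF ab(5)] by simp_all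
  show "1 \<le> pa i" "pa i < pb i" "pb i \<le> p + q" "pa i < c \<Longrightarrow> c < pb i \<Longrightarrow> w c < i \<or> p + q - i + 1 < w c"
    using ab unfolding e by simp_all
qed

lemma pos_range: "i \<in> {1..q} \<Longrightarrow> pa i \<in> {1..p+q} \<and> pb i \<in> {1..p+q}"
  using pos[of i] by auto

lemma pos_distinct:
  assumes "i \<in> {1..q}" "j \<in> {1..q}" 
  shows "pa i = pa j \<longleftrightarrow> i = j" "pb i = pb j \<longleftrightarrow> i = j" "pa i \<noteq> pb j" "pb i \<noteq> pa j"
proof -
  have "w (pa i) = w (pa j) \<Longrightarrow> i = j" "w (pb i) = w (pb j) \<Longrightarrow> i = j" "w (pa i) \<noteq> w (pb j)" "w (pb i) \<noteq> w (pa j)"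
    unfolding w_pa w_pb using assms q_le_p by auto
  then show "pa i = pa j \<longleftrightarrow> i = j" "pb i = pb j \<longleftrightarrow> i = j" "pa i \<noteq> pb j" "pb i \<noteq> pa j" by metis+
qed

lemma pos_cases:
  assumes "k \<in> {1..p+q}"
  shows "(\<exists>i\<in>{1..q}. k = pa i) \<or> (\<exists>i\<in>{1..q}. k = pb i) \<or> w k \<in> {q+1..p}"
proof -
  have "w k \<in> {1..p+q}" using permutes_in_image[OF w] assms by blast
  then show ?thesis
  proof (cases rule: index_cases)
    case (1 i) then show ?thesis using pb_w by blast
  next
    case (2 i) then show ?thesis by blast
  next
    case (3 i) then show ?thesis using pa_w by blast
  qed
qed

text \<open>\<open>y\<close> is \<open>b (pb i)\<close> corrected by the isotropic vectors of the
  earlier pairs so as to be orthogonal to all \<open>c (pb j)\<close>; isotropy of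
  \<open>V i\<close> then makes it orthogonal to the \<open>c (pa j)\<close> too. At inner positions
  before \<open>pa i\<close> the vector \<open>b k\<close> lies in \<open>V (n - i)\<close>,
  orthogonal to \<open>y\<close>, which inductively removes the component along \<open>c k\<close>.
  What remains is an isotropic vector in the plane of \<open>c (pa i)\<close> and
  \<open>c (pb i)\<close>, so the signs are opposite and both coefficients are nonzero.\<close>

lemma hyperbolic_pairs:
  assumes b: "relpos w b" and c: "oframe c s" and eq: "flag_of b = flag_of c"
  shows "i \<in> {1..q} \<Longrightarrow> \<exists>x \<alpha> \<beta>. x \<in> V i \<and> x \<notin> V (i - 1) \<and> x = \<alpha> *s c (pa i) + \<beta> *s c (pb i) \<and>
    \<alpha> \<noteq> 0 \<and> \<beta> \<noteq> 0 \<and> s (pa i) = - s (pb i)"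
proof (induction i rule: less_induct)
  case (less i)
  note i = less.prems
  note fb = relpos_frame(3)[OF w b]
  have "\<forall>j. \<exists>x \<alpha> \<beta>. j \<in> {1..<i} \<longrightarrow> x \<in> V j \<and> x = \<alpha> *s c (pa j) + \<beta> *s c (pb j) \<and> \<alpha> \<noteq> 0 \<and> \<beta> \<noteq> 0"
  proof
    fix j show "\<exists>x \<alpha> \<beta>. j \<in> {1..<i} \<longrightarrow> x \<in> V j \<and> x = \<alpha> *s c (pa j) + \<beta> *s c (pb j) \<and> \<alpha> \<noteq> 0 \<and> \<beta> \<noteq> 0"
      using less.IH[of j] i by (cases "j \<in> {1..<i}") auto
  qed
  then obtain X A B where XAB: "\<forall>j. j \<in> {1..<i} \<longrightarrow> X j \<in> V j \<and> X j = A j *s c (pa j) + B j *s c (pb j) \<and> A j \<noteq> 0 \<and> B j \<noteq> (0::complex)"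
    by metis
  have XV: "X j \<in> V j" and Xeq: "X j = A j *s c (pa j) + B j *s c (pb j)" and A0: "A j \<noteq> 0" and B0: "B j \<noteq> 0" 
    if "j \<in> {1..<i}" for j using XAB that by blast+
  have jq: "j \<in> {1..q}" if "j \<in> {1..<i}" for j using that i by auto
  have pri: "pa i \<in> {1..p+q}" "pb i \<in> {1..p+q}" using pos_range[OF i] by auto
  define y0 where "y0 = b (pb i)"
  have y0V: "y0 \<in> V i" "y0 \<notin> V (i - 1)"
    using b pri(2) unfolding relpos_def y0_def by (metis Diff_iff w_pb)+
  have y0F: "y0 \<in> flag_of c (pb i)" unfolding y0_def eq[symmetric] by (intro flag_of_base) (use pri in auto)
  \<comment> \<open>The denominator is \<open>h (X j) (c (pb j))\<close>, so subtracting
    \<open>t j\<close> times \<open>X j\<close> removes the product of \<open>y0\<close> with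
    \<open>c (pb j)\<close>.\<close>
  define t where "t = (\<lambda>j. h y0 (c (pb j)) / (B j * s (pb j)))"
  define y where "y = y0 - (\<Sum>j\<in>{1..<i}. t j *s X j)"
  have sumV: "(\<Sum>j\<in>{1..<i}. t j *s X j) \<in> V (i - 1)"
  proof (intro vec.subspace_sum subspace_flag_of vec.subspace_scale)
    fix j assume j: "j \<in> {1..<i}"
    then have "j \<le> i - 1" by auto
    then show "X j \<in> V (i - 1)" using XV[OF j] flag_of_mono[of j "i-1" U] by blast
  qed
  have yV': "y \<notin> V (i - 1)"
  proof
    assume "y \<in> V (i - 1)"
    then have "y + (\<Sum>j\<in>{1..<i}. t j *s X j) \<in> V (i - 1)" using sumV by (rule vec.subspace_add[OF subspace_flag_of])
    then show False using y0V(2) by (simp add: y_def)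
  qed
  have "(\<Sum>j\<in>{1..<i}. t j *s X j) \<in> V i" using sumV flag_of_mono[of "i-1" i U] by auto
  then have yV: "y \<in> V i" unfolding y_def using y0V(1) by (intro vec.subspace_diff[OF subspace_flag_of])
  have cc: "h (c k) (c l) = (if k = l then s k else 0)" if "k \<in> {1..p+q}" "l \<in> {1..p+q}" for k l
    using oframe_h[OF c that] .
  have hX: "h (X j) (c (pb l)) = (if j = l then B l * s (pb l) else 0)" if j: "j \<in> {1..<i}" and l: "l \<in> {1..<i}" for j l
  proof -
    have r: "pa j \<in> {1..p+q}" "pb j \<in> {1..p+q}" "pb l \<in> {1..p+q}" using pos_range[OF jq[OF j]] pos_range[OF jq[OF l]] by auto
    have d: "pa j \<noteq> pb l" "(pb j = pb l) = (j = l)" using pos_distinct[OF jq[OF j] jq[OF l]] by auto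
    show ?thesis unfolding Xeq[OF j] h_add_left h_scale_left cc[OF r(1,3)] cc[OF r(2,3)] using d by auto
  qed
  have hpb: "h y (c (pb l)) = 0" if l: "l \<in> {1..<i}" for l
  proof -
    have "(\<Sum>j\<in>{1..<i}. t j * h (X j) (c (pb l))) = (\<Sum>j\<in>{1..<i}. if j = l then t l * (B l * s (pb l)) else 0)"
      by (rule sum.cong) (use hX[OF _ l] in auto)
    also have "\<dots> = t l * (B l * s (pb l))" using l by simp
    also have "\<dots> = h y0 (c (pb l))" using B0[OF l] oframe_nz[OF c, of "pb l"] pos_range[OF jq[OF l]] by (simp add: t_def)
    finally show ?thesis by (simp add: y_def h_diff_left h_sum_left h_scale_left)
  qed
  have yF: "y \<in> flag_of c (pb i)"
    unfolding y_def
  proof (intro vec.subspace_diff vec.subspace_sum subspace_flag_of y0F)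
    fix j assume j: "j \<in> {1..<i}"
    have r: "pa j \<in> {1..p+q}" "pb j \<in> {1..p+q}" using pos_range[OF jq[OF j]] by auto
    \<comment> \<open>If the pair \<open>j\<close> ends after \<open>pb i\<close>, its coefficient
      is 0 because \<open>y0\<close> lies in the subspace at level \<open>pb i\<close>.\<close>
    show "t j *s X j \<in> flag_of c (pb i)"
    proof (cases "pb j \<le> pb i")
      case True
      have "pa j \<le> pb i" using pos(2)[OF jq[OF j]] True by simp
      then show ?thesis unfolding Xeq[OF j]
        using True r by (intro vec.subspace_scale vec.subspace_add subspace_flag_of flag_of_base) auto
    next
      case False
      then have "h y0 (c (pb j)) = 0" using oframe_flag[OF c, of "pb i" y0] y0F r pri by auto
      then show ?thesis using vec.subspace_0[OF subspace_flag_of] by (simp add: t_def)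
    qed
  qed
  have iq: "i \<le> q" using i by simp
  have hpa: "h y (c (pa l)) = 0" if l: "l \<in> {1..<i}" for l
  proof -
    have "X l \<in> V i" using XV[OF l] flag_of_mono[of l i U] l by auto
    then have "h y (X l) = 0" using V_isotropic[OF yV _ iq] by blast
    then have "cnj (A l) * h y (c (pa l)) = 0" unfolding Xeq[OF l] h_add_right h_scale_right hpb[OF l] by simp
    then show ?thesis using A0[OF l] by simp
  qed
  have zero: "k \<in> {1..p+q} \<Longrightarrow> k \<noteq> pa i \<Longrightarrow> k \<noteq> pb i \<Longrightarrow> h y (c k) = 0" for k
  proof (induction k rule: less_induct)
    case (less k)
    note k = less.prems
    have wk: "w k \<in> {1..p+q}" using permutes_in_image[OF w] k(1) by blast
    consider "pb i < k" | "w k < i" | "p + q - i + 1 < w k" | "k < pb i" "i \<le> w k" "w k \<le> p + q - i + 1"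
      using k(3) by linarith
    then show ?case
    proof cases
      case 1
      then show ?thesis using oframe_flag[OF c, of "pb i" y] yF pri k(1) by auto
    next
      case 2
      then show ?thesis using hpb[of "w k"] pb_w[of k "w k"] wk by auto
    next
      case 3
      then have "p + q - w k + 1 \<in> {1..<i}" "w k = p + q - (p + q - w k + 1) + 1" using wk by auto
      then show ?thesis using hpa pa_w by metis
    next
      case 4
      have "w k \<noteq> i" "w k \<noteq> p + q - i + 1" using k(2,3) pb_w pa_w by blast+
      then have wk': "w k \<le> p + q - i" using 4 by linarith
      \<comment> \<open>Strict pairing: no inner letter stands between the two entries of the pair
        \<open>i\<close>.\<close>
      have "k < pa i" using pos(4)[OF i, of k] 4 k(2) by linarith
      then have IH: "h y (c m) = 0" if "m \<in> {1..<k}" for m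
        using less.IH[of m] that k(1) pos(2)[OF i] by auto
      have "b k \<in> V (w k)" using b k(1) unfolding relpos_def by blast
      then have "b k \<in> V (p + q - i)" using flag_of_mono[OF wk', of U] by blast
      then have "h y (b k) = 0" using V_orthogonal[OF yV _ iq] by blast
      moreover have bF: "b k \<in> flag_of c k" unfolding eq[symmetric] by (intro flag_of_base) (use k(1) in auto)
      have "h y (b k) = (\<Sum>m=1..p+q. cnj (s m * h (b k) (c m)) * h y (c m))"
        by (subst oframe_expand[OF c, of "b k"]) (simp only: h_sum_right h_scale_right)
      also have "\<dots> = (\<Sum>m=1..p+q. if m = k then cnj (s k * h (b k) (c k)) * h y (c k) else 0)"
      proof (rule sum.cong)
        fix m assume m: "m \<in> {1..p+q}"
        show "cnj (s m * h (b k) (c m)) * h y (c m) = (if m = k then cnj (s k * h (b k) (c k)) * h y (c k) else 0)"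
        proof (cases "m < k")
          case True then show ?thesis using IH[of m] m by simp
        next
          case False
          then show ?thesis using oframe_flag[OF c, of k "b k"] bF m k(1) by (cases "m = k") auto
        qed
      qed simp
      also have "\<dots> = cnj (s k * h (b k) (c k)) * h y (c k)" using k(1) by simp
      finally have "cnj (s k * h (b k) (c k)) * h y (c k) = 0" using \<open>h y (b k) = 0\<close> by simp
      moreover have "h (b k) (c k) \<noteq> 0"
      proof
        assume z: "h (b k) (c k) = 0"
        have "h (b k) (c m) = 0" if "m \<in> {(k - 1)+1..p+q}" for m
          using oframe_flag[OF c, of k "b k"] bF z that k(1) by (cases "m = k") auto
        then have "b k \<in> flag_of c (k - 1)" using oframe_flag[OF c, of "k - 1" "b k"] k(1) by auto
        then show False unfolding eq[symmetric] using frame_notin[OF fb, of k] k(1) card_n by simp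
      qed
      ultimately show ?thesis using oframe_nz[OF c k(1)] by simp
    qed
  qed
  define \<alpha> \<beta> where "\<alpha> = s (pa i) * h y (c (pa i))" and "\<beta> = s (pb i) * h y (c (pb i))"
  have ne: "pa i \<noteq> pb i" using pos(2)[OF i] by simp
  have "y = (\<Sum>k=1..p+q. (s k * h y (c k)) *s c k)" by (rule oframe_expand[OF c])
  also have "\<dots> = (\<Sum>k\<in>{pa i, pb i}. (s k * h y (c k)) *s c k)"
    by (rule sum.mono_neutral_right) (use zero pri in auto)
  finally have yeq: "y = \<alpha> *s c (pa i) + \<beta> *s c (pb i)" using ne by (simp add: \<alpha>_def \<beta>_def)
  have "h y y = 0" using V_isotropic[OF yV yV iq] .
  then have "\<alpha> * cnj \<alpha> * s (pa i) + \<beta> * cnj \<beta> * s (pb i) = 0"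
    unfolding yeq h_add_left h_add_right h_scale_left h_scale_right cc[OF pri(1) pri(1)] cc[OF pri(1) pri(2)] cc[OF pri(2) pri(1)] cc[OF pri(2) pri(2)]
    using ne by (simp add: mult_ac)
  then have n: "of_real ((cmod \<alpha>)\<^sup>2) * s (pa i) + of_real ((cmod \<beta>)\<^sup>2) * s (pb i) = 0"
    unfolding complex_norm_square .
  have "y \<noteq> 0" using yV' vec.subspace_0[OF subspace_flag_of, of U "i - 1"] by metis
  have sa: "s (pa i) = 1 \<or> s (pa i) = -1" and sb: "s (pb i) = 1 \<or> s (pb i) = -1"
    using oframe_sign[OF c] pri by auto
  have nz: "\<alpha> \<noteq> 0 \<or> \<beta> \<noteq> 0" using yeq \<open>y \<noteq> 0\<close> by auto
  have "s (pa i) \<noteq> s (pb i)"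
  proof
    assume e: "s (pa i) = s (pb i)"
    then have "(of_real ((cmod \<alpha>)\<^sup>2) + of_real ((cmod \<beta>)\<^sup>2)) * s (pb i) = 0" using n by (simp add: distrib_right)
    then have "(of_real ((cmod \<alpha>)\<^sup>2) + of_real ((cmod \<beta>)\<^sup>2) :: complex) = 0" using sb by auto
    then have "(cmod \<alpha>)\<^sup>2 + (cmod \<beta>)\<^sup>2 = 0" by (simp only: of_real_add[symmetric] of_real_eq_0_iff)
    then show False using nz by (simp add: sum_power2_eq_zero_iff)
  qed
  then have opp: "s (pa i) = - s (pb i)" using sa sb by auto
  have "(of_real ((cmod \<alpha>)\<^sup>2) - of_real ((cmod \<beta>)\<^sup>2)) * s (pa i) = 0" using n unfolding opp by (simp add: left_diff_distrib)
  then have "(of_real ((cmod \<alpha>)\<^sup>2) - of_real ((cmod \<beta>)\<^sup>2) :: complex) = 0" using sa by auto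
  then have "(cmod \<alpha>)\<^sup>2 - (cmod \<beta>)\<^sup>2 = 0" by (simp only: of_real_diff[symmetric] of_real_eq_0_iff)
  then have "\<alpha> \<noteq> 0" "\<beta> \<noteq> 0" using nz by auto
  then show ?case using yV yV' yeq opp by (intro exI[of _ y] exI[of _ \<alpha>] exI[of _ \<beta>] conjI)
qed

lemma pair_sign:
  assumes "relpos w b" "oframe c s" "flag_of b = flag_of c" "i \<in> {1..q}" shows "s (pb i) = - s (pa i)"
  using hyperbolic_pairs[OF assms] by auto

text \<open>\<open>V i\<close> is spanned by the vectors of \<open>hyperbolic_pairs\<close> for the
  pairs up to \<open>i\<close>, which are combinations of frame vectors other than
  \<open>c k\<close>.\<close>

lemma middle_perp:
  assumes b: "relpos w b" and c: "oframe c s" and eq: "flag_of b = flag_of c"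
    and k: "k \<in> {1..p+q}" "w k \<in> {q+1..p}"
  shows "i \<le> q \<Longrightarrow> v \<in> V i \<Longrightarrow> h v (c k) = 0"
proof (induction i arbitrary: v)
  case 0 then show ?case by simp
next
  case (Suc i)
  have iq: "Suc i \<in> {1..q}" using Suc.prems by simp
  obtain x \<alpha> \<beta> where x: "x \<in> V (Suc i)" "x \<notin> V i" "x = \<alpha> *s c (pa (Suc i)) + \<beta> *s c (pb (Suc i))"
    using hyperbolic_pairs[OF b c eq iq] by auto
  have "pa (Suc i) \<noteq> k" "pb (Suc i) \<noteq> k" using k(2) iq w_pa[of "Suc i"] w_pb[of "Suc i"] q_le_p by auto
  then have hx: "h x (c k) = 0"
    unfolding x(3) using oframe_h[OF c _ k(1), of "pa (Suc i)"] oframe_h[OF c _ k(1), of "pb (Suc i)"] pos_range[OF iq] by (simp add: h_linear)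
  obtain a where a: "x - a *s U (Suc i) \<in> V i" using x(1) flag_of_step[of "Suc i" x U] by auto
  obtain d where d: "v - d *s U (Suc i) \<in> V i" using Suc.prems(2) flag_of_step[of "Suc i" v U] by auto
  have "a \<noteq> 0" using a x(2) by auto
  have "v - (d / a) *s x = (v - d *s U (Suc i)) - (d / a) *s (x - a *s U (Suc i))"
    using \<open>a \<noteq> 0\<close> by (simp add: vec.scale_right_diff_distrib)
  also have "\<dots> \<in> V i" by (rule vec.subspace_diff[OF subspace_flag_of d vec.subspace_scale[OF subspace_flag_of a]])
  finally have "h (v - (d / a) *s x) (c k) = 0" using Suc.IH Suc.prems(1) by simp
  then show ?case using hx by (simp add: h_linear)
qed

text \<open>Orthogonality to \<open>U i\<close> equates the coordinates \<open>i\<close> and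
  \<open>2 q - i + 1\<close> of \<open>c k\<close> for all \<open>i\<close> up to \<open>q\<close>.
  The negative part of its square thus cancels against \<open>q\<close> of the positive terms, taken
  in reverse order, and the rest is nonnegative.\<close>

lemma middle_sign:
  assumes b: "relpos w b" and c: "oframe c s" and eq: "flag_of b = flag_of c"
    and k: "k \<in> {1..p+q}" "w k \<in> {q+1..p}"
  shows "s k = 1"
proof -
  let ?x = "c k"
  have xc: "?x $ idx (2*q - i + 1) = ?x $ idx i" if i: "i \<in> {1..q}" for i
  proof -
    have "U i \<in> V i" using i by (intro flag_of_base) auto
    then have "h (U i) ?x = 0" using middle_perp[OF b c eq k] i by auto
    then have "h ?x (U i) = 0" by (simp only: h_eq_0_sym)
    then show ?thesis unfolding h_U_small[OF i] by simp
  qed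
  have "(\<Sum>i=1..p. ?x $ idx (q + i) * cnj (?x $ idx (q + i)))
      = (\<Sum>i=1..q. ?x $ idx (q + i) * cnj (?x $ idx (q + i))) + (\<Sum>i=q+1..p. ?x $ idx (q + i) * cnj (?x $ idx (q + i)))"
    using sum.ub_add_nat[of 1 q "\<lambda>i. ?x $ idx (q + i) * cnj (?x $ idx (q + i))" "p - q"] q_le_p q_pos by simp
  also have "(\<Sum>i=1..q. ?x $ idx (q + i) * cnj (?x $ idx (q + i))) = (\<Sum>i=1..q. ?x $ idx (q + (q + 1 - i)) * cnj (?x $ idx (q + (q + 1 - i))))"
    by (rule sum.atLeastAtMost_rev)
  also have "\<dots> = (\<Sum>i=1..q. ?x $ idx i * cnj (?x $ idx i))"
  proof (rule sum.cong)
    fix i assume i: "i \<in> {1..q}"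
    then have "q + (q + 1 - i) = 2*q - i + 1" by auto
    then show "?x $ idx (q + (q + 1 - i)) * cnj (?x $ idx (q + (q + 1 - i))) = ?x $ idx i * cnj (?x $ idx i)"
      by (simp only: xc[OF i])
  qed simp
  finally have "h ?x ?x = (\<Sum>i=q+1..p. ?x $ idx (q + i) * cnj (?x $ idx (q + i)))" unfolding herm_def by simp
  also have "\<dots> = of_real (\<Sum>i=q+1..p. (cmod (?x $ idx (q + i)))\<^sup>2)"
    by (simp only: complex_norm_square[symmetric] of_real_sum)
  finally have "Re (h ?x ?x) = (\<Sum>i=q+1..p. (cmod (?x $ idx (q + i)))\<^sup>2)" by (simp only: Re_complex_of_real)
  then have "0 \<le> Re (h ?x ?x)" by (simp add: sum_nonneg)
  then show ?thesis using oframe_h[OF c k(1) k(1)] oframe_sign[OF c k(1)] by auto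
qed

text \<open>\<open>I\<close> is the set of interchanged pairs, so \<open>vv I\<close> runs through
  \<open>Perm p q w\<close>. The vector at \<open>pa i\<close> is negative iff \<open>i\<close> is
  in \<open>I\<close>, which makes \<open>I\<close> visible in the signs.\<close>

definition vv :: "nat set \<Rightarrow> nat \<Rightarrow> nat" where "vv I = \<gamma> p q \<circ> (swp (p+q) I \<circ> w)"

definition sgn_of :: "nat set \<Rightarrow> nat \<Rightarrow> complex" where "sgn_of I k = eta (vv I k)"

lemma vv_simps:
  assumes "I \<subseteq> {1..q}"
  shows "i \<in> {1..q} \<Longrightarrow> vv I (pa i) = (if i \<in> I then i else 2*q - i + 1)"
    "i \<in> {1..q} \<Longrightarrow> vv I (pb i) = (if i \<in> I then 2*q - i + 1 else i)"
    "w k \<in> {q+1..p} \<Longrightarrow> vv I k = q + w k"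
  using swp_simps[OF assms q_pos q_le_p] gamma_arith[OF q_pos q_le_p] by (simp_all add: vv_def w_pa w_pb)

lemma vv_range: "k \<in> {1..p+q} \<Longrightarrow> vv I k \<in> {1..p+q}"
  unfolding vv_def o_def by (intro gamma_arith(1)[OF q_pos q_le_p] swp_range) (simp only: permutes_in_image[OF w])

lemma vv_inj: "k \<in> {1..p+q} \<Longrightarrow> l \<in> {1..p+q} \<Longrightarrow> vv I k = vv I l \<longleftrightarrow> k = l"
proof
  assume kl: "k \<in> {1..p+q}" "l \<in> {1..p+q}" and e: "vv I k = vv I l"
  have r: "w k \<in> {1..p+q}" "w l \<in> {1..p+q}" using kl permutes_in_image[OF w] by blast+
  have "swp (p+q) I (w k) = swp (p+q) I (w l)"
    using e gamma_arith(2)[OF q_pos q_le_p] swp_range[OF r(1)] swp_range[OF r(2)] unfolding vv_def o_def inj_on_def by blast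
  then have "w k = w l" using swp_swp[OF r(1)] swp_swp[OF r(2)] by metis
  then show "k = l" using permutes_inj_eq[OF w] by blast
qed simp

section \<open>Coordinate flags and adapted flags in the cell of \<open>w\<close>\<close>

abbreviation EF :: "nat set \<Rightarrow> 'n flag" where "EF I \<equiv> flag_of (e \<circ> vv I)"

lemma aframe_coord: "aframe (e \<circ> vv I) (sgn_of I)"
  unfolding aframe_def oframe_def o_def
proof (intro conjI ballI)
  fix k assume k: "k \<in> {1..p+q}"
  show "sgn_of I k = 1 \<or> sgn_of I k = -1" by (simp add: sgn_of_def eta_def)
  show "J *v e (vv I k) = sgn_of I k *s e (vv I k)" unfolding sgn_of_def by (rule J_e) (rule vv_range[OF k])
  fix l assume l: "l \<in> {1..p+q}"
  show "h (e (vv I k)) (e (vv I l)) = (if k = l then sgn_of I k else 0)"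
    unfolding h_e_e[OF vv_range[OF k] vv_range[OF l]] vv_inj[OF k l] sgn_of_def by (rule refl)
qed

lemma EF_aflags: "EF I \<in> aflags (sgn_of I)"
  unfolding aflags_def using aframe_coord by blast

text \<open>At \<open>pb i\<close> both \<open>e i\<close> and \<open>e (2 q - i + 1)\<close> have
  occurred, so \<open>U i\<close> is available as a frame vector; at \<open>pa i\<close> either of
  the two has a nonzero component along \<open>U (n - i + 1)\<close>. Hence the relative position is
  \<open>w\<close> for every \<open>I\<close>.\<close>

lemma EF_cell:
  assumes I: "I \<subseteq> {1..q}" shows "EF I \<in> cell w"
proof -
  define b where "b = (\<lambda>k. if w k \<le> q then U (w k) else (e (vv I k) :: 'n cvec))"
  have half: "U i \<in> V (p + q - i)" if i: "i \<in> {1..q}" for i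
    using i q_le_p by (intro flag_of_base) auto
  have big: "e (vv I (pa i)) \<in> V (p + q - i + 1) - V (p + q - i)" if i: "i \<in> {1..q}" for i
  proof -
    have i': "1 \<le> i" "i \<le> q" using i by auto
    let ?n = "p + q - i + 1"
    have "p + q - i + 1 \<le> p + q" using i' q_le_p by linarith
    then have nr: "?n \<in> {1..CARD('n)}" using card_n by simp
    have UnV: "U ?n \<in> V ?n" "U ?n \<notin> V (p + q - i)"
      using frame_notin[OF frame_U nr] by (auto intro!: flag_of_base)
    have UV: "U i \<in> V ?n" using half[OF i] flag_of_mono[of "p + q - i" ?n U] by auto
    \<comment> \<open>Half the sum and half the difference of \<open>U i\<close> and
      \<open>U (n - i + 1)\<close> are \<open>e i\<close> and
      \<open>e (2 q - i + 1)\<close>.\<close>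
    define r :: complex where "r = (if i \<in> I then 1/2 else -1/2)"
    have "e (vv I (pa i)) = (1/2) *s U i + r *s U ?n"
      unfolding vv_simps(1)[OF I i] U_small[OF i'(2)] U_large[OF i'] by (simp add: r_def vec_eq_iff algebra_simps)
    moreover have "(1/2) *s U i + r *s U ?n \<in> V ?n"
      using UnV UV by (intro vec.subspace_add vec.subspace_scale subspace_flag_of)
    moreover have "(1/2) *s U i + r *s U ?n \<notin> V (p + q - i)"
    proof
      assume "(1/2) *s U i + r *s U ?n \<in> V (p + q - i)"
      then have "(1/r) *s (((1/2) *s U i + r *s U ?n) - (1/2) *s U i) \<in> V (p + q - i)"
        using half[OF i] by (intro vec.subspace_diff vec.subspace_scale subspace_flag_of)
      moreover have "r \<noteq> 0" by (simp add: r_def)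
      ultimately show False using UnV(2) by simp
    qed
    ultimately show ?thesis by simp
  qed
  have rb: "relpos w b"
    unfolding relpos_def
  proof
    fix k assume k: "k \<in> {1..p+q}"
    have wk: "w k \<in> {1..p+q}" using permutes_in_image[OF w] k by blast
    have Uk: "U (w k) \<in> V (w k) - V (w k - 1)" using wk frame_notin[OF frame_U, of "w k"] card_n by (auto intro!: flag_of_base)
    show "b k \<in> V (w k) - V (w k - 1)"
      using wk
    proof (cases rule: index_cases)
      case (1 i) then show ?thesis using Uk by (simp add: b_def)
    next
      case (2 i)
      then have "b k = e (q + w k)" using vv_simps(3)[OF I, of k] by (auto simp: b_def)
      also have "\<dots> = U (w k)" using 2 by (simp add: U_mid)
      finally show ?thesis using Uk by simp
    next
      case (3 i)
      have ka: "k = pa i" using pa_w 3(2) by blast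
      have "b k = e (vv I (pa i))" using 3 q_le_p ka by (auto simp: b_def)
      moreover have "w k - 1 = p + q - i" using 3 by simp
      ultimately show ?thesis using big[OF 3(1)] 3(2) by simp
    qed
  qed
  have "flag_of b = EF I"
  proof (rule flag_of_eqI)
    show "frame b" using relpos_frame(3)[OF w rb] .
    show "frame (e \<circ> vv I :: nat \<Rightarrow> 'n cvec)" by (rule oframe_frame[OF aframe_oframe[OF aframe_coord]])
    fix k assume "k \<in> {1..CARD('n)}"
    then have k: "k \<in> {1..p+q}" using card_n by simp
    have base: "e (vv I l) \<in> EF I k" if "1 \<le> l" "l \<le> k" for l using flag_of_base[OF that, of "e \<circ> vv I"] by simp
    show "b k \<in> EF I k"
    proof (cases "w k \<le> q")
      case True
      define i where "i = w k"
      have "w k \<in> {1..p+q}" using permutes_in_image[OF w] k by blast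
      then have i: "i \<in> {1..q}" using True by (simp add: i_def)
      have kp: "k = pb i" by (rule pb_w) (simp add: i_def)
      have "e (vv I (pa i)) \<in> EF I k" "e (vv I (pb i)) \<in> EF I k"
        by (rule base; use pos(1-3)[OF i] kp in linarith)+
      then have e2: "e i \<in> EF I k" "e (2*q - i + 1) \<in> EF I k"
        unfolding vv_simps(1,2)[OF I i] by (cases "i \<in> I"; simp only: if_True if_False)+
      have "b k = U i" using True by (simp add: b_def i_def)
      also have "\<dots> = e i + e (2*q - i + 1)" by (rule U_small) (use i in simp)
      finally show ?thesis using e2 by (simp only: vec.subspace_add[OF subspace_flag_of])
    next
      case False
      then show ?thesis using base[of k] k by (simp add: b_def)
    qed
  qed
  from this[symmetric] rb show ?thesis unfolding cell_def mem_Collect_eq by (intro exI conjI)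
qed

lemma single_coord:
  fixes x :: "'n cvec"
  assumes "m \<in> {1..p+q}" "\<And>l. l \<in> {1..p+q} \<Longrightarrow> l \<noteq> m \<Longrightarrow> x $ idx l = 0" shows "x = (x $ idx m) *s e m"
  by (rule pq_form.vec_eqI[OF pq_form_axioms]) (use assms e_idx[OF assms(1)] in auto)

text \<open>The vector \<open>x\<close> of \<open>hyperbolic_pairs\<close> is supported on the
  coordinates \<open>i\<close> and \<open>2 q - i + 1\<close>: in \<open>V i\<close> only
  coordinates of pairs up to \<open>i\<close> occur, and earlier pairs are excluded by orthogonality
  to their frame vectors. Now \<open>c (pa i)\<close> and \<open>c (pb i)\<close> lie in opposite
  eigenspaces of \<open>J\<close> and have disjoint supports, so nothing cancels in \<open>x\<close>
  and both vanish wherever \<open>x\<close> does. Their signs decide which coordinate belongs to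
  which.\<close>

lemma adapted_pairs:
  assumes b: "relpos w b" and c: "aframe c s" and eq: "flag_of b = flag_of c"
  shows "i \<in> {1..q} \<Longrightarrow> \<exists>\<alpha> \<beta>. \<alpha> \<noteq> 0 \<and> \<beta> \<noteq> 0 \<and> c (pa i) = \<alpha> *s e (if s (pa i) = -1 then i else 2*q - i + 1) \<and>
    c (pb i) = \<beta> *s e (if s (pa i) = -1 then 2*q - i + 1 else i)"
proof (induction i rule: less_induct)
  case (less i)
  note i = less.prems
  note o = aframe_oframe[OF c]
  obtain x \<alpha> \<beta> where x: "x \<in> V i" "x = \<alpha> *s c (pa i) + \<beta> *s c (pb i)" "\<alpha> \<noteq> 0" "\<beta> \<noteq> 0" "s (pa i) = - s (pb i)"
    using hyperbolic_pairs[OF b o eq i] by auto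
  have pri: "pa i \<in> {1..p+q}" "pb i \<in> {1..p+q}" using pos_range[OF i] by auto
  have sgn: "s (pa i) = 1 \<or> s (pa i) = -1" using oframe_sign[OF o pri(1)] .
  have low0: "c (pa i) $ idx l = 0 \<and> c (pb i) $ idx l = 0" if j: "j \<in> {1..<i}" and l: "l = j \<or> l = 2*q - j + 1" for j l
  proof -
    have jq: "j \<in> {1..q}" using j i by auto
    have lr: "l \<in> {1..p+q}" using l jq q_le_p by auto
    obtain \<mu> \<nu> where mn: "\<mu> \<noteq> 0" "\<nu> \<noteq> 0" "c (pa j) = \<mu> *s e (if s (pa j) = -1 then j else 2*q - j + 1)"
      "c (pb j) = \<nu> *s e (if s (pa j) = -1 then 2*q - j + 1 else j)"
      using less.IH[of j] j jq by auto
    obtain m \<tau> where m: "m = pa j \<or> m = pb j" "c m = \<tau> *s e l" "\<tau> \<noteq> 0"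
      using l mn by (cases "s (pa j) = -1") auto
    have mr: "m \<in> {1..p+q}" "m \<noteq> pa i" "m \<noteq> pb i"
      using m(1) pos_range[OF jq] pos_distinct[OF jq i] j by auto
    have "h (c (pa i)) (c m) = 0" "h (c (pb i)) (c m) = 0" using oframe_h[OF o] pri mr by auto
    then have "h (c (pa i)) (e l) = 0" "h (c (pb i)) (e l) = 0" using m(2,3) by (simp_all add: h_scale_right)
    then show ?thesis unfolding h_e[OF lr] by (simp add: eta_def split: if_splits)
  qed
  have xl: "x $ idx l = 0" if l: "l \<in> {1..p+q}" "l \<noteq> i" "l \<noteq> 2*q - i + 1" for l
  proof (cases "\<exists>j\<in>{1..<i}. l = j \<or> l = 2*q - j + 1")
    case True
    then show ?thesis using low0 by (auto simp: x(2))
  next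
    case False
    show ?thesis
    proof (rule V_coord[OF x(1) l(1)])
      fix j assume j: "j \<in> {1..i}"
      then have jq: "j \<in> {1..q}" using i by auto
      have "\<not> (l = j \<or> l = 2*q - j + 1)" using False l(2,3) j by (cases "j = i") auto
      then show "U j $ idx l = 0" unfolding U_small_coord[OF jq l(1)] by simp
    qed
  qed
  have Jc: "eta l * c k $ idx l = s k * c k $ idx l" if "k \<in> {1..p+q}" "l \<in> {1..p+q}" for k l
  proof -
    have "J *v c k = s k *s c k" using c that(1) by (simp add: aframe_def)
    then have "(J *v c k) $ idx l = (s k *s c k) $ idx l" by simp
    then show ?thesis using rk_idx[of l, where 'n='n] that(2) card_n by (simp add: J_nth)
  qed
  have ne: "s (pa i) \<noteq> s (pb i)" using x(5) sgn by auto
  have coord: "c (pa i) $ idx l = 0 \<and> c (pb i) $ idx l = 0" if l: "l \<in> {1..p+q}" "l \<noteq> i" "l \<noteq> 2*q - i + 1" for l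
  proof -
    have z: "\<alpha> * c (pa i) $ idx l + \<beta> * c (pb i) $ idx l = 0" using xl[OF l] by (simp add: x(2))
    show ?thesis
    proof (cases "c (pa i) $ idx l = 0")
      case True then show ?thesis using z x(4) by simp
    next
      case False
      then have "eta l = s (pa i)" using Jc[OF pri(1) l(1)] by simp
      then have "c (pb i) $ idx l = 0" using Jc[OF pri(2) l(1)] ne by auto
      then show ?thesis using z x(3) by simp
    qed
  qed
  have ir: "i \<in> {1..p+q}" "2*q - i + 1 \<in> {1..p+q}" using i q_le_p by auto
  have et: "eta i = -1" "eta (2*q - i + 1) = 1" using i by (auto simp: eta_def)
  have cn: "c (pa i) \<noteq> 0" "c (pb i) \<noteq> 0" using frame_nonzero[OF oframe_frame[OF o]] pri card_n by auto
  show ?case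
  proof (cases "s (pa i) = -1")
    case True
    have sb: "s (pb i) = 1" using x(5) True by simp
    have "c (pa i) $ idx (2*q - i + 1) = 0" using Jc[OF pri(1) ir(2)] et True by simp
    then have 1: "c (pa i) = (c (pa i) $ idx i) *s e i" using coord by (intro single_coord[OF ir(1)]) auto
    have "c (pb i) $ idx i = 0" using Jc[OF pri(2) ir(1)] et sb by simp
    then have 2: "c (pb i) = (c (pb i) $ idx (2*q - i + 1)) *s e (2*q - i + 1)" using coord by (intro single_coord[OF ir(2)]) auto
    have "c (pa i) $ idx i \<noteq> 0" "c (pb i) $ idx (2*q - i + 1) \<noteq> 0" using 1 2 cn by auto
    then show ?thesis using 1 2 True by auto
  next
    case False
    then have sa: "s (pa i) = 1" using sgn by auto
    have "s (pb i) = - s (pa i)" using x(5) by simp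
    then have sb: "s (pb i) = -1" using sa by simp
    have "c (pa i) $ idx i = 0" using Jc[OF pri(1) ir(1)] et sa by simp
    then have 1: "c (pa i) = (c (pa i) $ idx (2*q - i + 1)) *s e (2*q - i + 1)" using coord by (intro single_coord[OF ir(2)]) auto
    have "c (pb i) $ idx (2*q - i + 1) = 0" using Jc[OF pri(2) ir(2)] et sb by simp
    then have 2: "c (pb i) = (c (pb i) $ idx i) *s e i" using coord by (intro single_coord[OF ir(1)]) auto
    have "c (pa i) $ idx (2*q - i + 1) \<noteq> 0" "c (pb i) $ idx i \<noteq> 0" using 1 2 cn by auto
    then show ?thesis using 1 2 False by auto
  qed
qed

lemma adapted_coord:
  assumes b: "relpos w b" and c: "aframe c s" and eq: "flag_of b = flag_of c"
  shows "flag_of c = EF {i \<in> {1..q}. s (pa i) = -1}"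
proof -
  let ?I = "{i \<in> {1..q}. s (pa i) = -1}"
  have I: "?I \<subseteq> {1..q}" by auto
  note o = aframe_oframe[OF c]
  note fc = oframe_frame[OF o]
  have pairs: "\<exists>\<tau>. \<tau> \<noteq> 0 \<and> c (pa i) = \<tau> *s e (vv ?I (pa i))" "\<exists>\<tau>. \<tau> \<noteq> 0 \<and> c (pb i) = \<tau> *s e (vv ?I (pb i))" if i: "i \<in> {1..q}" for i
    using adapted_pairs[OF b c eq i] i unfolding vv_simps(1,2)[OF I i] by auto
  have outer: "\<exists>\<tau>. \<tau> \<noteq> 0 \<and> c k = \<tau> *s e (vv ?I k)" if k: "k \<in> {1..p+q}" "w k \<notin> {q+1..p}" for k
  proof -
    obtain i where i: "i \<in> {1..q}" "k = pa i \<or> k = pb i" using pos_cases[OF k(1)] k(2) by blast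
    from i(2) show ?thesis
    proof
      assume "k = pa i" then show ?thesis using pairs(1)[OF i(1)] by simp
    next
      assume "k = pb i" then show ?thesis using pairs(2)[OF i(1)] by simp
    qed
  qed
  \<comment> \<open>Orthogonality to the frame vectors of the pairs and to earlier middle vectors
    excludes all coordinates but the own one and those of later middle positions.\<close>
  have middle: "k \<in> {1..p+q} \<Longrightarrow> w k \<in> {q+1..p} \<Longrightarrow> \<exists>\<tau>. \<tau> \<noteq> 0 \<and> c k = \<tau> *s e (q + w k)" for k
  proof (induction k rule: less_induct)
    case (less k)
    note k = less.prems
    have perp: "c k $ idx l = 0" if m: "m \<in> {1..p+q}" "m \<noteq> k" and l: "l \<in> {1..p+q}" and cm: "c m = \<tau> *s e l" "\<tau> \<noteq> 0" for m l \<tau>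
    proof -
      have "h (c k) (c m) = 0" using oframe_h[OF o k(1) m(1)] m(2) by simp
      then have "h (c k) (e l) = 0" using cm by (simp add: h_scale_right)
      then show ?thesis unfolding h_e[OF l] by (simp add: eta_def split: if_splits)
    qed
    have "c k $ idx l = 0" if l: "l \<in> {1..p+q}" "l \<noteq> q + w k" for l
    proof -
      obtain m where m: "m \<in> {1..p+q}" "vv ?I m = l"
      proof -
        have "inj_on (vv ?I) {1..p+q}" using vv_inj by (auto simp: inj_on_def)
        moreover have "vv ?I ` {1..p+q} \<subseteq> {1..p+q}" using vv_range by blast
        ultimately have "vv ?I ` {1..p+q} = {1..p+q}" by (intro endo_inj_surj) auto
        then have "l \<in> vv ?I ` {1..p+q}" using l(1) by (simp only:)
        then show ?thesis
        proof (rule imageE)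
          fix m assume "l = vv ?I m" "m \<in> {1..p+q}"
          then show ?thesis using that[of m] by (simp only:)
        qed
      qed
      have mk: "m \<noteq> k" using m(2) l(2) vv_simps(3)[OF I k(2)] by auto
      consider (pair) "\<exists>\<tau>. \<tau> \<noteq> 0 \<and> c m = \<tau> *s e (vv ?I m)" | (mdl) "w m \<in> {q+1..p}"
        using outer[OF m(1)] by blast
      then show ?thesis
      proof cases
        case pair
        then obtain \<tau> where "\<tau> \<noteq> 0" "c m = \<tau> *s e (vv ?I m)" by (elim exE conjE)
        then show ?thesis using perp[OF m(1) mk l(1), of \<tau>] m(2) by simp
      next
        case mdl
        have lm: "l = q + w m" using m(2) vv_simps(3)[OF I mdl] by simp
        show ?thesis
        proof (cases "m < k")
          case True
          then obtain \<tau> where "\<tau> \<noteq> 0" "c m = \<tau> *s e (q + w m)" using less.IH[OF True m(1) mdl] by (elim exE conjE)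
          then show ?thesis using perp[OF m(1) mk l(1), of \<tau>] lm by simp
        next
          case False
          \<comment> \<open>A later middle position carries a larger letter, so its coordinate is
            absent from \<open>V (w k)\<close>, hence from \<open>b k\<close>; it is also absent
            from the earlier vectors of \<open>c\<close>, and \<open>b k\<close> is a nonzero
            multiple of \<open>c k\<close> modulo these.\<close>
          then have "k < m" using mk by simp
          then have lt: "w k < w m" using mid[unfolded middle_increasing_def, rule_format, of k m] k m(1) mdl by simp
          have "b k \<in> V (w k)" using b k(1) unfolding relpos_def by blast
          then have bz: "b k $ idx l = 0"
          proof (rule V_coord[OF _ l(1)])
            fix j assume "j \<in> {1..w k}"
            then consider "j \<in> {1..q}" | "j \<in> {q+1..p}" using k(2) by fastforce
            then show "U j $ idx l = 0"
            proof cases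
              case 1
              then show ?thesis unfolding U_small_coord[OF 1 l(1)] unfolding lm using mdl by auto
            next
              case 2
              then show ?thesis unfolding U_mid_coord[OF 2 l(1)] unfolding lm using \<open>j \<in> {1..w k}\<close> lt by auto
            qed
          qed
          have bF: "b k \<in> flag_of c k" unfolding eq[symmetric] by (intro flag_of_base) (use k(1) in auto)
          then obtain a where a: "b k - a *s c k \<in> flag_of c (k - 1)" using flag_of_step[of k "b k" c] k(1) by auto
          have "a \<noteq> 0"
          proof
            assume "a = 0"
            then have "b k \<in> flag_of b (k - 1)" using a eq by simp
            then show False using frame_notin[OF relpos_frame(3)[OF w b], of k] k(1) card_n by simp
          qed
          have "flag_of c (k - 1) \<subseteq> {x. x $ idx l = 0}"
            unfolding flag_of_def
          proof (rule vec.span_minimal)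
            show "vec.subspace {x :: 'n cvec. x $ idx l = 0}" by (auto simp: vec.subspace_def)
            show "c ` {1..k-1} \<subseteq> {x. x $ idx l = 0}"
            proof
              fix z assume "z \<in> c ` {1..k-1}"
              then obtain r where r: "r \<in> {1..k-1}" "z = c r" by blast
              have rr: "r \<in> {1..p+q}" "r < k" using r(1) k(1) by auto
              have "\<exists>\<tau>. c r = \<tau> *s e (vv ?I r)"
              proof (cases "w r \<in> {q+1..p}")
                case True
                then show ?thesis using less.IH[OF rr(2,1) True] vv_simps(3)[OF I True] by auto
              next
                case False
                show ?thesis using outer[OF rr(1) False] by (elim exE conjE) (rule exI)
              qed
              then obtain \<tau> where t: "c r = \<tau> *s e (vv ?I r)" by (elim exE)
              have "vv ?I r \<noteq> l" using vv_inj[OF rr(1) m(1), of ?I] m(2) rr(2) \<open>k < m\<close> by auto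
              then show "z \<in> {x. x $ idx l = 0}" unfolding r(2) t using e_idx[OF vv_range[OF rr(1)] l(1)] by simp
            qed
          qed
          then have "b k - a *s c k \<in> {x. x $ idx l = 0}" using a by (rule subsetD)
          then have "(b k - a *s c k) $ idx l = 0" by (simp only: mem_Collect_eq)
          then show ?thesis using bz \<open>a \<noteq> 0\<close> by simp
        qed
      qed
    qed
    then have ck: "c k = (c k $ idx (q + w k)) *s e (q + w k)" using k(2) by (intro single_coord) auto
    have cn: "c k \<noteq> 0" using frame_nonzero[OF fc, of k] k(1) card_n by simp
    have "c k $ idx (q + w k) \<noteq> 0"
    proof
      assume z: "c k $ idx (q + w k) = 0"
      have "c k = 0" by (subst ck, subst z) simp
      then show False using cn by simp
    qed
    then show ?case using ck by (intro exI conjI)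
  qed
  have "\<forall>k. \<exists>\<tau>. k \<in> {1..p+q} \<longrightarrow> \<tau> \<noteq> 0 \<and> c k = \<tau> *s e (vv ?I k)"
  proof
    fix k
    show "\<exists>\<tau>. k \<in> {1..p+q} \<longrightarrow> \<tau> \<noteq> 0 \<and> c k = \<tau> *s e (vv ?I k)"
    proof (cases "k \<in> {1..p+q}")
      case True
      show ?thesis
      proof (cases "w k \<in> {q+1..p}")
        case mk: True
        then show ?thesis using middle[OF True mk] vv_simps(3)[OF I mk] by auto
      next
        case False
        from outer[OF True False] obtain \<tau> where "\<tau> \<noteq> 0 \<and> c k = \<tau> *s e (vv ?I k)" by (elim exE)
        then show ?thesis by (intro exI[of _ \<tau>] impI)
      qed
    next
      case nk: False
      show ?thesis by (rule exI[of _ 0], rule impI, erule notE[OF nk])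
    qed
  qed
  then have "\<exists>\<tau>. \<forall>k. k \<in> {1..p+q} \<longrightarrow> \<tau> k \<noteq> 0 \<and> c k = \<tau> k *s e (vv ?I k)" by (rule choice)
  then obtain \<tau> where t: "\<forall>k. k \<in> {1..p+q} \<longrightarrow> \<tau> k \<noteq> 0 \<and> c k = \<tau> k *s e (vv ?I k)" by (elim exE)
  have fe: "frame (e \<circ> vv ?I :: nat \<Rightarrow> 'n cvec)" by (rule oframe_frame[OF aframe_oframe[OF aframe_coord]])
  have "flag_of c = flag_of (\<lambda>k. \<tau> k *s (e \<circ> vv ?I) k)" using t card_n by (intro flag_of_cong fc) auto
  also have "\<dots> = EF ?I" by (rule flag_of_scale[OF fe]) (use t card_n in auto)
  finally show ?thesis .
qed

lemma sign_pattern: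
  assumes b: "relpos w b" and c: "oframe c s" and eq: "flag_of b = flag_of c" and k: "k \<in> {1..p+q}"
  shows "s k = sgn_of {i \<in> {1..q}. s (pa i) = -1} k"
proof -
  let ?I = "{i \<in> {1..q}. s (pa i) = -1}"
  have I: "?I \<subseteq> {1..q}" by auto
  have sa: "s (pa i) = 1 \<or> s (pa i) = -1" if "i \<in> {1..q}" for i using oframe_sign[OF c] pos_range[OF that] by blast
  have et: "eta i = -1" "eta (2*q - i + 1) = 1" if "i \<in> {1..q}" for i using that by (auto simp: eta_def)
  consider i where "i \<in> {1..q}" "k = pa i" | i where "i \<in> {1..q}" "k = pb i" | "w k \<in> {q+1..p}" using pos_cases[OF k] by blast
  then show ?thesis
  proof cases
    case (1 i)
    then show ?thesis using sa[OF 1(1)] et[OF 1(1)] vv_simps(1)[OF I 1(1)] by (auto simp: sgn_of_def)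
  next
    case (2 i)
    then show ?thesis using sa[OF 2(1)] et[OF 2(1)] vv_simps(2)[OF I 2(1)] pair_sign[OF b c eq 2(1)] by (auto simp: sgn_of_def)
  next
    case 3
    then show ?thesis using middle_sign[OF b c eq k 3] vv_simps(3)[OF I 3] by (simp add: sgn_of_def eta_def)
  qed
qed

section \<open>The Schubert variety of \<open>w\<close> inside the open orbits\<close>

lemma closure_cell:
  assumes F: "F \<in> flag_topology closure_of cell w" "F \<in> sflags s"
  shows "F \<in> cell w"
proof -
  have "F \<in> flags" using F(2) sflags_flags by blast
  then obtain v where v: "v permutes {1..p+q}" "F \<in> cell v" using bruhat by blast
  obtain b where b: "relpos v b" "F = flag_of b" using v(2) by (auto simp: cell_def)
  obtain c where c: "oframe c s" "F = flag_of c" using F(2) by (auto simp: sflags_def)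
  have "ballot (p+q) q 1 v" by (rule nondegenerate_ballot[OF v(1) b(1) c(1)]) (use b c in simp)
  then have "v = w"
    by (rule dominance_unique[OF q_pos q_le_p w pr mid v(1)]) (rule closure_dominance[OF w v(1) F(1) v(2)])
  then show ?thesis using v(2) by simp
qed

lemma schubert_cell: "schubert p q w = flag_topology closure_of cell w"
  unfolding schubert_def orbit_B_I[OF w] ..

lemma cell_subset: "cell w \<subseteq> schubert p q w"
  unfolding schubert_cell
proof (rule closure_of_subset)
  show "cell w \<subseteq> topspace flag_topology"
    unfolding topspace_flag_topology cell_def using relpos_frame(3)[OF w] flag_of_flags by blast
qed

lemma met_orbits_eq: "met_orbits p q (schubert p q w :: 'n flag set) = (\<lambda>I. sflags (sgn_of I)) ` Pow {1..q}"
proof (intro equalityI subsetI)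
  fix D :: "'n flag set" assume "D \<in> met_orbits p q (schubert p q w)"
  then have D: "D \<in> open_orbits p q" "schubert p q w \<inter> D \<noteq> {}" by (auto simp: met_orbits_def)
  obtain c0 s where s: "oframe c0 s" "D = sflags s" using D(1) open_orbits_iff by blast
  obtain F where F: "F \<in> schubert p q w" "F \<in> sflags s" using D(2) s(2) by blast
  then have "F \<in> cell w" using closure_cell schubert_cell by blast
  then obtain b where b: "relpos w b" "F = flag_of b" by (auto simp: cell_def)
  obtain c where c: "oframe c s" "F = flag_of c" using F(2) by (auto simp: sflags_def)
  have eq: "flag_of b = flag_of c" using b c by simp
  let ?I = "{i \<in> {1..q}. s (pa i) = -1}"
  have "D = sflags (sgn_of ?I)" unfolding s(2) by (rule sflags_cong) (rule sign_pattern[OF b(1) c(1) eq])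
  moreover have "?I \<in> Pow {1..q}" by auto
  ultimately show "D \<in> (\<lambda>I. sflags (sgn_of I)) ` Pow {1..q}" by (rule image_eqI)
next
  fix D assume "D \<in> (\<lambda>I. sflags (sgn_of I)) ` Pow {1..q}"
  then obtain I where I: "I \<subseteq> {1..q}" "D = sflags (sgn_of I)" by blast
  have "D \<in> open_orbits p q" using open_orbits_iff aframe_oframe[OF aframe_coord] I(2) by blast
  moreover have "EF I \<in> schubert p q w \<inter> D" using EF_cell[OF I(1)] cell_subset EF_aflags aflags_sflags I(2) by blast
  ultimately show "D \<in> met_orbits p q (schubert p q w)" unfolding met_orbits_def by blast
qed

lemma sgn_of_inj:
  assumes "I \<subseteq> {1..q}" "I' \<subseteq> {1..q}" "\<And>k. k \<in> {1..p+q} \<Longrightarrow> sgn_of I k = sgn_of I' k" shows "I = I'"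
proof -
  have "i \<in> I \<longleftrightarrow> i \<in> I'" if i: "i \<in> {1..q}" for i
  proof -
    have et: "eta i = -1" "eta (2*q - i + 1) = 1" using i by (auto simp: eta_def)
    have "sgn_of I (pa i) = sgn_of I' (pa i)" using assms(3) pos_range[OF i] by blast
    then show ?thesis unfolding sgn_of_def vv_simps(1)[OF assms(1) i] vv_simps(1)[OF assms(2) i] using et by (auto split: if_splits)
  qed
  then show ?thesis using assms(1,2) by blast
qed

lemma EF_sflags: "EF I \<in> sflags (sgn_of I)"
  using EF_aflags aflags_sflags by blast

lemma card_met_orbits: "card (met_orbits p q (schubert p q w :: 'n flag set)) = 2 ^ q"
proof -
  have "inj_on (\<lambda>I. sflags (sgn_of I)) (Pow {1..q})"
  proof (rule inj_onI)
    fix I I' assume a: "I \<in> Pow {1..q}" "I' \<in> Pow {1..q}" "sflags (sgn_of I) = sflags (sgn_of I')"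
    have "EF I \<in> sflags (sgn_of I')" using EF_sflags[of I] a(3) by simp
    then have "\<And>k. k \<in> {1..p+q} \<Longrightarrow> sgn_of I k = sgn_of I' k" by (rule sflags_sign_unique[OF EF_sflags])
    then show "I = I'" using a(1,2) by (intro sgn_of_inj) auto
  qed
  then show ?thesis unfolding met_orbits_eq by (simp add: card_image card_Pow)
qed

lemma schubert_base_cycle:
  assumes I: "I \<subseteq> {1..q}"
  shows "schubert p q w \<inter> base_cycle p q (sflags (sgn_of I)) = {EF I}"
  unfolding base_cycle_eq[OF aframe_coord]
proof (intro equalityI subsetI)
  fix F assume F: "F \<in> schubert p q w \<inter> aflags (sgn_of I)"
  then have "F \<in> cell w" using closure_cell schubert_cell aflags_sflags by blast
  then obtain b where b: "relpos w b" "F = flag_of b" by (auto simp: cell_def)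
  obtain c where c: "aframe c (sgn_of I)" "F = flag_of c" using F by (auto simp: aflags_def)
  have eq: "flag_of b = flag_of c" using b c by simp
  let ?I = "{i \<in> {1..q}. sgn_of I (pa i) = -1}"
  \<comment> \<open>The set read off from the signs at the positions \<open>pa i\<close> is
    \<open>I\<close> itself, because the signs determine the set.\<close>
  have "?I = I"
    by (rule sgn_of_inj[OF _ I]) (use sign_pattern[OF b(1) aframe_oframe[OF c(1)] eq] in auto)
  then show "F \<in> {EF I}" using adapted_coord[OF b(1) c(1) eq] c(2) by simp
next
  fix F assume "F \<in> {EF I}"
  then show "F \<in> schubert p q w \<inter> aflags (sgn_of I)" using EF_cell[OF I] cell_subset EF_aflags by blast
qed

lemma coord_flags_eq: "coord_flags p q w = EF ` Pow {1..q}"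
  unfolding coord_flags_def Perm_swp[OF q_le_p] vv_def by blast

lemma intersection_coord_flags:
  "(\<Union>D \<in> met_orbits p q (schubert p q w). schubert p q w \<inter> base_cycle p q D) = (coord_flags p q w :: 'n flag set)"
  unfolding met_orbits_eq coord_flags_eq using schubert_base_cycle by (simp add: UN_extend_simps) blast

text \<open>A nondegenerate flag of the Schubert variety betrays the word: its cell has a ballot
  word below \<open>w\<close>, and \<open>w\<close> is minimal among those.\<close>

lemma cell_unique:
  assumes v: "v permutes {1..p+q}" and F: "F \<in> cell v" "F \<in> schubert p q w" "F \<in> sflags s" 
  shows "v = w"
proof -
  obtain b where b: "relpos v b" "F = flag_of b" using F(1) by (auto simp: cell_def)
  obtain c where c: "oframe c s" "F = flag_of c" using F(3) by (auto simp: sflags_def)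
  have "ballot (p+q) q 1 v" by (rule nondegenerate_ballot[OF v b(1) c(1)]) (use b c in simp)
  moreover have "F \<in> flag_topology closure_of cell w" using F(2) schubert_cell by simp
  ultimately show "v = w"
    by (intro dominance_unique[OF q_pos q_le_p w pr mid v] closure_dominance[OF w v _ F(1)])
qed

end

section \<open>Schubert varieties of length \<open>p * q\<close> and the map to coordinate
  flags\<close>

context pq_form
begin

lemma strict_wordI: "strictly_pairing p q w \<Longrightarrow> strict_word TYPE('n) p q w"
  unfolding strictly_pairing_iff[OF q_le_p] strict_word_def strict_word_axioms_def using pq_form_axioms by blast

text \<open>An open set that meets the closure of a cell meets the cell.\<close>

lemma met_cell:
  assumes w: "w permutes {1..p+q}" and met: "met_orbits p q (schubert p q w :: 'n flag set) \<noteq> {}"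
  shows "\<exists>F s. F \<in> cell w \<and> F \<in> sflags s"
proof -
  obtain D :: "'n flag set" where D: "D \<in> open_orbits p q" "schubert p q w \<inter> D \<noteq> {}" using met by (auto simp: met_orbits_def)
  obtain c0 s where s: "oframe c0 s" "D = sflags s" using D(1) open_orbits_iff by blast
  obtain F where F: "F \<in> flag_topology closure_of cell w" "F \<in> sflags s"
    using D(2) s(2) unfolding schubert_def orbit_B_I[OF w] by blast
  have "\<forall>T. F \<in> T \<and> openin flag_topology T \<longrightarrow> (\<exists>y. y \<in> cell w \<and> y \<in> T)"
    using F(1) unfolding in_closure_of by (rule conjunct2)
  then have "\<exists>y. y \<in> cell w \<and> y \<in> sflags s" using conjI[OF F(2) open_sflags[of s]] by (elim allE impE)
  then show ?thesis by blast
qed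

lemma met_length:
  assumes w: "w permutes {1..p+q}" and met: "met_orbits p q (schubert p q w :: 'n flag set) \<noteq> {}"
  shows "perm_length (p + q) w = p * q \<longleftrightarrow> strictly_pairing p q w"
proof -
  obtain F s where F: "F \<in> cell w" "F \<in> sflags s" using met_cell[OF assms] by blast
  obtain b where b: "relpos w b" "F = flag_of b" using F(1) by (auto simp: cell_def)
  obtain c where c: "oframe c s" "F = flag_of c" using F(2) by (auto simp: sflags_def)
  have "ballot (p+q) q 1 w" by (rule nondegenerate_ballot[OF w b(1) c(1)]) (use b c in simp)
  then show ?thesis by (rule length_iff_strictly_pairing[OF q_pos q_le_p w])
qed

lemma Ipq_word:
  assumes "S \<in> (Ipq p q :: 'n flag set set)"
  shows "\<exists>w. strictly_pairing p q w \<and> S = schubert p q w"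
  using assms met_length unfolding Ipq_def by blast

text \<open>Membership in \<open>Ipq p q\<close> only provides some strictly pairing word with the
  same variety. The cell of \<open>v\<close> contains a nondegenerate flag of this variety, and
  \<open>cell_unique\<close> identifies the two words.\<close>

lemma Ipq_word_unique:
  assumes v: "v permutes {1..p+q}" and S: "(schubert p q v :: 'n flag set) \<in> Ipq p q"
  shows "strictly_pairing p q v"
proof -
  obtain w where w: "strictly_pairing p q w" "(schubert p q v :: 'n flag set) = schubert p q w" using Ipq_word[OF S] by blast
  interpret sw: strict_word p q ty w by (rule strict_wordI[OF w(1)])
  have "met_orbits p q (schubert p q v :: 'n flag set) \<noteq> {}" unfolding w(2) sw.met_orbits_eq by auto
  then obtain F s where F: "F \<in> cell v" "F \<in> sflags s" using met_cell[OF v] by blast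
  have "cell v \<subseteq> topspace flag_topology"
    unfolding topspace_flag_topology cell_def using relpos_frame(3)[OF v] flag_of_flags by blast
  then have "cell v \<subseteq> flag_topology closure_of cell v" by (rule closure_of_subset)
  then have "F \<in> flag_topology closure_of cell v" using F(1) by (rule subsetD)
  then have "F \<in> schubert p q v" unfolding schubert_def orbit_B_I[OF v] .
  then have "F \<in> schubert p q w" using w(2) by (simp only:)
  then have "v = w" by (rule sw.cell_unique[OF v F(1) _ F(2)])
  then show ?thesis using w(1) by simp
qed

lemma coord_flags_Fix_T:
  assumes "strictly_pairing p q w" shows "coord_flags p q w \<subseteq> (Fix_T :: 'n flag set)"
proof
  interpret sw: strict_word p q ty w by (rule strict_wordI[OF assms])
  fix F :: "'n flag" assume "F \<in> coord_flags p q w"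
  then obtain I where F: "F = sw.EF I" unfolding sw.coord_flags_eq by blast
  have fe: "frame (e \<circ> sw.vv I :: nat \<Rightarrow> 'n cvec)" by (rule oframe_frame[OF aframe_oframe[OF sw.aframe_coord]])
  show "F \<in> Fix_T"
    unfolding Fix_T_def mem_Collect_eq
  proof (intro conjI ballI impI)
    show "F \<in> flags" unfolding F by (rule flag_of_flags[OF fe])
    fix t :: "'n cmat" assume t: "t \<in> SL" "\<forall>i j. i \<noteq> j \<longrightarrow> t $ i $ j = 0"
    have "det t = (\<Prod>i\<in>UNIV. t $ i $ i)" by (rule det_diagonal) (use t(2) in blast)
    then have "(\<Prod>i\<in>UNIV. t $ i $ i) = 1" using t(1) by (simp add: SL_def)
    then have nz: "t $ i $ i \<noteq> 0" for i using prod_zero_iff[of UNIV "\<lambda>i. t $ i $ i"] by auto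
    have te: "t *v (e k :: 'n cvec) = (t $ idx k $ idx k) *s e k" for k
    proof -
      have *: "t $ i $ idx k = t $ idx k $ idx k * (if i = idx k then 1 else 0)" for i
        using t(2)[rule_format, of i "idx k"] by (cases "i = idx k") simp_all
      have c: "(t *v (e k :: 'n cvec)) $ i = t $ i $ idx k" for i
        by (simp only: e_def mult_axis column_def vec_lambda_beta)
      have "(t *v (e k :: 'n cvec)) $ i = ((t $ idx k $ idx k) *s e k) $ i" for i
        unfolding c vector_smult_component e_nth by (rule *)
      then show ?thesis unfolding vec_eq_iff by (rule allI)
    qed
    have "act t F = flag_of (\<lambda>k. (t $ idx (sw.vv I k) $ idx (sw.vv I k)) *s (e \<circ> sw.vv I) k)"
      unfolding F act_flag_of o_def te by (rule refl)
    also have "\<dots> = F" unfolding F by (rule flag_of_scale[OF fe]) (rule nz)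
    finally show "act t F = F" .
  qed
qed

text \<open>A common coordinate flag lies in the cell of \<open>v\<close> and in the Schubert
  variety of \<open>w\<close>, and it is nondegenerate.\<close>

lemma coord_flags_inj:
  assumes v: "strictly_pairing p q v" and w: "strictly_pairing p q w"
    and eq: "coord_flags p q v = (coord_flags p q w :: 'n flag set)"
  shows "v = w"
proof -
  interpret sv: strict_word p q ty v by (rule strict_wordI[OF v])
  interpret sw: strict_word p q ty w by (rule strict_wordI[OF w])
  have "sv.EF {} \<in> coord_flags p q w" unfolding eq[symmetric] sv.coord_flags_eq by blast
  then obtain I where I: "I \<subseteq> {1..q}" "sv.EF {} = sw.EF I" unfolding sw.coord_flags_eq by blast
  have "sv.EF {} \<in> schubert p q w" using sw.EF_cell[OF I(1)] sw.cell_subset I(2) by auto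
  then show ?thesis
    by (rule sw.cell_unique[OF sv.w sv.EF_cell[of "{}", OF empty_subsetI] _ sv.EF_sflags[of "{}"]])
qed

end

theorem theorem39:
  fixes p q :: nat
  assumes "1 \<le> q" and "q \<le> p" and "CARD('n::{finite,linorder}) = p + q"
  shows
    "(\<forall>w. w permutes {1..p+q} \<and> met_orbits p q (schubert p q w :: 'n flag set) \<noteq> {} \<longrightarrow>
        (perm_length (p + q) w = p * q \<longleftrightarrow> strictly_pairing p q w)) \<and>
     (\<forall>w. strictly_pairing p q w \<longrightarrow>
        card (met_orbits p q (schubert p q w :: 'n flag set)) = 2 ^ q \<and>
        (\<forall>D \<in> met_orbits p q (schubert p q w :: 'n flag set).
           \<exists>!F. F \<in> schubert p q w \<inter> base_cycle p q D)) \<and>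
     (\<exists>f. f \<in> (Ipq p q :: 'n flag set set) \<rightarrow> Pow Fix_T \<and>
        (\<forall>w. w permutes {1..p+q} \<and> (schubert p q w :: 'n flag set) \<in> Ipq p q \<longrightarrow>
           f (schubert p q w) = coord_flags p q w) \<and>
        inj_on f (Ipq p q) \<and>
        (\<forall>S \<in> Ipq p q. f S = (\<Union>D \<in> met_orbits p q S. S \<inter> base_cycle p q D)))"
proof -
  interpret pq_form p q "TYPE('n)" by unfold_locales (use assms in auto)
  \<comment> \<open>Defined through the intersections, \<open>f\<close> depends on the variety
    alone; that it gives the coordinate flags of every word representing the variety is then a
    statement to be proved.\<close>
  define f :: "'n flag set \<Rightarrow> 'n flag set" where "f S = (\<Union>D \<in> met_orbits p q S. S \<inter> base_cycle p q D)" for S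
  have f: "f (schubert p q w) = coord_flags p q w" if "strictly_pairing p q w" for w
  proof -
    interpret sw: strict_word p q "TYPE('n)" w by (rule strict_wordI[OF that])
    show ?thesis unfolding f_def by (rule sw.intersection_coord_flags)
  qed
  show ?thesis
  proof (intro conjI)
    show "\<forall>w. w permutes {1..p+q} \<and> met_orbits p q (schubert p q w :: 'n flag set) \<noteq> {} \<longrightarrow>
        (perm_length (p + q) w = p * q \<longleftrightarrow> strictly_pairing p q w)"
      using met_length by blast
    show "\<forall>w. strictly_pairing p q w \<longrightarrow>
        card (met_orbits p q (schubert p q w :: 'n flag set)) = 2 ^ q \<and>
        (\<forall>D \<in> met_orbits p q (schubert p q w :: 'n flag set). \<exists>!F. F \<in> schubert p q w \<inter> base_cycle p q D)"
    proof (intro allI impI conjI ballI)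
      fix w assume w: "strictly_pairing p q w"
      interpret sw: strict_word p q "TYPE('n)" w by (rule strict_wordI[OF w])
      show "card (met_orbits p q (schubert p q w :: 'n flag set)) = 2 ^ q" by (rule sw.card_met_orbits)
      fix D :: "'n flag set" assume "D \<in> met_orbits p q (schubert p q w)"
      then obtain I where I: "I \<subseteq> {1..q}" "D = sflags (sw.sgn_of I)" unfolding sw.met_orbits_eq by blast
      show "\<exists>!F. F \<in> schubert p q w \<inter> base_cycle p q D"
        unfolding I(2) sw.schubert_base_cycle[OF I(1)] by simp
    qed
    show "\<exists>f. f \<in> (Ipq p q :: 'n flag set set) \<rightarrow> Pow Fix_T \<and>
        (\<forall>w. w permutes {1..p+q} \<and> (schubert p q w :: 'n flag set) \<in> Ipq p q \<longrightarrow>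
           f (schubert p q w) = coord_flags p q w) \<and>
        inj_on f (Ipq p q) \<and>
        (\<forall>S \<in> Ipq p q. f S = (\<Union>D \<in> met_orbits p q S. S \<inter> base_cycle p q D))"
    proof (intro exI[of _ f] conjI)
      show "f \<in> (Ipq p q :: 'n flag set set) \<rightarrow> Pow Fix_T"
      proof
        fix S :: "'n flag set" assume "S \<in> Ipq p q"
        then obtain w where "strictly_pairing p q w" "S = schubert p q w" using Ipq_word by blast
        then show "f S \<in> Pow Fix_T" using f coord_flags_Fix_T by auto
      qed
      show "\<forall>w. w permutes {1..p+q} \<and> (schubert p q w :: 'n flag set) \<in> Ipq p q \<longrightarrow> f (schubert p q w) = coord_flags p q w"
        using f Ipq_word_unique by blast
      show "inj_on f (Ipq p q)"
      proof (rule inj_onI)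
        fix S T :: "'n flag set" assume ST: "S \<in> Ipq p q" "T \<in> Ipq p q" "f S = f T"
        obtain v where v: "strictly_pairing p q v" "S = schubert p q v" using Ipq_word[OF ST(1)] by blast
        obtain w where w: "strictly_pairing p q w" "T = schubert p q w" using Ipq_word[OF ST(2)] by blast
        have "v = w" by (rule coord_flags_inj[OF v(1) w(1)]) (use ST(3) f v w in simp)
        then show "S = T" using v w by simp
      qed
      show "\<forall>S \<in> Ipq p q. f S = (\<Union>D \<in> met_orbits p q S. S \<inter> base_cycle p q D)"
        unfolding f_def by blast
    qed
  qed
qed

end
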